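(* Let $\mathfrak G\subset\mathbb C^{c\times c}$ be a matrix Lie group with Lie algebra $\mathfrak g\subset\mathbb C^{c\times c}$ satisfying $\mathfrak g^\dagger=\mathfrak g$, and let $\Pi:\mathbb C^{c\times c}\to\mathfrak g$ be the real-orthogonal projection on $\mathfrak g$. Let $\mathcal L$ be a matter proto-Lagrangian leading to a real-valued Lagrangian functional, with the property that for all $P\in\mathbb C^{r\times c}$, $R\in\mathbb C^{Nr\times c}$, $x\in\mathbb R^N$ and $1\le\kappa\le N$, $$\Pi\Big(\tfrac1{\mathrm i}\,P^\dagger\big[\mathcal L^{(\kappa)\dagger}(P;P^\dagger;R;R^\dagger;x)-\mathcal L^{(\kappa\star)}(P;P^\dagger;R;R^\dagger;x)\big]\Big)=0 .$$ Let $\mathcal G$ be a gauge proto-Lagrangian (real on $\mathfrak g$). Consider the dynamically extended Lagrangian density $\mathcal L_{\Psi,A}(x)+\mathcal G_A(x)$ for $\Psi\in C^\infty(\mathbb R^N;\mathbb C^{r\times c})$ and $A_\mu\in C^\infty(\mathbb R^N;\mathfrak g)$, $1\le\mu\le N$. (i) The Euler–Lagrange equations of this density are $$\mathcal L^{(o)}_{\Psi,A}-\sum_{\mu=1}^N\Big(\frac{\partial}{\partial x^\mu}\mathcal L^{(\mu)}_{\Psi,A}-A_\mu\mathcal L^{(\mu)}_{\Psi,A}\Big)=0,$$ $$\Pi\Big(\Psi^\dagger\big[\mathcal L^{(\kappa)\dagger}_{\Psi,A}+\mathcal L^{(\kappa\star)}_{\Psi,A}\big]\Big)-2\sum_{\mu=1}^N\Big(\partial_\mu\,\Pi\hat{\mathcal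 G}^{(\mu\kappa)}_A-\big[A_\mu,\Pi\hat{\mathcal G}^{(\mu\kappa)}_A\big]\Big)^\dagger=0,\qquad 1\le\kappa\le N .$$ (ii) In the special case $\mathfrak g=\mathfrak g_J=\{X\in\mathbb C^{c\times c}: X^\dagger J+JX=0\}$ with $J=J^\dagger=J^{-1}$, the second set of equations can be rewritten as $$\mathcal L^{(\kappa)}_{\Psi,A}\Psi-J\Psi^\dagger\mathcal L^{(\kappa\star)}_{\Psi,A}J-2\sum_{\mu=1}^N\Big(\partial_\mu\,\Pi\hat{\mathcal G}^{(\mu\kappa)}_A-\big[A_\mu,\Pi\hat{\mathcal G}^{(\mu\kappa)}_A\big]\Big)=0,\qquad 1\le\kappa\le N .$$
   Context: Fix positive integers $N,r,c$; $^\dagger$ is the conjugate transpose and $[X,Y]=XY-YX$ for $c\times c$ matrices. $\mathfrak g$ is a real linear subspace of $\mathbb C^{c\times c}$. $\Pi$ is orthogonal for the real inner product $(X,Y)\mapsto\mathrm{Re}\,\mathrm{Tr}[X^\dagger Y]$. Derivative convention: for a function $F$ of a matrix $Z\in\mathbb C^{p\times q}$, $\partial F/\partial Z$ is the $q\times p$ matrix with $(i,j)$ entry $\partial F/\partial Z_{ji}$. Matter proto-Lagrangian: a smooth function $\mathcal L:\mathbb C^{r\times c}\times\mathbb C^{c\times r}\times\mathbb C^{Nr\times c}\times\mathbb C^{c\times Nr}\times\mathbb R^N\to\mathbb C$, $(P;Q^\top;R;S^\top;x)\mapsto\mathcal L(P;Q^\top;R;S^\top;x)$, holomorphic in the matrix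 arguments and vanishing when these are all $0$; $R=\mathrm{col}[R_1,\dots,R_N]$, $R_\mu\in\mathbb C^{r\times c}$, $S^\top=\mathrm{row}[S_1^\top,\dots,S_N^\top]$, $S_\mu^\top\in\mathbb C^{c\times r}$. The complex partial derivatives with respect to $P,Q^\top,R_\mu,S^\top_\mu$ are $\mathcal L^{(o)},\mathcal L^{(o\star)},\mathcal L^{(\mu)},\mathcal L^{(\mu\star)}$. "$\mathcal L$ leads to a real-valued Lagrangian functional" means $\int_{\mathbb R^N}\mathcal L(\Psi;\Psi^\dagger;\nabla\Psi;\nabla\Psi^\dagger;x)\,dx\in\mathbb R$ for all $\Psi$ in a space of smooth functions $\mathbb R^N\to\mathbb C^{r\times c}$ on which the integral converges absolutely; this space contains all compactly supported smooth functions. Here $\nabla\Psi=\mathrm{col}[\partial_\mu\Psi]_\mu$, $\nabla\Psi^\dagger=\mathrm{row}[\partial_\mu\Psi^\dagger]_\mu$. Static extension: $\mathcal L_{\Psi,A}(x)=\mathcal L(\Psi;\Psi^\dagger;\mathrm{col}[\partial_\mu\Psi+\Psi A_\mu]_\mu;\mathrm{row}[\partial_\mu\Psi^\dagger+A_\mu^\dagger\Psi^\dagger]_\mu;x)$, all functions evaluated at $x$; $\mathcal L^{(o)}_{\Psi,A}$, $\mathcal L^{(\mu)}_{\Psi,A}$, $\mathcal L^{(\mu\star)}_{\Psi,A}$ denote the functions of $x$ obtained by the same substitution in the derivatives. Gauge proto-Lagrangian: a smooth function $\mathcal G(\dots,P_{\mu\nu},\dots;\dots,Q_{\theta\rho\star},\dots;x)\in\mathbb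 C$ of matrices $P_{\mu\nu}\in\mathbb C^{c\times c}$ ($1\le\mu<\nu\le N$), $Q_{\theta\rho\star}\in\mathbb C^{c\times c}$ ($1\le\theta<\rho\le N$) and $x\in\mathbb R^N$, holomorphic in the matrices, with partial derivatives $\mathcal G^{(\mu\nu)}=\partial\mathcal G/\partial P_{\mu\nu}$, $\mathcal G^{(\theta\rho\star)}=\partial\mathcal G/\partial Q_{\theta\rho\star}$, such that $\mathcal G(\dots,P_{\mu\nu},\dots;\dots,P_{\theta\rho}^\dagger,\dots;x)\in\mathbb R$ whenever all $P_{\mu\nu}\in\mathfrak g$. Put $F_{\mu\nu}=\partial_\mu A_\nu-\partial_\nu A_\mu-[A_\mu,A_\nu]$ and $\mathcal G_A(x)=\mathcal G(\dots,F_{\mu\nu}(x),\dots;\dots,F_{\theta\rho}^\dagger(x),\dots;x)$; $\mathcal G^{(\mu\nu)}_A$, $\mathcal G^{(\theta\rho\star)}_A$ denote the derivatives with the same substitution. The standing relation $\mathcal G^{(\theta\rho\star)}_A=(\mathcal G^{(\theta\rho)}_A)^\dagger$ is in force. Define $\hat{\mathcal G}^{(\mu\nu)}_A=\mathcal G^{(\mu\nu)}_A$ if $\mu<\nu$, $0$ if $\mu=\nu$, and $-\mathcal G^{(\nu\mu)}_A$ if $\mu>\nu$. Euler–Lagrange equations: the conditions, for $(\Psi,A_1,\dots,A_N)$, equivalent to stationarity of the integral of the density, i.e. for real $\varepsilon$ the derivative at $\varepsilon=0$ of the integral of the difference between perturbed and unperturbed density vanishes, for all perturbations $\Psi\to\Psi+\varepsilon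 H$ with $H\in C_c^\infty(\mathbb R^N;\mathbb C^{r\times c})$, and for each $\kappa$ for all perturbations $A_\kappa\to A_\kappa+\varepsilon H$ with $H\in C_c^\infty(\mathbb R^N;\mathfrak g)$. *)

theory Defs
  imports "HOL-Analysis.Analysis"
begin

text \<open>
  A \<open>p \<times> q\<close> complex matrix has type \<open>complex^'q^'p\<close>. The dimensions \<open>N\<close>, \<open>r\<close>, \<open>c\<close> are the
  cardinalities of \<open>'n\<close>, \<open>'r\<close>, \<open>'c\<close>; the index type \<open>'n\<close> is linearly ordered because the
  matrices \<open>P\<^sub>\<mu>\<^sub>\<nu>\<close> are indexed by the pairs \<open>\<mu> < \<nu>\<close>.
\<close>

section \<open>Smooth functions\<close>

text \<open>
  On a finite-dimensional domain, \<open>C\<^sup>k\<close> may be tested on directional derivatives, which avoids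
  iterating over spaces of linear maps.
\<close>

primrec C_k :: "nat \<Rightarrow> ('a::real_normed_vector \<Rightarrow> 'b::real_normed_vector) \<Rightarrow> bool" where
  "C_k 0 f \<longleftrightarrow> continuous_on UNIV f"
| "C_k (Suc k) f \<longleftrightarrow>
     (\<forall>x. f differentiable (at x)) \<and> (\<forall>v. C_k k (\<lambda>x. frechet_derivative f (at x) v))"

definition smooth :: "('a::euclidean_space \<Rightarrow> 'b::real_normed_vector) \<Rightarrow> bool" where
  "smooth f \<longleftrightarrow> (\<forall>k. C_k k f)"

definition test_function :: "('a::euclidean_space \<Rightarrow> 'b::real_normed_vector) \<Rightarrow> bool" where
  "test_function H \<longleftrightarrow> smooth H \<and> compact (closure {x. H x \<noteq> 0})"

definition partial_d :: "'n::finite \<Rightarrow> (real^'n \<Rightarrow> 'b::real_normed_vector) \<Rightarrow> real^'n \<Rightarrow> 'b" where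
  "partial_d \<mu> f x = frechet_derivative f (at x) (axis \<mu> 1)"


section \<open>Complex matrices\<close>

definition dagger :: "complex^'q^'p \<Rightarrow> complex^'p^'q"  (\<open>_\<^sup>\<dagger>\<close> [1000] 999) where
  "X\<^sup>\<dagger> = transpose (map_matrix cnj X)"

definition cscale :: "complex \<Rightarrow> complex^'q^'p \<Rightarrow> complex^'q^'p" where
  "cscale a X = map_matrix ((*) a) X"

definition commutator :: "complex^'c^'c \<Rightarrow> complex^'c^'c \<Rightarrow> complex^'c^'c" where
  "commutator X Y = X ** Y - Y ** X"

definition upd_entry :: "complex^'q^'p \<Rightarrow> 'p \<Rightarrow> 'q \<Rightarrow> complex \<Rightarrow> complex^'q^'p" where
  "upd_entry Z i j z = (\<chi> a b. if a = i \<and> b = j then z else Z $ a $ b)"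

text \<open>The derivative is transposed: its \<open>(i, j)\<close> entry is \<open>\<partial>F/\<partial>Z\<^sub>j\<^sub>i\<close>.\<close>

definition matrix_deriv :: "(complex^'q^'p \<Rightarrow> complex) \<Rightarrow> complex^'q^'p \<Rightarrow> complex^'p^'q" where
  "matrix_deriv F Z = (\<chi> i j. deriv (\<lambda>z. F (upd_entry Z j i z)) (Z $ j $ i))"

text \<open>
  Holomorphy is required in each entry separately. It is only used for functions that are moreover
  jointly smooth, hence continuous, so this is holomorphy in several complex variables.
\<close>

definition matrix_holomorphic :: "(complex^'q^'p \<Rightarrow> complex) \<Rightarrow> bool" where
  "matrix_holomorphic F \<longleftrightarrow> (\<forall>Z i j. (\<lambda>z. F (upd_entry Z i j z)) holomorphic_on UNIV)"

text \<open>
  Block columns in \<open>\<complex>\<^sup>N\<^sup>r\<^sup>\<times>\<^sup>c\<close> and block rows in \<open>\<complex>\<^sup>c\<^sup>\<times>\<^sup>N\<^sup>r\<close>; the \<open>Nr\<close> long index is a pair in \<open>'n \<times> 'r\<close>.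
\<close>

definition block_col :: "('n::finite \<Rightarrow> complex^'c^'r) \<Rightarrow> complex^'c^('n \<times> 'r::finite)" where
  "block_col R = (\<chi> p j. R (fst p) $ snd p $ j)"

definition block_row :: "('n::finite \<Rightarrow> complex^'r^'c) \<Rightarrow> complex^('n \<times> 'r::finite)^'c" where
  "block_row S = (\<chi> i p. S (fst p) $ i $ snd p)"

definition col_block :: "complex^'c^('n::finite \<times> 'r::finite) \<Rightarrow> 'n \<Rightarrow> complex^'c^'r" where
  "col_block R \<mu> = (\<chi> i j. R $ (\<mu>, i) $ j)"

definition row_block :: "complex^('n::finite \<times> 'r::finite)^'c \<Rightarrow> 'n \<Rightarrow> complex^'r^'c" where
  "row_block S \<mu> = (\<chi> i j. S $ i $ (\<mu>, j))"


section \<open>Matrix Lie groups\<close>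

definition matrix_exp :: "complex^'c^'c \<Rightarrow> complex^'c^'c" where
  "matrix_exp X = (\<Sum>k. (1 / fact k) *\<^sub>R (((**) X ^^ k) (mat 1)))"

definition matrix_Lie_group :: "(complex^'c^'c) set \<Rightarrow> bool" where
  "matrix_Lie_group G \<longleftrightarrow>
     G \<subseteq> {X. invertible X} \<and> mat 1 \<in> G \<and>
     (\<forall>X\<in>G. \<forall>Y\<in>G. X ** Y \<in> G) \<and> (\<forall>X\<in>G. matrix_inv X \<in> G) \<and>
     closedin (top_of_set {X. invertible X}) G"

definition Lie_algebra :: "(complex^'c^'c) set \<Rightarrow> (complex^'c^'c) set" where
  "Lie_algebra G = {X. \<forall>t::real. matrix_exp (t *\<^sub>R X) \<in> G}"

definition real_orthogonal_projection ::
    "(complex^'c^'c) set \<Rightarrow> (complex^'c^'c \<Rightarrow> complex^'c^'c) \<Rightarrow> bool" where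
  "real_orthogonal_projection V proj \<longleftrightarrow>
     (\<forall>X. proj X \<in> V \<and> (\<forall>Y\<in>V. Re (trace (Y\<^sup>\<dagger> ** (X - proj X))) = 0))"


section \<open>Matter proto-Lagrangians\<close>

type_synonym ('n, 'r, 'c) matter_field = "real^'n \<Rightarrow> complex^'c^'r"

type_synonym ('n, 'c) potential = "'n \<Rightarrow> real^'n \<Rightarrow> complex^'c^'c"

text \<open>The arguments are \<open>(P, Q\<^sup>T, R, S\<^sup>T, x)\<close>.\<close>

type_synonym ('n, 'r, 'c) matter_arg =
  "(complex^'c^'r) \<times> (complex^'r^'c) \<times> (complex^'c^('n \<times> 'r)) \<times> (complex^('n \<times> 'r)^'c) \<times> (real^'n)"

definition matter_proto_lagrangian ::
    "(('n::finite, 'r::finite, 'c::finite) matter_arg \<Rightarrow> complex) \<Rightarrow> bool" where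
  "matter_proto_lagrangian L \<longleftrightarrow>
     smooth L \<and>
     (\<forall>P Q R S x.
        matrix_holomorphic (\<lambda>Z. L (Z, Q, R, S, x)) \<and>
        matrix_holomorphic (\<lambda>Z. L (P, Z, R, S, x)) \<and>
        matrix_holomorphic (\<lambda>Z. L (P, Q, Z, S, x)) \<and>
        matrix_holomorphic (\<lambda>Z. L (P, Q, R, Z, x))) \<and>
     (\<forall>x. L (0, 0, 0, 0, x) = 0)"

text \<open>
  \<open>L_o\<close>, \<open>L_col\<close>, \<open>L_row\<close> are the derivatives with respect to \<open>P\<close>, \<open>R\<^sub>\<mu>\<close>, \<open>S\<^sub>\<mu>\<^sup>T\<close>, that is, the
  functions \<open>L\<^sup>(\<^sup>o\<^sup>)\<close>, \<open>L\<^sup>(\<^sup>\<mu>\<^sup>)\<close>, \<open>L\<^sup>(\<^sup>\<mu>\<^sup>\<star>\<^sup>)\<close>.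
\<close>

fun L_o :: "(('n::finite, 'r::finite, 'c::finite) matter_arg \<Rightarrow> complex) \<Rightarrow>
    ('n, 'r, 'c) matter_arg \<Rightarrow> complex^'r^'c" where
  "L_o L (P, Q, R, S, x) = matrix_deriv (\<lambda>Z. L (Z, Q, R, S, x)) P"

fun L_col :: "(('n::finite, 'r::finite, 'c::finite) matter_arg \<Rightarrow> complex) \<Rightarrow> 'n \<Rightarrow>
    ('n, 'r, 'c) matter_arg \<Rightarrow> complex^'r^'c" where
  "L_col L \<mu> (P, Q, R, S, x) =
     matrix_deriv (\<lambda>Z. L (P, Q, block_col ((col_block R)(\<mu> := Z)), S, x)) (col_block R \<mu>)"

fun L_row :: "(('n::finite, 'r::finite, 'c::finite) matter_arg \<Rightarrow> complex) \<Rightarrow> 'n \<Rightarrow>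
    ('n, 'r, 'c) matter_arg \<Rightarrow> complex^'c^'r" where
  "L_row L \<mu> (P, Q, R, S, x) =
     matrix_deriv (\<lambda>Z. L (P, Q, R, block_row ((row_block S)(\<mu> := Z)), x)) (row_block S \<mu>)"

definition free_arg ::
    "('n, 'r, 'c) matter_field \<Rightarrow> real^'n \<Rightarrow> ('n::finite, 'r::finite, 'c::finite) matter_arg" where
  "free_arg \<Psi> x =
     (\<Psi> x, (\<Psi> x)\<^sup>\<dagger>,
      block_col (\<lambda>\<mu>. partial_d \<mu> \<Psi> x),
      block_row (\<lambda>\<mu>. partial_d \<mu> (\<lambda>y. (\<Psi> y)\<^sup>\<dagger>) x), x)"

definition real_valued_functional ::
    "(('n::finite, 'r::finite, 'c::finite) matter_arg \<Rightarrow> complex) \<Rightarrow> bool" where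
  "real_valued_functional L \<longleftrightarrow>
     (\<exists>V. (\<forall>\<Psi>\<in>V. smooth \<Psi>) \<and> (\<forall>\<Psi>. test_function \<Psi> \<longrightarrow> \<Psi> \<in> V) \<and>
        (\<forall>\<Psi>\<in>V. integrable lborel (\<lambda>x. L (free_arg \<Psi> x)) \<and>
           (\<integral>x. L (free_arg \<Psi> x) \<partial>lborel) \<in> \<real>))"

text \<open>
  The arguments substituted in the static extension: \<open>L\<^sub>\<Psi>\<^sub>,\<^sub>A(x)\<close> is \<open>L (static_arg \<Psi> A x)\<close>, and likewise
  for the derivatives of \<open>L\<close>.
\<close>

definition static_arg ::
    "('n, 'r, 'c) matter_field \<Rightarrow> ('n, 'c) potential \<Rightarrow> real^'n \<Rightarrow>
     ('n::finite, 'r::finite, 'c::finite) matter_arg" where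
  "static_arg \<Psi> A x =
     (\<Psi> x, (\<Psi> x)\<^sup>\<dagger>,
      block_col (\<lambda>\<mu>. partial_d \<mu> \<Psi> x + \<Psi> x ** A \<mu> x),
      block_row (\<lambda>\<mu>. partial_d \<mu> (\<lambda>y. (\<Psi> y)\<^sup>\<dagger>) x + (A \<mu> x)\<^sup>\<dagger> ** (\<Psi> x)\<^sup>\<dagger>), x)"


section \<open>Gauge proto-Lagrangians\<close>

text \<open>
  The arguments are \<open>(P, Q, x)\<close> with arrays \<open>P $ \<mu> $ \<nu>\<close> and \<open>Q $ \<theta> $ \<rho>\<close>, of which only the
  entries with \<open>\<mu> < \<nu>\<close> and \<open>\<theta> < \<rho>\<close> are meaningful: a gauge proto-Lagrangian must not depend on
  the others. (A separate index type of increasing pairs would be empty for \<open>N = 1\<close>.)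
\<close>

type_synonym ('n, 'c) gauge_arg =
  "(complex^'c^'c^'n^'n) \<times> (complex^'c^'c^'n^'n) \<times> (real^'n)"

definition upd_block :: "'a^'n^'n \<Rightarrow> 'n \<Rightarrow> 'n \<Rightarrow> 'a \<Rightarrow> 'a^'n^'n" where
  "upd_block P \<mu> \<nu> Z = (\<chi> a b. if a = \<mu> \<and> b = \<nu> then Z else P $ a $ b)"

definition gauge_proto_lagrangian ::
    "(complex^'c^'c) set \<Rightarrow> (('n::{finite,linorder}, 'c::finite) gauge_arg \<Rightarrow> complex) \<Rightarrow> bool" where
  "gauge_proto_lagrangian \<gg> G \<longleftrightarrow>
     (\<forall>P P' Q Q' x.
        (\<forall>\<mu> \<nu>. \<mu> < \<nu> \<longrightarrow> P $ \<mu> $ \<nu> = P' $ \<mu> $ \<nu> \<and> Q $ \<mu> $ \<nu> = Q' $ \<mu> $ \<nu>) \<longrightarrow>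
        G (P, Q, x) = G (P', Q', x)) \<and>
     smooth G \<and>
     (\<forall>P Q x \<mu> \<nu>. \<mu> < \<nu> \<longrightarrow>
        matrix_holomorphic (\<lambda>Z. G (upd_block P \<mu> \<nu> Z, Q, x)) \<and>
        matrix_holomorphic (\<lambda>Z. G (P, upd_block Q \<mu> \<nu> Z, x))) \<and>
     (\<forall>P x. (\<forall>\<mu> \<nu>. \<mu> < \<nu> \<longrightarrow> P $ \<mu> $ \<nu> \<in> \<gg>) \<longrightarrow> G (P, \<chi> \<mu> \<nu>. (P $ \<mu> $ \<nu>)\<^sup>\<dagger>, x) \<in> \<real>)"

fun G_P :: "(('n::finite, 'c::finite) gauge_arg \<Rightarrow> complex) \<Rightarrow> 'n \<Rightarrow> 'n \<Rightarrow>
    ('n, 'c) gauge_arg \<Rightarrow> complex^'c^'c" where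
  "G_P G \<mu> \<nu> (P, Q, x) = matrix_deriv (\<lambda>Z. G (upd_block P \<mu> \<nu> Z, Q, x)) (P $ \<mu> $ \<nu>)"

fun G_Q :: "(('n::finite, 'c::finite) gauge_arg \<Rightarrow> complex) \<Rightarrow> 'n \<Rightarrow> 'n \<Rightarrow>
    ('n, 'c) gauge_arg \<Rightarrow> complex^'c^'c" where
  "G_Q G \<theta> \<rho> (P, Q, x) = matrix_deriv (\<lambda>Z. G (P, upd_block Q \<theta> \<rho> Z, x)) (Q $ \<theta> $ \<rho>)"

definition gauge_field ::
    "(complex^'c^'c) set \<Rightarrow> ('n::finite, 'c::finite) potential \<Rightarrow> bool" where
  "gauge_field \<gg> A \<longleftrightarrow> (\<forall>\<mu>. smooth (A \<mu>) \<and> (\<forall>x. A \<mu> x \<in> \<gg>))"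

definition curvature ::
    "('n, 'c) potential \<Rightarrow> 'n \<Rightarrow> 'n \<Rightarrow> real^'n \<Rightarrow> complex^'c^'c" where
  "curvature A \<mu> \<nu> x =
     partial_d \<mu> (A \<nu>) x - partial_d \<nu> (A \<mu>) x - commutator (A \<mu> x) (A \<nu> x)"

definition gauge_arg_of ::
    "('n, 'c) potential \<Rightarrow> real^'n \<Rightarrow> ('n::finite, 'c::finite) gauge_arg" where
  "gauge_arg_of A x = (\<chi> \<mu> \<nu>. curvature A \<mu> \<nu> x, \<chi> \<theta> \<rho>. (curvature A \<theta> \<rho> x)\<^sup>\<dagger>, x)"

definition G_hat ::
    "(('n::{finite,linorder}, 'c::finite) gauge_arg \<Rightarrow> complex) \<Rightarrow>
     ('n, 'c) potential \<Rightarrow> 'n \<Rightarrow> 'n \<Rightarrow> (real, 'n) vec \<Rightarrow> complex^'c^'c" where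
  "G_hat G A \<mu> \<nu> x =
     (if \<mu> < \<nu> then G_P G \<mu> \<nu> (gauge_arg_of A x)
      else if \<mu> = \<nu> then 0
      else - G_P G \<nu> \<mu> (gauge_arg_of A x))"


section \<open>Stationarity of the dynamically extended density\<close>

definition dyn_density ::
    "(('n::{finite,linorder}, 'r::finite, 'c::finite) matter_arg \<Rightarrow> complex) \<Rightarrow>
     (('n, 'c) gauge_arg \<Rightarrow> complex) \<Rightarrow>
     ('n, 'r, 'c) matter_field \<Rightarrow> ('n, 'c) potential \<Rightarrow> (real, 'n) vec \<Rightarrow> complex" where
  "dyn_density L G \<Psi> A x = L (static_arg \<Psi> A x) + G (gauge_arg_of A x)"

definition stationary_matter ::
    "(('n::{finite,linorder}, 'r::finite, 'c::finite) matter_arg \<Rightarrow> complex) \<Rightarrow>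
     (('n, 'c) gauge_arg \<Rightarrow> complex) \<Rightarrow>
     ('n, 'r, 'c) matter_field \<Rightarrow> ('n, 'c) potential \<Rightarrow> bool" where
  "stationary_matter L G \<Psi> A \<longleftrightarrow>
     (\<forall>H. test_function H \<longrightarrow>
        ((\<lambda>\<epsilon>::real. \<integral>x. dyn_density L G (\<lambda>y. \<Psi> y + \<epsilon> *\<^sub>R H y) A x - dyn_density L G \<Psi> A x \<partial>lborel)
           has_vector_derivative 0) (at 0))"

definition stationary_gauge ::
    "(complex^'c^'c) set \<Rightarrow>
     (('n::{finite,linorder}, 'r::finite, 'c::finite) matter_arg \<Rightarrow> complex) \<Rightarrow>
     (('n, 'c) gauge_arg \<Rightarrow> complex) \<Rightarrow>
     ('n, 'r, 'c) matter_field \<Rightarrow> ('n, 'c) potential \<Rightarrow> 'n \<Rightarrow> bool" where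
  "stationary_gauge \<gg> L G \<Psi> A \<kappa> \<longleftrightarrow>
     (\<forall>H. test_function H \<and> (\<forall>x. H x \<in> \<gg>) \<longrightarrow>
        ((\<lambda>\<epsilon>::real. \<integral>x. dyn_density L G \<Psi> (A(\<kappa> := (\<lambda>y. A \<kappa> y + \<epsilon> *\<^sub>R H y))) x
                         - dyn_density L G \<Psi> A x \<partial>lborel)
           has_vector_derivative 0) (at 0))"

end

theory Submission
  imports Defs
begin

text \<open>
  The first variation of the density is an integral of the derivative of \<open>L\<close> (or \<open>G\<close>) along the
  variation, which by holomorphy is a sum of traces against the matrix derivatives; integration by
  parts and the fundamental lemma of the calculus of variations then give the equations.

  For variations of \<open>\<Psi>\<close>, the first variation has a complex linear and an antilinear part in \<open>H\<close>, and
  the Euler-Lagrange equation only expresses that the linear part vanishes. The antilinear part is its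
  conjugate because the first variation is real: the condition on \<open>proj\<close> makes the imaginary part of
  \<open>L\<close> independent of the potential, and without potential the functional is real.

  For variations of the potential, the same condition and the relation between \<open>G_Q\<close> and \<open>G_P\<close> turn
  the traces into real inner products with \<open>H\<close>. These determine a matrix function with values in \<open>\<gg>\<close>,
  because \<open>\<gg>\<close> is closed under brackets and \<open>proj\<close> commutes with the conjugate transpose.
\<close>

section \<open>Calculus of smooth functions\<close>

text \<open>The variation parameter is real, so stationarity along \<open>H\<close> controls only a
  real-linear functional M of \<open>H\<close>, whereas the matter equation is a complex linear
  statement. Comparing \<open>H\<close> with i \<open>H\<close>, one finds that M(H) - i M(i H) is
  twice the linear part; when this vanishes, the reality of M(H) and M(i H) forces both to be 0.
  That reality is delicate: it is guaranteed only without potential and for compactly supported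
  fields, while \<open>\<Psi>\<close> is arbitrary and the integral of its density may diverge.
  Hence only differences of densities are integrated. In the gauge equations the test functions have
  values in \<open>\<gg>\<close> and detect only the component in \<open>\<gg>\<close>, so the
  left-hand side must lie in \<open>\<gg>\<close> itself; this is why \<open>G_hat\<close> is
  projected before its covariant derivative is taken. Closure under brackets has to be derived from
  the group, because \<open>Lie_algebra\<close> is defined by one-parameter subgroups.\<close>

lemma C_k_SucI:
  assumes "\<And>x. (f has_derivative f' x) (at x)" and "\<And>v. C_k k (\<lambda>x. f' x v)"
  shows "C_k (Suc k) f"
proof -
  have "frechet_derivative f (at x) = f' x" for x
    using assms(1) frechet_derivative_at by metis
  then show ?thesis using assms by (auto simp: differentiable_def)
qed

lemma C_k_Suc_derivative:
  "C_k (Suc k) f \<Longrightarrow> (f has_derivative frechet_derivative f (at x)) (at x)"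
  by (simp add: frechet_derivative_works)

lemma C_k_SucD: "C_k (Suc k) f \<Longrightarrow> C_k k f"
proof (induction k arbitrary: f)
  case 0
  then show ?case
    by (auto intro!: continuous_at_imp_continuous_on differentiable_imp_continuous_within)
next
  case (Suc k)
  then show ?case by (metis C_k.simps(2))
qed

lemma C_k_const: "C_k k (\<lambda>x. c)"
proof (induction k arbitrary: c)
  case (Suc k)
  show ?case
    by (rule C_k_SucI[where f' = "\<lambda>x v. 0"]) (auto intro!: derivative_eq_intros Suc)
qed simp

lemma C_k_bounded_linear:
  assumes "bounded_linear T" "C_k k f"
  shows "C_k k (\<lambda>x. T (f x))"
  using assms(2)
proof (induction k arbitrary: f)
  case 0
  then show ?case
    using bounded_linear.continuous_on[OF assms(1)] by auto
next
  case (Suc k)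
  show ?case
    by (rule C_k_SucI[where f' = "\<lambda>x v. T (frechet_derivative f (at x) v)"])
      (use Suc.prems C_k_Suc_derivative in
       \<open>auto intro!: Suc.IH bounded_linear.has_derivative[OF assms(1)] simp: frechet_derivative_works\<close>)
qed

lemma C_k_linear: "bounded_linear T \<Longrightarrow> C_k k T"
proof (cases k)
  case 0
  then show "bounded_linear T \<Longrightarrow> ?thesis"
    by (simp add: linear_continuous_on)
next
  case (Suc n)
  then show "bounded_linear T \<Longrightarrow> ?thesis"
    by (simp only:) (rule C_k_SucI[where f' = "\<lambda>_. T"],
        auto intro: C_k_const bounded_linear_imp_has_derivative)
qed

lemma C_k_add:
  "C_k k f \<Longrightarrow> C_k k g \<Longrightarrow> C_k k (\<lambda>x. f x + g x)"
proof (induction k arbitrary: f g)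
  case 0
  then show ?case by (auto intro!: continuous_intros)
next
  case (Suc k)
  show ?case
    by (rule C_k_SucI[where f' =
          "\<lambda>x v. frechet_derivative f (at x) v + frechet_derivative g (at x) v"])
      (use Suc.prems in \<open>auto intro!: Suc.IH has_derivative_add simp: frechet_derivative_works\<close>)
qed

lemma C_k_sum: "(\<And>i. i \<in> I \<Longrightarrow> C_k k (f i)) \<Longrightarrow> C_k k (\<lambda>x. \<Sum>i\<in>I. f i x)"
  by (induction I rule: infinite_finite_induct) (auto intro: C_k_const C_k_add)

lemma C_k_bilinear:
  assumes "bounded_bilinear B"
  shows "C_k k f \<Longrightarrow> C_k k g \<Longrightarrow> C_k k (\<lambda>x. B (f x) (g x))"
proof (induction k arbitrary: f g)
  case 0
  then show ?case using bounded_bilinear.continuous_on[OF assms] by auto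
next
  case (Suc k)
  show ?case
  proof (rule C_k_SucI[where f' = "\<lambda>x v. B (f x) (frechet_derivative g (at x) v)
        + B (frechet_derivative f (at x) v) (g x)"])
    show "((\<lambda>x. B (f x) (g x)) has_derivative (\<lambda>v. B (f x) (frechet_derivative g (at x) v)
        + B (frechet_derivative f (at x) v) (g x))) (at x)" for x
      by (rule bounded_bilinear.FDERIV[OF assms]) (use Suc.prems C_k_Suc_derivative in auto)
    \<comment> \<open>Each product keeps one factor undifferentiated; it is lowered from order k + 1
      to order k so that the induction hypothesis applies to both factors.\<close>
    show "C_k k (\<lambda>x. B (f x) (frechet_derivative g (at x) v)
        + B (frechet_derivative f (at x) v) (g x))" for v
      using Suc.prems C_k_SucD[of k f] C_k_SucD[of k g]
      by (intro C_k_add Suc.IH) auto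
  qed
qed

text \<open>Smoothness speaks of derivatives in fixed directions. Expanding in the basis reduces a
  direction that moves with the point to finitely many fixed ones with scalar coefficients.\<close>

lemma frechet_derivative_Basis:
  fixes f :: "'a::euclidean_space \<Rightarrow> 'b::real_normed_vector"
  assumes "f differentiable (at x)"
  shows "frechet_derivative f (at x) v = (\<Sum>b\<in>Basis. (v \<bullet> b) *\<^sub>R frechet_derivative f (at x) b)"
proof -
  have l: "linear (frechet_derivative f (at x))"
    using assms linear_frechet_derivative by blast
  have "frechet_derivative f (at x) v = frechet_derivative f (at x) (\<Sum>b\<in>Basis. (v \<bullet> b) *\<^sub>R b)"
    by (simp add: euclidean_representation)
  then show ?thesis
    by (simp add: linear_sum[OF l] linear_cmul[OF l])
qed

lemma C_k_compose:
  fixes f :: "'b::euclidean_space \<Rightarrow> 'c::real_normed_vector"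
    and g :: "'a::real_normed_vector \<Rightarrow> 'b"
  shows "C_k k f \<Longrightarrow> C_k k g \<Longrightarrow> C_k k (\<lambda>x. f (g x))"
proof (induction k arbitrary: f g)
  case 0
  then show ?case
    by (auto intro: continuous_on_compose2)
next
  case (Suc k)
  have d: "((\<lambda>x. f (g x)) has_derivative
      (\<lambda>v. frechet_derivative f (at (g x)) (frechet_derivative g (at x) v))) (at x)" for x
    by (rule has_derivative_compose[OF C_k_Suc_derivative[OF Suc.prems(2)]
          C_k_Suc_derivative[OF Suc.prems(1)]])
  show ?case
  proof (rule C_k_SucI[OF d])
    fix v
    \<comment> \<open>The chain rule evaluates the derivative of \<open>f\<close> in a moving
      direction; in coordinates it is a sum of products whose second factors are again compositions
      with \<open>g\<close>.\<close>
    have "C_k k (\<lambda>x. \<Sum>b\<in>Basis. (frechet_derivative g (at x) v \<bullet> b) *\<^sub>R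
        frechet_derivative f (at (g x)) b)"
      using Suc.prems C_k_SucD[OF Suc.prems(2)]
      by (intro C_k_sum C_k_bilinear[OF bounded_bilinear_scaleR]
          C_k_bounded_linear[OF bounded_linear_inner_left] Suc.IH) auto
    then show "C_k k (\<lambda>x. frechet_derivative f (at (g x)) (frechet_derivative g (at x) v))"
      using Suc.prems(1) by (subst frechet_derivative_Basis) auto
  qed
qed

text \<open>Needed for the quotient that defines the cutoff function. The derivative of the inverse
  contains only the inverse and derivatives of \<open>f\<close>, which closes the induction.\<close>

lemma C_k_inverse_pos:
  fixes f :: "'a::real_normed_vector \<Rightarrow> real"
  assumes pos: "\<And>x. f x > 0"
  shows "C_k k f \<Longrightarrow> C_k k (\<lambda>x. inverse (f x))"
proof (induction k)
  case 0
  then show ?case using pos by (auto intro!: continuous_intros) (metis less_irrefl)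
next
  case (Suc k)
  have nz: "f x \<noteq> 0" for x using pos[of x] by simp
  show ?case
  proof (rule C_k_SucI)
    show "((\<lambda>x. inverse (f x)) has_derivative
       (\<lambda>v. - (inverse (f x) * frechet_derivative f (at x) v * inverse (f x)))) (at x)" for x
      by (rule Deriv.has_derivative_inverse[OF nz C_k_Suc_derivative[OF Suc.prems]])
    show "C_k k (\<lambda>x. - (inverse (f x) * frechet_derivative f (at x) v * inverse (f x)))" for v
      using Suc.prems C_k_SucD[OF Suc.prems]
      by (intro C_k_bounded_linear[OF bounded_linear_minus[OF bounded_linear_ident]]
          C_k_bilinear[OF bounded_bilinear_mult] Suc.IH) auto
  qed
qed

section \<open>Closure properties of smooth functions\<close>

lemma smooth_const: "smooth (\<lambda>x. c)"
  and smooth_linear: "bounded_linear T \<Longrightarrow> smooth T"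
  and smooth_bounded_linear: "bounded_linear U \<Longrightarrow> smooth f \<Longrightarrow> smooth (\<lambda>x. U (f x))"
  and smooth_add: "smooth g \<Longrightarrow> smooth h \<Longrightarrow> smooth (\<lambda>x. g x + h x)"
  and smooth_sum: "(\<And>i. i \<in> I \<Longrightarrow> smooth (k i)) \<Longrightarrow> smooth (\<lambda>x. \<Sum>i\<in>I. k i x)"
  by (simp_all add: smooth_def C_k_const C_k_linear C_k_bounded_linear C_k_add C_k_sum)

lemma smooth_bilinear:
  "bounded_bilinear B \<Longrightarrow> smooth f \<Longrightarrow> smooth g \<Longrightarrow> smooth (\<lambda>x. B (f x) (g x))"
  by (simp add: smooth_def C_k_bilinear)

lemma smooth_compose:
  fixes f :: "'b::euclidean_space \<Rightarrow> 'c::real_normed_vector"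
  shows "smooth f \<Longrightarrow> smooth g \<Longrightarrow> smooth (\<lambda>x. f (g x))"
  by (simp add: smooth_def C_k_compose)

lemma smooth_inverse_pos:
  fixes f :: "'a::euclidean_space \<Rightarrow> real"
  shows "(\<And>x. f x > 0) \<Longrightarrow> smooth f \<Longrightarrow> smooth (\<lambda>x. inverse (f x))"
  by (simp add: smooth_def C_k_inverse_pos)

lemma smooth_minus: "smooth f \<Longrightarrow> smooth (\<lambda>x. - f x)"
  by (rule smooth_bounded_linear[OF bounded_linear_minus[OF bounded_linear_ident]])

lemma smooth_diff: "smooth f \<Longrightarrow> smooth g \<Longrightarrow> smooth (\<lambda>x. f x - g x)"
  using smooth_add[of f "\<lambda>x. - g x"] smooth_minus[of g] by simp

lemma smooth_Pair:
  assumes "smooth f" "smooth g"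
  shows "smooth (\<lambda>x. (f x, g x))"
proof -
  have "smooth (\<lambda>x. (f x, 0) + (0, g x))"
    using assms
    by (intro smooth_add smooth_bounded_linear[of "\<lambda>u. (u, 0)"]
        smooth_bounded_linear[of "\<lambda>u. (0, u)"] bounded_linear_Pair
        bounded_linear_ident bounded_linear_zero)
  then show ?thesis by simp
qed

text \<open>With these embeddings a vector-valued function is a finite sum of linear images of its
  components, and matrix units are \<open>axis i (axis j 1)\<close>.\<close>

lemma bounded_linear_axis: "bounded_linear (axis i :: 'a::real_normed_vector \<Rightarrow> 'a^'n)"
proof (rule bounded_linear_intro[where K = 1])
  show "axis i (x + y) = (axis i x + axis i y :: 'a^'n)" for x y
    by (simp add: axis_def vec_eq_iff)
  show "axis i (r *\<^sub>R x) = (r *\<^sub>R axis i x :: 'a^'n)" for r x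
    by (simp add: axis_def vec_eq_iff)
  show "norm (axis i x :: 'a^'n) \<le> norm x * 1" for x
    by (simp add: norm_vec_def L2_set_def axis_def if_distrib[of norm] if_distrib[of "\<lambda>x. x^2"] cong: if_cong)
qed

lemma smooth_vec:
  fixes f :: "'i::finite \<Rightarrow> 'a::euclidean_space \<Rightarrow> 'b::real_normed_vector"
  assumes "\<And>i. smooth (f i)"
  shows "smooth (\<lambda>x. \<chi> i. f i x)"
proof -
  have "(\<lambda>x. \<chi> i. f i x) = (\<lambda>x. \<Sum>i\<in>UNIV. axis i (f i x))"
    by (auto simp: fun_eq_iff vec_eq_iff axis_def if_distrib cong: if_cong)
  moreover have "smooth \<dots>"
    using assms by (intro smooth_sum smooth_bounded_linear[OF bounded_linear_axis])
  ultimately show ?thesis by simp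
qed

lemma smooth_vec_nth: "smooth f \<Longrightarrow> smooth (\<lambda>x. f x $ i)"
  by (rule smooth_bounded_linear[OF bounded_linear_vec_nth])

lemma smooth_has_derivative:
  "smooth f \<Longrightarrow> (f has_derivative frechet_derivative f (at x)) (at x)"
  using C_k_Suc_derivative smooth_def by blast

lemma smooth_differentiable: "smooth f \<Longrightarrow> f differentiable (at x)"
  using smooth_has_derivative differentiable_def by blast

lemma smooth_frechet: "smooth f \<Longrightarrow> smooth (\<lambda>x. frechet_derivative f (at x) v)"
  unfolding smooth_def by (metis C_k.simps(2))

lemma smooth_partial_d: "smooth f \<Longrightarrow> smooth (partial_d \<mu> f)"
  using smooth_frechet[of f "axis \<mu> 1"] by (simp add: partial_d_def[abs_def])

lemma smooth_continuous: "smooth f \<Longrightarrow> continuous_on S f"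
  unfolding smooth_def by (metis C_k.simps(1) continuous_on_subset subset_UNIV)

text \<open>Joint continuity in base point and direction is what differentiation under the integral
  requires along a moving argument.\<close>

lemma continuous_frechet_derivative:
  fixes f :: "'a::euclidean_space \<Rightarrow> 'b::real_normed_vector"
  assumes "smooth f" "continuous_on S s" "continuous_on S v"
  shows "continuous_on S (\<lambda>x. frechet_derivative f (at (s x)) (v x))"
proof -
  have "continuous_on S (\<lambda>x. \<Sum>b\<in>Basis. (v x \<bullet> b) *\<^sub>R frechet_derivative f (at (s x)) b)"
    using assms
    by (intro continuous_intros continuous_on_compose2[OF smooth_continuous[OF smooth_frechet, of _ UNIV]]) auto
  then show ?thesis
    by (subst frechet_derivative_Basis[OF smooth_differentiable[OF assms(1)]])
qed

section \<open>Partial derivatives\<close>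

lemma partial_d_eqI:
  "(f has_derivative f') (at x) \<Longrightarrow> partial_d \<mu> f x = f' (axis \<mu> 1)"
  unfolding partial_d_def using frechet_derivative_at by metis

lemma partial_d_bounded_linear:
  "smooth f \<Longrightarrow> bounded_linear T \<Longrightarrow> partial_d \<mu> (\<lambda>x. T (f x)) x = T (partial_d \<mu> f x)"
  by (rule partial_d_eqI[THEN trans])
    (auto intro: bounded_linear.has_derivative smooth_has_derivative simp: partial_d_def)

lemma partial_d_bilinear:
  assumes "bounded_bilinear B" "smooth f" "smooth g"
  shows "partial_d \<mu> (\<lambda>x. B (f x) (g x)) x = B (f x) (partial_d \<mu> g x) + B (partial_d \<mu> f x) (g x)"
  by (rule partial_d_eqI[THEN trans, OF bounded_bilinear.FDERIV[OF assms(1)]])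
    (use assms in \<open>auto intro: smooth_has_derivative simp: partial_d_def\<close>)

lemma partial_d_add:
  "smooth f \<Longrightarrow> smooth g \<Longrightarrow> partial_d \<mu> (\<lambda>x. f x + g x) x = partial_d \<mu> f x + partial_d \<mu> g x"
  by (rule partial_d_eqI[THEN trans])
    (auto intro!: has_derivative_add smooth_has_derivative simp: partial_d_def)

lemma partial_d_zero_outside:
  assumes "closed C" "\<And>y. y \<notin> C \<Longrightarrow> f y = 0" "x \<notin> C"
  shows "partial_d \<mu> f x = 0"
proof -
  have "(f has_derivative (\<lambda>v. 0)) (at x)"
    by (rule has_derivative_transform_within_open[of "\<lambda>_. 0" _ _ _ "- C"])
      (use assms in auto)
  then show ?thesis using partial_d_eqI by blast
qed

text \<open>Allows a field to be replaced by its cut-off version wherever the two agree on an open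
  set.\<close>

lemma partial_d_cong_open:
  assumes "open U" "x \<in> U" "\<And>y. y \<in> U \<Longrightarrow> f y = g y" "smooth g"
  shows "partial_d \<mu> f x = partial_d \<mu> g x"
proof -
  have "(f has_derivative frechet_derivative g (at x)) (at x)"
    by (rule has_derivative_transform_within_open[OF smooth_has_derivative[OF assms(4)] assms(1,2)])
      (use assms in auto)
  then show ?thesis using partial_d_eqI partial_d_def by metis
qed

section \<open>Bump functions\<close>

text \<open>The power of \<open>inverse t\<close> makes the family closed under differentiation up
  to linear combinations: the derivative of member n is member n + 2 minus n times member n + 1.
  Smoothness then follows for all members at once.\<close>

definition flat_exp :: "nat \<Rightarrow> real \<Rightarrow> real" where
  "flat_exp n t = (if t > 0 then exp (- inverse t) * inverse t ^ n else 0)"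

text \<open>With s = 1/t the claim is that s^n exp(-s) tends to 0 as s tends to infinity.\<close>

lemma flat_exp_tendsto_0: "(flat_exp n \<longlongrightarrow> 0) (at_right 0)"
proof -
  have "((\<lambda>t::real. inverse t ^ n / exp (inverse t)) \<longlongrightarrow> 0) (at_right 0)"
    using filterlim_compose[OF tendsto_power_div_exp_0 filterlim_inverse_at_top_right] .
  then show ?thesis
    by (rule Lim_transform_eventually)
      (auto simp: eventually_at_filter flat_exp_def exp_minus field_simps)
qed

lemma flat_exp_has_derivative:
  "(flat_exp n has_real_derivative flat_exp (n + 2) t - n * flat_exp (n + 1) t) (at t)"
proof -
  consider "t > 0" | "t < 0" | "t = 0" by linarith
  then show ?thesis
  proof cases
    case 1
    have "((\<lambda>t. exp (- inverse t) * inverse t ^ n) has_real_derivative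
        flat_exp (n + 2) t - n * flat_exp (n + 1) t) (at t)"
    proof (cases n)
      case 0
      then show ?thesis
        using 1 by (auto intro!: derivative_eq_intros simp: flat_exp_def field_simps power2_eq_square)
    next
      case (Suc m)
      have e: "((\<lambda>t. exp (- inverse t)) has_real_derivative exp (- inverse t) * (inverse t)\<^sup>2) (at t)"
        using 1 by (auto intro!: derivative_eq_intros simp: field_simps power2_eq_square)
      have "(inverse has_real_derivative - (inverse t)\<^sup>2) (at t)"
        using 1 by (auto intro!: derivative_eq_intros simp: field_simps power2_eq_square)
      from DERIV_mult[OF e DERIV_power_Suc[OF this, of m]] show ?thesis
        using 1 Suc by (simp add: flat_exp_def algebra_simps power2_eq_square)
    qed
    then show ?thesis
      by (rule has_field_derivative_transform_within_open[of _ _ _ "{0<..}"])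
        (use 1 in \<open>auto simp: flat_exp_def\<close>)
  next
    case 2
    have "((\<lambda>t. 0) has_real_derivative flat_exp (n + 2) t - n * flat_exp (n + 1) t) (at t)"
      using 2 by (simp add: flat_exp_def)
    then show ?thesis
      by (rule has_field_derivative_transform_within_open[of _ _ _ "{..<0}"])
        (use 2 in \<open>auto simp: flat_exp_def\<close>)
  next
    case 3
    \<comment> \<open>The value at 0 is 0 by definition, so the difference quotient is
      \<open>flat_exp (Suc n)\<close> on the right and 0 on the left.\<close>
    have "((\<lambda>y. (flat_exp n y - flat_exp n 0) / (y - 0)) \<longlongrightarrow> 0) (at 0)"
    proof (rule filterlim_split_at)
      show "((\<lambda>y. (flat_exp n y - flat_exp n 0) / (y - 0)) \<longlongrightarrow> 0) (at_left 0)"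
        by (rule Lim_transform_eventually[OF tendsto_const])
          (auto simp: eventually_at_filter flat_exp_def)
      show "((\<lambda>y. (flat_exp n y - flat_exp n 0) / (y - 0)) \<longlongrightarrow> 0) (at_right 0)"
        by (rule Lim_transform_eventually[OF flat_exp_tendsto_0[of "Suc n"]])
          (auto simp: eventually_at_filter flat_exp_def field_simps)
    qed
    then show ?thesis
      using 3 by (simp add: has_field_derivative_iff flat_exp_def)
  qed
qed

lemma C_k_flat_exp: "C_k k (flat_exp n)"
proof (induction k arbitrary: n)
  case 0
  show ?case
    using DERIV_isCont[OF flat_exp_has_derivative] by (auto intro: continuous_at_imp_continuous_on)
next
  case (Suc k)
  show ?case
  proof (rule C_k_SucI)
    show "(flat_exp n has_derivative (*) (flat_exp (n + 2) x + (- n) * flat_exp (n + 1) x)) (at x)" for x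
      using flat_exp_has_derivative[of n x] by (simp add: has_field_derivative_def)
    show "C_k k (\<lambda>x. (flat_exp (n + 2) x + (- n) * flat_exp (n + 1) x) * v)" for v
      by (intro C_k_bilinear[OF bounded_bilinear_mult] C_k_add C_k_const Suc)
  qed
qed

lemma smooth_flat_exp: "smooth (flat_exp n)"
  by (simp add: smooth_def C_k_flat_exp)

lemma flat_exp_nonneg: "flat_exp n t \<ge> 0"
  and flat_exp_pos_iff: "flat_exp n t > 0 \<longleftrightarrow> t > 0"
  by (auto simp: flat_exp_def)

lemma smooth_norm_square: "smooth (\<lambda>x::'a::euclidean_space. (x - a) \<bullet> (x - a))"
  by (intro smooth_bilinear[OF bounded_bilinear_inner] smooth_diff smooth_const
      smooth_linear bounded_linear_ident)

text \<open>The polynomial \<delta>^2 - |x - a|^2 is positive exactly in the open ball, and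
  \<open>flat_exp 0\<close> flattens it smoothly at the boundary sphere.\<close>

lemma smooth_bump_exists:
  fixes a :: "'a::euclidean_space"
  assumes "\<delta> > 0"
  obtains \<phi> :: "'a \<Rightarrow> real" where "smooth \<phi>" "\<And>x. \<phi> x \<ge> 0" "\<phi> a > 0"
    "\<And>x. dist a x \<ge> \<delta> \<Longrightarrow> \<phi> x = 0"
proof
  let ?\<phi> = "\<lambda>x. flat_exp 0 (\<delta>\<^sup>2 - (x - a) \<bullet> (x - a))"
  show "smooth ?\<phi>"
    by (intro smooth_compose[OF smooth_flat_exp] smooth_diff smooth_const smooth_norm_square)
  show "?\<phi> x \<ge> 0" for x by (rule flat_exp_nonneg)
  show "?\<phi> a > 0" using assms by (simp add: flat_exp_pos_iff)
  show "?\<phi> x = 0" if "dist a x \<ge> \<delta>" for x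
  proof -
    have "\<delta>\<^sup>2 \<le> (norm (x - a))\<^sup>2"
      using that assms by (intro power_mono) (auto simp: dist_norm norm_minus_commute)
    then show ?thesis by (simp add: flat_exp_def power2_norm_eq_inner)
  qed
qed

lemma smooth_cutoff_exists:
  assumes "R \<ge> 0"
  obtains \<eta> :: "'a::euclidean_space \<Rightarrow> real" where "smooth \<eta>"
    "\<And>x. norm x \<le> R \<Longrightarrow> \<eta> x = 1" "\<And>x. norm x > R + 1 \<Longrightarrow> \<eta> x = 0"
proof
  \<comment> \<open>\<open>u\<close> is positive inside the ball of radius \<open>R + 1\<close> and
    \<open>v\<close> outside the ball of radius \<open>R\<close>. Their sum is 2R + 1 > 0, so the
    denominator never vanishes. The quotient is 1 where \<open>v\<close> is switched off and 0 where
    \<open>u\<close> is.\<close>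
  define u v where "u = (\<lambda>x::'a. (R + 1)\<^sup>2 - (x - 0) \<bullet> (x - 0))"
    and "v = (\<lambda>x::'a. (x - 0) \<bullet> (x - 0) - R\<^sup>2)"
  let ?\<eta> = "\<lambda>x. flat_exp 0 (u x) * inverse (flat_exp 0 (u x) + flat_exp 0 (v x))"
  have s: "smooth u" "smooth v"
    unfolding u_def v_def
    by (intro smooth_diff smooth_const smooth_norm_square)+
  have uv: "u x > 0 \<or> v x > 0" for x
  proof -
    have "u x + v x > 0" using assms by (simp add: u_def v_def power2_eq_square algebra_simps)
    then show ?thesis by linarith
  qed
  have pos: "flat_exp 0 (u x) + flat_exp 0 (v x) > 0" for x
    using uv[of x] flat_exp_nonneg[of 0] flat_exp_pos_iff[of 0]
    by (metis add_nonneg_pos add_pos_nonneg)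
  show "smooth ?\<eta>"
    by (intro smooth_bilinear[OF bounded_bilinear_mult] smooth_inverse_pos pos smooth_add
        smooth_compose[OF smooth_flat_exp] s)
  show "?\<eta> x = 1" if "norm x \<le> R" for x
  proof -
    have "(norm x)\<^sup>2 \<le> R\<^sup>2" using that by (intro power_mono) auto
    then have "flat_exp 0 (v x) = 0"
      by (simp add: flat_exp_def v_def power2_norm_eq_inner)
    then show ?thesis using pos[of x] by simp
  qed
  show "?\<eta> x = 0" if "norm x > R + 1" for x
  proof -
    have "(norm x)\<^sup>2 \<ge> (R + 1)\<^sup>2" using that assms by (intro power_mono) auto
    then show ?thesis
      by (simp add: flat_exp_def u_def power2_norm_eq_inner)
  qed
qed

text \<open>Radii are easier to combine than compact closures. A radius can always be enlarged, and
  \<open>R \<ge> 0\<close> is what the cutoff construction asks for.\<close>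

lemma test_function_iff:
  "test_function H \<longleftrightarrow> smooth H \<and> (\<exists>R\<ge>0. \<forall>x. norm x > R \<longrightarrow> H x = 0)"
proof -
  have "compact (closure {x. H x \<noteq> 0}) \<longleftrightarrow> bounded {x. H x \<noteq> 0}"
    by (simp add: compact_closure)
  also have "\<dots> \<longleftrightarrow> (\<exists>R\<ge>0. \<forall>x. norm x > R \<longrightarrow> H x = 0)"
  proof
    assume "bounded {x. H x \<noteq> 0}"
    then obtain R where "R > 0" "\<forall>x\<in>{x. H x \<noteq> 0}. norm x \<le> R" using bounded_pos by metis
    then show "\<exists>R\<ge>0. \<forall>x. norm x > R \<longrightarrow> H x = 0"
      by (intro exI[of _ R]) (auto simp: not_less[symmetric])
  next
    assume "\<exists>R\<ge>0. \<forall>x. norm x > R \<longrightarrow> H x = 0"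
    then show "bounded {x. H x \<noteq> 0}"
      unfolding bounded_iff by (metis (mono_tags, lifting) mem_Collect_eq not_less)
  qed
  finally show ?thesis by (simp add: test_function_def)
qed

section \<open>Integrals of compactly supported functions\<close>

text \<open>Bridges the Lebesgue integral over the whole space and the Henstock-Kurzweil integral
  over a box, because the rule for differentiating with respect to a parameter is applied to the
  latter.\<close>

lemma compact_support_integral:
  fixes f :: "'a::euclidean_space \<Rightarrow> 'b::euclidean_space"
  assumes cont: "continuous_on UNIV f" and zero: "\<And>x. x \<notin> cbox a b \<Longrightarrow> f x = 0"
  shows "integrable lborel f" and "(\<integral>x. f x \<partial>lborel) = integral (cbox a b) f"
proof -
  have "integrable lborel (\<lambda>x. indicator (cbox a b) x *\<^sub>R f x)"
    by (intro borel_integrable_compact continuous_on_subset[OF cont]) auto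
  moreover have "(\<lambda>x. indicator (cbox a b) x *\<^sub>R f x) = f"
    using zero by (auto simp: fun_eq_iff indicator_def)
  ultimately show int: "integrable lborel f" by simp
  have "integral (cbox a b) f = integral UNIV (\<lambda>x. if x \<in> cbox a b then f x else 0)"
    by (simp only: integral_restrict_UNIV)
  also have "(\<lambda>x. if x \<in> cbox a b then f x else 0) = f" using zero by auto
  finally show "(\<integral>x. f x \<partial>lborel) = integral (cbox a b) f"
    using integral_lborel[OF int] by simp
qed

lemma cbox_bound_exists:
  obtains a :: "'a::euclidean_space" where "\<And>x. norm x \<le> R \<Longrightarrow> x \<in> cbox (- a) a"
  using bounded_subset_cbox_symmetric[OF bounded_cball[of "0::'a" R]]
  by (metis mem_cball_0 subsetD)

lemma compact_support_integrable:
  fixes f :: "'a::euclidean_space \<Rightarrow> 'b::euclidean_space"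
  assumes "continuous_on UNIV f" "\<And>x. norm x > R \<Longrightarrow> f x = 0"
  shows "integrable lborel f"
  using cbox_bound_exists[of R] assms compact_support_integral(1)
  by (metis not_less)

text \<open>The supports are confined to a common ball only for parameters of absolute value at most
  1. This is enough for a derivative at 0 and admits translations, whose supports drift with the
  parameter.\<close>

lemma compact_support_leibniz:
  fixes F :: "real \<Rightarrow> 'a::euclidean_space \<Rightarrow> 'b::euclidean_space"
  assumes deriv: "\<And>e x. ((\<lambda>e. F e x) has_vector_derivative F' e x) (at e)"
    and cont: "\<And>e. continuous_on UNIV (F e)"
    and cont': "continuous_on UNIV (\<lambda>(e, x). F' e x)"
    and zero: "\<And>e x. \<bar>e\<bar> \<le> 1 \<Longrightarrow> norm x > R \<Longrightarrow> F e x = 0"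
  shows "((\<lambda>e. \<integral>x. F e x \<partial>lborel) has_vector_derivative (\<integral>x. F' 0 x \<partial>lborel)) (at 0)"
proof -
  obtain a :: 'a where a: "\<And>x. norm x \<le> R \<Longrightarrow> x \<in> cbox (- a) a"
    using cbox_bound_exists[of R] by blast
  have F0: "F e x = 0" if "\<bar>e\<bar> \<le> 1" "x \<notin> cbox (- a) a" for e x
    using that a zero by (meson not_less)
  have F'0: "F' 0 x = 0" if x: "x \<notin> cbox (- a) a" for x
  proof -
    have "((\<lambda>e. 0) has_vector_derivative F' 0 x) (at 0)"
      by (rule has_vector_derivative_transform_within_open[OF deriv, where S = "{-1<..<1}"])
        (use F0 x in auto)
    then show ?thesis
      using vector_derivative_unique_at has_vector_derivative_const by blast
  qed
  have c': "continuous_on UNIV (F' 0)"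
    using continuous_on_compose2[OF cont', of UNIV "\<lambda>x. (0, x)"]
      continuous_on_Pair[OF continuous_on_const continuous_on_id, of UNIV 0] by simp
  have "((\<lambda>e. integral (cbox (- a) a) (F e)) has_vector_derivative integral (cbox (- a) a) (F' 0))
      (at 0 within UNIV)"
    by (rule leibniz_rule_vector_derivative)
      (use deriv in \<open>auto intro: integrable_continuous continuous_on_subset[OF cont] continuous_on_subset[OF cont']\<close>)
  moreover have "integral (cbox (- a) a) (F' 0) = (\<integral>x. F' 0 x \<partial>lborel)"
    using compact_support_integral(2)[OF c' F'0] by simp
  ultimately have "((\<lambda>e. integral (cbox (- a) a) (F e)) has_vector_derivative (\<integral>x. F' 0 x \<partial>lborel)) (at 0)"
    by simp
  then show ?thesis
    by (rule has_vector_derivative_transform_within_open[where S = "{-1<..<1}"])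
      (use F0 in \<open>auto intro!: compact_support_integral(2)[symmetric] cont\<close>)
qed

text \<open>The integral of \<open>f\<close> translated by \<open>t\<close> does not depend on \<open>t\<close>.\<close>

lemma integral_partial_d_eq_0:
  fixes f :: "real^'n \<Rightarrow> 'b::euclidean_space"
  assumes "smooth f" and zero: "\<And>x. norm x > R \<Longrightarrow> f x = 0"
  shows "(\<integral>x. partial_d \<mu> f x \<partial>lborel) = 0"
proof -
  let ?e = "axis \<mu> 1 :: real^'n"
  let ?F = "\<lambda>t x. f (t *\<^sub>R ?e + x)" and ?F' = "\<lambda>t x. partial_d \<mu> f (t *\<^sub>R ?e + x)"
  have "((\<lambda>t. \<integral>x. ?F t x \<partial>lborel) has_vector_derivative (\<integral>x. ?F' 0 x \<partial>lborel)) (at 0)"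
  \<comment> \<open>A translation along a unit vector by at most 1 moves the support by at most
    1.\<close>
  proof (rule compact_support_leibniz[where R = "R + 1"])
    fix t :: real and x :: "real^'n"
    have g: "((\<lambda>t. t *\<^sub>R ?e + x) has_derivative (\<lambda>s. s *\<^sub>R ?e)) (at t)"
      by (auto intro!: derivative_eq_intros)
    have l: "linear (frechet_derivative f (at y))" for y
      using assms(1) linear_frechet_derivative smooth_differentiable by blast
    show "((\<lambda>t. ?F t x) has_vector_derivative ?F' t x) (at t)"
      using has_derivative_compose[OF g smooth_has_derivative[OF assms(1)]]
      by (simp add: has_vector_derivative_def partial_d_def linear_cmul[OF l])
    show "continuous_on UNIV (?F t)"
      by (intro continuous_on_compose2[OF smooth_continuous[OF assms(1), of UNIV]] continuous_intros) auto
    show "continuous_on UNIV (\<lambda>(t, x). ?F' t x)"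
      unfolding split_beta
      by (intro continuous_on_compose2[OF smooth_continuous[OF smooth_partial_d[OF assms(1)], of UNIV]]
          continuous_intros) auto
    assume "\<bar>t\<bar> \<le> 1" "norm x > R + 1"
    moreover have "norm x \<le> norm (t *\<^sub>R ?e + x) + norm (t *\<^sub>R ?e)"
      by (metis add.commute add_diff_cancel_right' norm_triangle_ineq4)
    ultimately show "?F t x = 0"
      by (intro zero) (simp add: norm_axis_1)
  qed
  moreover have "(\<integral>x. ?F t x \<partial>lborel) = (\<integral>x. f x \<partial>lborel)" for t
  proof -
    have "f \<in> borel_measurable borel"
      using smooth_continuous[OF assms(1)] by (rule borel_measurable_continuous_onI)
    then have "(\<integral>x. f x \<partial>distr lborel borel ((+) (t *\<^sub>R ?e))) = (\<integral>x. ?F t x \<partial>lborel)"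
      by (intro integral_distr) auto
    then show ?thesis by (simp add: lborel_distr_plus)
  qed
  ultimately have "((\<lambda>t::real. \<integral>x. f x \<partial>lborel) has_vector_derivative (\<integral>x. ?F' 0 x \<partial>lborel)) (at 0)"
    by simp
  then have "(\<integral>x. ?F' 0 x \<partial>lborel) = 0"
    using vector_derivative_unique_at has_vector_derivative_const by blast
  then show ?thesis by simp
qed

text \<open>Integrate the Leibniz rule for \<open>B\<close>. The bilinear map is left general to
  serve both the complex trace pairing of the matter equation and the real inner product of the
  gauge equations.\<close>

lemma integral_by_parts:
  fixes B :: "'a::euclidean_space \<Rightarrow> 'b::euclidean_space \<Rightarrow> 'd::euclidean_space"
    and f :: "real^'n \<Rightarrow> 'a" and g :: "real^'n \<Rightarrow> 'b"
  assumes B: "bounded_bilinear B" and f: "smooth f" and g: "smooth g"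
    and zero: "\<And>x. norm x > R \<Longrightarrow> g x = 0"
  shows "integrable lborel (\<lambda>x. B (f x) (partial_d \<mu> g x))"
    and "integrable lborel (\<lambda>x. B (partial_d \<mu> f x) (g x))"
    and "(\<integral>x. B (f x) (partial_d \<mu> g x) \<partial>lborel) = - (\<integral>x. B (partial_d \<mu> f x) (g x) \<partial>lborel)"
proof -
  note c = smooth_continuous[OF smooth_bilinear[OF B], of _ _ UNIV]
  have z: "partial_d \<mu> g x = 0" if "norm x > R" for x
    by (rule partial_d_zero_outside[of "cball 0 R"]) (use zero that in auto)
  show i1: "integrable lborel (\<lambda>x. B (f x) (partial_d \<mu> g x))"
    by (rule compact_support_integrable[of _ R])
      (use c f g smooth_partial_d z bounded_bilinear.zero_right[OF B] in auto)
  show i2: "integrable lborel (\<lambda>x. B (partial_d \<mu> f x) (g x))"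
    by (rule compact_support_integrable[of _ R])
      (use c f g smooth_partial_d zero bounded_bilinear.zero_right[OF B] in auto)
  have "(\<integral>x. partial_d \<mu> (\<lambda>x. B (f x) (g x)) x \<partial>lborel) = 0"
    by (rule integral_partial_d_eq_0[of _ R])
      (use smooth_bilinear[OF B f g] zero bounded_bilinear.zero_right[OF B] in auto)
  then have "(\<integral>x. B (f x) (partial_d \<mu> g x) + B (partial_d \<mu> f x) (g x) \<partial>lborel) = 0"
    by (simp add: partial_d_bilinear[OF B f g])
  then show "(\<integral>x. B (f x) (partial_d \<mu> g x) \<partial>lborel) = - (\<integral>x. B (partial_d \<mu> f x) (g x) \<partial>lborel)"
    using i1 i2 by (simp add: eq_neg_iff_add_eq_0)
qed

text \<open>All variations considered change the argument of the density affinely in the parameter,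
  so one differentiation under the integral covers both kinds of field. The integrand is a
  difference because \<open>f (s x)\<close> alone need not be integrable.\<close>

lemma first_variation:
  fixes f :: "'e::euclidean_space \<Rightarrow> 'b::euclidean_space" and s v :: "'a::euclidean_space \<Rightarrow> 'e"
  assumes f: "smooth f" and s: "continuous_on UNIV s" and v: "continuous_on UNIV v"
    and zero: "\<And>x. norm x > R \<Longrightarrow> v x = 0"
  shows "((\<lambda>\<epsilon>. \<integral>x. f (s x + \<epsilon> *\<^sub>R v x) - f (s x) \<partial>lborel) has_vector_derivative
      (\<integral>x. frechet_derivative f (at (s x)) (v x) \<partial>lborel)) (at 0)"
    and "integrable lborel (\<lambda>x. f (s x + \<epsilon> *\<^sub>R v x) - f (s x))"
    and "integrable lborel (\<lambda>x. frechet_derivative f (at (s x)) (v x))"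
proof -
  have l: "linear (frechet_derivative f (at y))" for y
    using f linear_frechet_derivative smooth_differentiable by blast
  have c: "continuous_on UNIV (\<lambda>x. f (s x + \<epsilon> *\<^sub>R v x) - f (s x))" for \<epsilon>
    by (intro continuous_intros continuous_on_compose2[OF smooth_continuous[OF f, of UNIV]] s v) auto
  show "integrable lborel (\<lambda>x. f (s x + \<epsilon> *\<^sub>R v x) - f (s x))" for \<epsilon>
    by (rule compact_support_integrable[of _ R]) (use c zero in auto)
  show "integrable lborel (\<lambda>x. frechet_derivative f (at (s x)) (v x))"
    by (rule compact_support_integrable[of _ R])
      (use continuous_frechet_derivative[OF f s v] zero linear_0[OF l] in auto)
  let ?F' = "\<lambda>\<epsilon> x. frechet_derivative f (at (s x + \<epsilon> *\<^sub>R v x)) (v x)"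
  have "((\<lambda>\<epsilon>. \<integral>x. f (s x + \<epsilon> *\<^sub>R v x) - f (s x) \<partial>lborel) has_vector_derivative
      (\<integral>x. ?F' 0 x \<partial>lborel)) (at 0)"
  proof (rule compact_support_leibniz[where R = R])
    fix \<epsilon> :: real and x :: 'a
    have "((\<lambda>\<epsilon>. s x + \<epsilon> *\<^sub>R v x) has_derivative (\<lambda>t. t *\<^sub>R v x)) (at \<epsilon>)"
      by (auto intro!: derivative_eq_intros)
    from has_derivative_compose[OF this smooth_has_derivative[OF f]]
    have "((\<lambda>\<epsilon>. f (s x + \<epsilon> *\<^sub>R v x) - f (s x)) has_derivative (\<lambda>t. t *\<^sub>R ?F' \<epsilon> x - 0)) (at \<epsilon>)"
      by (intro has_derivative_diff has_derivative_const) (simp add: linear_cmul[OF l])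
    then show "((\<lambda>\<epsilon>. f (s x + \<epsilon> *\<^sub>R v x) - f (s x)) has_vector_derivative ?F' \<epsilon> x) (at \<epsilon>)"
      by (simp add: has_vector_derivative_def)
    show "continuous_on UNIV (\<lambda>(\<epsilon>, x). ?F' \<epsilon> x)"
      unfolding split_beta
      by (intro continuous_frechet_derivative[OF f] continuous_intros
          continuous_on_compose2[OF s] continuous_on_compose2[OF v]) auto
  qed (use c zero in auto)
  then show "((\<lambda>\<epsilon>. \<integral>x. f (s x + \<epsilon> *\<^sub>R v x) - f (s x) \<partial>lborel) has_vector_derivative
      (\<integral>x. frechet_derivative f (at (s x)) (v x) \<partial>lborel)) (at 0)"
    by simp
qed

text \<open>Testing with a bump times the constant vector \<open>W x\<close> makes the integrand
  nonnegative everywhere and positive at \<open>x\<close>. That vector lies in \<open>V\<close>,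
  which is where the assumption on the values of \<open>W\<close> enters.\<close>

lemma fundamental_lemma:
  fixes W :: "'a::euclidean_space \<Rightarrow> 'e::euclidean_space"
  assumes W: "continuous_on UNIV W" and V: "subspace V" "\<And>x. W x \<in> V"
    and int: "\<And>H. test_function H \<Longrightarrow> (\<And>x. H x \<in> V) \<Longrightarrow> (\<integral>x. W x \<bullet> H x \<partial>lborel) = 0"
  shows "W x = 0"
proof (rule ccontr)
  assume nz: "W x \<noteq> 0"
  have c: "continuous_on UNIV (\<lambda>y. W y \<bullet> W x)"
    by (intro continuous_intros W)
  have "open {y. W y \<bullet> W x > 0}"
    using c by (rule open_Collect_less[OF continuous_on_const])
  moreover have "x \<in> {y. W y \<bullet> W x > 0}" using nz by simp
  ultimately obtain \<delta> where \<delta>: "\<delta> > 0" "ball x \<delta> \<subseteq> {y. W y \<bullet> W x > 0}"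
    by (meson open_contains_ball)
  obtain \<phi> :: "'a \<Rightarrow> real" where \<phi>: "smooth \<phi>" "\<And>y. \<phi> y \<ge> 0" "\<phi> x > 0"
    "\<And>y. dist x y \<ge> \<delta> \<Longrightarrow> \<phi> y = 0"
    using smooth_bump_exists[OF \<delta>(1)] by metis
  define H where "H = (\<lambda>y. \<phi> y *\<^sub>R W x)"
  define R where "R = norm x + \<delta>"
  have far: "\<phi> y = 0" if "norm y > R" for y
  proof -
    have "norm y \<le> norm x + dist x y"
      by (metis dist_norm norm_minus_commute norm_triangle_sub)
    then show ?thesis using that by (intro \<phi>(4)) (simp add: R_def)
  qed
  have "smooth H"
    unfolding H_def by (intro smooth_bilinear[OF bounded_bilinear_scaleR] \<phi> smooth_const)
  moreover have "R \<ge> 0" using \<delta>(1) by (simp add: R_def)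
  ultimately have "test_function H"
    unfolding test_function_iff using far by (auto simp: H_def)
  moreover have "H y \<in> V" for y
    using V by (simp add: H_def subspace_scale)
  ultimately have I0: "(\<integral>y. W y \<bullet> H y \<partial>lborel) = 0" by (rule int)
  have cH: "continuous_on UNIV (\<lambda>y. W y \<bullet> H y)"
    by (intro continuous_intros W smooth_continuous[OF \<open>smooth H\<close>])
  obtain a :: 'a where a: "\<And>y. norm y \<le> R + 1 \<Longrightarrow> y \<in> cbox (- a) a"
    using cbox_bound_exists[of "R + 1"] by blast
  have H0: "W y \<bullet> H y = 0" if "y \<notin> cbox (- a) a" for y
  proof -
    have "norm y > R + 1" using that a[of y] by (meson not_le)
    then show ?thesis using far[of y] by (simp add: H_def)
  qed
  have "integral (cbox (- a) a) (\<lambda>y. W y \<bullet> H y) = 0"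
    using compact_support_integral(2)[OF cH H0] I0 by simp
  moreover have "(\<lambda>y. W y \<bullet> H y) integrable_on cbox (- a) a"
    by (intro integrable_continuous continuous_on_subset[OF cH]) auto
  ultimately have hi: "((\<lambda>y. W y \<bullet> H y) has_integral 0) (cbox (- a) a)"
    by (metis integrable_integral)
  \<comment> \<open>The box contains an open ball larger than the support, so it has nonempty
    interior and contains \<open>x\<close>; a continuous nonnegative function with integral 0 then
    vanishes at \<open>x\<close>.\<close>
  have "ball 0 (R + 1) \<subseteq> cbox (- a) a" using a by auto
  then have "ball 0 (R + 1) \<subseteq> box (- a) a"
    by (metis interior_cbox interior_maximal open_ball)
  moreover have x: "x \<in> ball 0 (R + 1)" using \<delta>(1) by (simp add: R_def)
  ultimately have ne: "box (- a) a \<noteq> {}" and xa: "x \<in> cbox (- a) a"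
    using box_subset_cbox by (auto simp: subset_iff)
  have nonneg: "W y \<bullet> H y \<ge> 0" for y
  proof (cases "dist x y \<ge> \<delta>")
    case True
    then show ?thesis using \<phi>(4) by (simp add: H_def)
  next
    case False
    then have "y \<in> ball x \<delta>" by simp
    then have "W y \<bullet> W x > 0" using \<delta>(2) by blast
    then show ?thesis using \<phi>(2) by (simp add: H_def)
  qed
  have "W x \<bullet> H x = 0"
    by (rule has_integral_0_cbox_imp_0[OF continuous_on_subset[OF cH] _ hi ne xa])
      (use nonneg in auto)
  then show False using nz \<phi>(3) by (simp add: H_def)
qed

section \<open>Complex matrices\<close>

lemma dagger_nth [simp]: "X\<^sup>\<dagger> $ i $ j = cnj (X $ j $ i)"
  by (simp add: dagger_def transpose_def map_matrix_def)

lemma cscale_nth [simp]: "cscale a X $ i $ j = a * X $ i $ j"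
  by (simp add: cscale_def map_matrix_def)

lemma dagger_dagger [simp]: "(X\<^sup>\<dagger>)\<^sup>\<dagger> = X"
  by (simp add: vec_eq_iff)

lemma dagger_0 [simp]: "0\<^sup>\<dagger> = 0"
  by (simp add: vec_eq_iff)

lemma dagger_add: "(X + Y)\<^sup>\<dagger> = X\<^sup>\<dagger> + Y\<^sup>\<dagger>"
  and dagger_diff: "(X - Y)\<^sup>\<dagger> = X\<^sup>\<dagger> - Y\<^sup>\<dagger>"
  and dagger_scaleR: "(a *\<^sub>R X)\<^sup>\<dagger> = a *\<^sub>R X\<^sup>\<dagger>"
  and dagger_cscale: "(cscale z X)\<^sup>\<dagger> = cscale (cnj z) (X\<^sup>\<dagger>)"
  by (simp_all add: vec_eq_iff)

lemma dagger_mult: "(X ** Y)\<^sup>\<dagger> = Y\<^sup>\<dagger> ** X\<^sup>\<dagger>"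
  by (simp add: vec_eq_iff matrix_matrix_mult_def mult.commute)

lemma dagger_sum: "(\<Sum>i\<in>I. f i)\<^sup>\<dagger> = (\<Sum>i\<in>I. (f i)\<^sup>\<dagger>)"
  by (induction I rule: infinite_finite_induct) (simp_all add: dagger_add)

lemma bounded_linear_dagger: "bounded_linear (dagger :: complex^'q^'p \<Rightarrow> _)"
  by (simp add: linear_conv_bounded_linear[symmetric] linear_iff dagger_add dagger_scaleR)

lemma bounded_linear_cscale: "bounded_linear (cscale a :: complex^'q^'p \<Rightarrow> _)"
  by (simp add: linear_conv_bounded_linear[symmetric] linear_iff vec_eq_iff algebra_simps)

lemma bounded_bilinear_matrix_mult:
  "bounded_bilinear ((**) :: complex^'q^'p \<Rightarrow> complex^'s^'q \<Rightarrow> complex^'s^'p)"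
  by (simp add: bilinear_conv_bounded_bilinear[symmetric] bilinear_def linear_iff vec_eq_iff
      matrix_matrix_mult_def algebra_simps sum.distrib scaleR_sum_right)

lemmas matrix_mult_algebra =
  bounded_bilinear.add_left[OF bounded_bilinear_matrix_mult]
  bounded_bilinear.add_right[OF bounded_bilinear_matrix_mult]
  bounded_bilinear.diff_left[OF bounded_bilinear_matrix_mult]
  bounded_bilinear.diff_right[OF bounded_bilinear_matrix_mult]
  bounded_bilinear.minus_left[OF bounded_bilinear_matrix_mult]
  bounded_bilinear.minus_right[OF bounded_bilinear_matrix_mult]
  bounded_bilinear.scaleR_left[OF bounded_bilinear_matrix_mult]
  bounded_bilinear.scaleR_right[OF bounded_bilinear_matrix_mult]

lemma bounded_linear_trace: "bounded_linear (trace :: complex^'q^'q \<Rightarrow> complex)"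
  by (simp add: linear_conv_bounded_linear[symmetric] linear_iff trace_def sum.distrib scaleR_sum_right)

lemma trace_dagger: "trace (X\<^sup>\<dagger>) = cnj (trace X)"
  by (simp add: trace_def)

lemma trace_cscale_right: "trace (X ** cscale a Y) = a * trace (X ** Y)"
  by (simp add: trace_def matrix_matrix_mult_def sum_distrib_left algebra_simps)

text \<open>Pairing with a matrix unit reads off an entry; the swapped indices match the transposed
  convention of \<open>matrix_deriv\<close>.\<close>

lemma trace_mult_axis: "trace (X ** axis i (axis j z)) = X $ j $ i * z"
  by (simp add: trace_def matrix_matrix_mult_def axis_def if_distrib[of "\<lambda>v. v $ _"]
      if_distrib[of "\<lambda>v. _ * v"] sum.delta cong: if_cong)

lemma bounded_bilinear_trace_mult:
  "bounded_bilinear (\<lambda>(X :: complex^'q^'p) (Y :: complex^'p^'q). trace (X ** Y))"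
  by (simp add: bilinear_conv_bounded_bilinear[symmetric] bilinear_def linear_iff trace_def
      matrix_matrix_mult_def algebra_simps sum.distrib scaleR_sum_right)

text \<open>Identifies the inner product of the Euclidean space of matrices with the real trace
  form, so that projections and the fundamental lemma refer to the same form.\<close>

lemma inner_matrix_eq: "X \<bullet> Y = Re (trace (X\<^sup>\<dagger> ** Y))" for X Y :: "complex^'q^'p"
proof -
  have "Re (trace (X\<^sup>\<dagger> ** Y)) = (\<Sum>j\<in>UNIV. \<Sum>i\<in>UNIV. X $ i $ j \<bullet> Y $ i $ j)"
    by (simp add: trace_def matrix_matrix_mult_def inner_complex_def)
  also have "\<dots> = (\<Sum>i\<in>UNIV. \<Sum>j\<in>UNIV. X $ i $ j \<bullet> Y $ i $ j)"
    by (rule sum.swap)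
  finally show ?thesis by (simp add: inner_vec_def)
qed

lemma inner_dagger: "X\<^sup>\<dagger> \<bullet> Y\<^sup>\<dagger> = X \<bullet> Y" for X Y :: "complex^'q^'p"
proof -
  have "Re (trace (X ** Y\<^sup>\<dagger>)) = Re (trace ((Y ** X\<^sup>\<dagger>)\<^sup>\<dagger>))" by (simp add: dagger_mult)
  also have "\<dots> = Re (trace (Y ** X\<^sup>\<dagger>))" by (subst trace_dagger) simp
  also have "\<dots> = Re (trace (X\<^sup>\<dagger> ** Y))" by (subst trace_mul_sym) simp
  finally show ?thesis by (simp add: inner_matrix_eq)
qed

lemma sum_axis: "(\<Sum>i\<in>UNIV. axis i (v $ i)) = v"
  by (simp add: vec_eq_iff axis_def if_distrib[of "\<lambda>v. v $ _"] sum.delta cong: if_cong)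

text \<open>Holomorphy makes the real derivative along a matrix unit multiplication by the complex
  partial derivative. Real linearity then adds up the matrix units.\<close>

lemma trace_matrix_deriv:
  fixes F :: "complex^'q^'p \<Rightarrow> complex"
  assumes F: "(F has_derivative D) (at Z)" and hol: "matrix_holomorphic F"
  shows "D H = trace (matrix_deriv F Z ** H)"
proof -
  have lin: "linear D" using F by (simp add: has_derivative_linear)
  have upd: "upd_entry Z i j z = Z + axis i (axis j (z - Z $ i $ j))" for i j z
    by (auto simp: upd_entry_def vec_eq_iff axis_def)
  have entry: "D (axis i (axis j h)) = deriv (\<lambda>z. F (upd_entry Z i j z)) (Z $ i $ j) * h" for i j h
  proof -
    let ?u = "\<lambda>z. F (upd_entry Z i j z)"
    have "?u field_differentiable at (Z $ i $ j)"
      using hol holomorphic_on_imp_differentiable_at[of ?u UNIV] by (simp add: matrix_holomorphic_def)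
    then have 1: "(?u has_derivative (*) (deriv ?u (Z $ i $ j))) (at (Z $ i $ j))"
      using field_differentiable_derivI has_field_derivative_def by blast
    have "bounded_linear (\<lambda>h::complex. axis i (axis j h) :: complex^'q^'p)"
      by (rule bounded_linear_compose[OF bounded_linear_axis bounded_linear_axis])
    then have "(upd_entry Z i j has_derivative (\<lambda>h. 0 + axis i (axis j (h - 0)))) (at (Z $ i $ j))"
      unfolding upd[abs_def]
      by (intro has_derivative_add has_derivative_const
          bounded_linear.has_derivative[of "\<lambda>h. axis i (axis j h)"] has_derivative_diff has_derivative_ident)
    then have "(upd_entry Z i j has_derivative (\<lambda>h. axis i (axis j h))) (at (Z $ i $ j))"
      by simp
    moreover have "upd_entry Z i j (Z $ i $ j) = Z"
      by (simp add: upd vec_eq_iff axis_def)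
    ultimately have 2: "(?u has_derivative (\<lambda>h. D (axis i (axis j h)))) (at (Z $ i $ j))"
      using has_derivative_compose[of "upd_entry Z i j" _ "Z $ i $ j" UNIV F D] F by simp
    \<comment> \<open>The restriction of \<open>F\<close> to one entry has a derivative from
      holomorphy and one from the chain rule; they coincide.\<close>
    show ?thesis using has_derivative_unique[OF 1 2] by metis
  qed
  have "H = (\<Sum>i\<in>UNIV. \<Sum>j\<in>UNIV. axis i (axis j (H $ i $ j)))"
    by (simp add: sum_axis linear_sum[OF bounded_linear.linear[OF bounded_linear_axis], symmetric])
  then have "D H = (\<Sum>i\<in>UNIV. \<Sum>j\<in>UNIV. D (axis i (axis j (H $ i $ j))))"
    by (metis (no_types, lifting) lin linear_sum sum.cong)
  also have "\<dots> = (\<Sum>j\<in>UNIV. \<Sum>i\<in>UNIV. matrix_deriv F Z $ j $ i * H $ i $ j)"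
    by (subst sum.swap) (simp add: entry matrix_deriv_def)
  finally show ?thesis by (simp add: trace_def matrix_matrix_mult_def)
qed

section \<open>Real-orthogonal projections\<close>

lemma projection_characterization:
  assumes "real_orthogonal_projection V proj" "subspace V"
  shows "proj X = Z \<longleftrightarrow> Z \<in> V \<and> (\<forall>Y\<in>V. Y \<bullet> (X - Z) = 0)"
proof -
  have p: "proj X \<in> V" "\<And>Y. Y \<in> V \<Longrightarrow> Y \<bullet> (X - proj X) = 0"
    using assms(1) by (auto simp: real_orthogonal_projection_def inner_matrix_eq)
  show ?thesis
  proof (safe)
    assume Z: "Z \<in> V" "\<forall>Y\<in>V. Y \<bullet> (X - Z) = 0"
    have d: "proj X - Z \<in> V" using p Z assms(2) subspace_diff by blast
    have "(proj X - Z) \<bullet> (proj X - Z)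
        = (proj X - Z) \<bullet> (X - Z) - (proj X - Z) \<bullet> (X - proj X)"
      by (simp add: algebra_simps)
    also have "\<dots> = 0" using p(2)[OF d] Z(2) d by simp
    finally show "proj X = Z" by simp
  qed (use p in auto)
qed

text \<open>Linearity and commutation with the dagger follow from uniqueness of the vector of
  \<open>V\<close> with orthogonal remainder. For the latter, the dagger maps \<open>V\<close> onto
  itself and preserves the inner product.\<close>

lemma
  assumes "real_orthogonal_projection V proj" "subspace V"
  shows projection_in: "proj X \<in> V"
    and projection_inner: "Y \<in> V \<Longrightarrow> Y \<bullet> proj X = Y \<bullet> X"
    and projection_bounded_linear: "bounded_linear proj"
    and projection_dagger: "dagger ` V = V \<Longrightarrow> proj (X\<^sup>\<dagger>) = (proj X)\<^sup>\<dagger>"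
proof -
  note c = projection_characterization[OF assms]
  show in_V: "proj X \<in> V" for X using c[of X "proj X"] by simp
  have orth: "Y \<in> V \<Longrightarrow> Y \<bullet> (X - proj X) = 0" for X Y
    using c[of X "proj X"] by simp
  show inner: "Y \<in> V \<Longrightarrow> Y \<bullet> proj X = Y \<bullet> X" for X Y
    using orth[of Y X] by (simp add: inner_diff_right)
  have "proj (X + Y) = proj X + proj Y" for X Y
    unfolding c using in_V assms(2) by (simp add: inner subspace_add inner_diff_right inner_add_right)
  moreover have "proj (a *\<^sub>R X) = a *\<^sub>R proj X" for a X
    unfolding c using in_V assms(2) by (simp add: inner subspace_scale inner_diff_right)
  ultimately show "bounded_linear proj"
    by (simp add: linear_conv_bounded_linear[symmetric] linear_iff)
  assume V: "dagger ` V = V"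
  show "proj (X\<^sup>\<dagger>) = (proj X)\<^sup>\<dagger>"
    unfolding c
  proof safe
    show "(proj X)\<^sup>\<dagger> \<in> V" using V in_V by blast
    fix Y assume "Y \<in> V"
    then have "Y\<^sup>\<dagger> \<in> V" using V by blast
    then have "Y\<^sup>\<dagger> \<bullet> (X - proj X) = 0" by (rule orth)
    then show "Y \<bullet> (X\<^sup>\<dagger> - (proj X)\<^sup>\<dagger>) = 0"
      using inner_dagger[of "Y\<^sup>\<dagger>" "X - proj X"] by (simp add: dagger_diff)
  qed
qed

section \<open>The Lie algebra of a matrix group\<close>

lemma matrix_power_scaleR:
  "((**) (t *\<^sub>R X) ^^ k) (mat 1) = t ^ k *\<^sub>R (((**) X ^^ k) (mat 1))" for X :: "complex^'c^'c"
  by (induction k) (simp_all add: matrix_mult_algebra)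

text \<open>By bounded bilinearity the product is submultiplicative up to a constant
  \<open>K\<close>, so the series is dominated by a multiple of that of exp(K |X|).\<close>

lemma summable_matrix_exp:
  "summable (\<lambda>k. norm ((1 / fact k) *\<^sub>R (((**) X ^^ k) (mat 1))))" for X :: "complex^'c^'c"
proof -
  obtain K where K: "K > 0"
    "\<And>(A :: complex^'c^'c) (B :: complex^'c^'c). norm (A ** B) \<le> norm A * norm B * K"
    using bounded_bilinear.pos_bounded[OF bounded_bilinear_matrix_mult] by blast
  let ?c = "norm (mat 1 :: complex^'c^'c)"
  have bound: "norm (((**) X ^^ k) (mat 1)) \<le> (K * norm X) ^ k * ?c" for k
  proof (induction k)
    case (Suc k)
    have "norm (((**) X ^^ Suc k) (mat 1)) \<le> norm X * norm (((**) X ^^ k) (mat 1)) * K"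
      using K(2) by simp
    also have "\<dots> \<le> norm X * ((K * norm X) ^ k * ?c) * K"
      using Suc K(1) by (intro mult_right_mono mult_left_mono) auto
    finally show ?case by (simp add: algebra_simps)
  qed simp
  have "summable (\<lambda>k. (inverse (fact k) * (K * norm X) ^ k) * ?c)"
    by (intro summable_mult2 summable_exp)
  then show ?thesis
    by (rule summable_comparison_test'[where N = 0])
      (use bound in \<open>auto simp: divide_simps mult.commute\<close>)
qed

text \<open>In the powers of \<open>g ** X ** h\<close> the inner factors \<open>h ** g\<close>
  cancel, and conjugation is bounded linear, so it passes through the series.\<close>

lemma matrix_exp_conjugate:
  fixes X g h :: "complex^'c^'c"
  assumes "g ** h = mat 1" "h ** g = mat 1"
  shows "matrix_exp (g ** X ** h) = g ** matrix_exp X ** h"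
proof -
  have pow: "((**) (g ** X ** h) ^^ k) (mat 1) = g ** ((**) X ^^ k) (mat 1) ** h" for k
  proof (induction k)
    case (Suc k)
    have "((**) (g ** X ** h) ^^ Suc k) (mat 1) = g ** X ** (h ** g) ** ((**) X ^^ k) (mat 1) ** h"
      by (simp add: Suc matrix_mul_assoc)
    then show ?case by (simp add: assms matrix_mul_assoc)
  qed (simp add: assms)
  have "bounded_linear (\<lambda>Z. g ** Z ** h)"
    using bounded_linear_compose[OF bounded_bilinear.bounded_linear_left[OF bounded_bilinear_matrix_mult]
        bounded_bilinear.bounded_linear_right[OF bounded_bilinear_matrix_mult]] .
  from bounded_linear.suminf[OF this summable_norm_cancel[OF summable_matrix_exp]]
  show ?thesis
    unfolding matrix_exp_def pow by (simp add: matrix_mult_algebra)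
qed

text \<open>Beyond its first two terms the series has norm at most \<open>C\<close> t^2 for |t|
  \<le> 1, so the difference quotient is within \<open>C\<close> |t| of \<open>X\<close>.\<close>

lemma matrix_exp_tendsto:
  fixes X :: "complex^'c^'c"
  shows "((\<lambda>t. (1 / t) *\<^sub>R (matrix_exp (t *\<^sub>R X) - mat 1)) \<longlongrightarrow> X) (at 0)"
proof -
  define a where "a = (\<lambda>k. (1 / fact k) *\<^sub>R (((**) X ^^ k) (mat 1)))"
  define C where "C = (\<Sum>k. norm (a (k + 2)))"
  have sa: "summable (\<lambda>k. norm (a k))"
    using summable_matrix_exp[of X] by (simp add: a_def)
  then have sa2: "summable (\<lambda>k. norm (a (k + 2)))"
    using summable_iff_shift[of "\<lambda>k. norm (a k)" 2] by simp
  have bound: "norm ((1 / t) *\<^sub>R (matrix_exp (t *\<^sub>R X) - mat 1) - X) \<le> C * \<bar>t\<bar>"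
    if t: "t \<noteq> 0" "\<bar>t\<bar> \<le> 1" for t
  proof -
    have e: "(1 / fact k) *\<^sub>R (((**) (t *\<^sub>R X) ^^ k) (mat 1)) = t ^ k *\<^sub>R a k" for k
      by (simp add: a_def matrix_power_scaleR)
    have s: "summable (\<lambda>k. t ^ k *\<^sub>R a k)"
      using summable_norm_cancel[OF summable_matrix_exp[of "t *\<^sub>R X"]] by (simp only: e)
    have "matrix_exp (t *\<^sub>R X) = (\<Sum>k. t ^ (k + 2) *\<^sub>R a (k + 2)) + (\<Sum>k<2. t ^ k *\<^sub>R a k)"
      unfolding matrix_exp_def e by (rule suminf_split_initial_segment[OF s])
    also have "(\<Sum>k<2. t ^ k *\<^sub>R a k) = mat 1 + t *\<^sub>R X"
      by (simp add: a_def numeral_2_eq_2)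
    finally have r: "matrix_exp (t *\<^sub>R X) - mat 1 = t *\<^sub>R X + (\<Sum>k. t ^ (k + 2) *\<^sub>R a (k + 2))"
      by simp
    have n: "norm (t ^ (k + 2) *\<^sub>R a (k + 2)) \<le> t\<^sup>2 * norm (a (k + 2))" for k
    proof -
      have "\<bar>t\<bar> ^ (k + 2) \<le> \<bar>t\<bar> ^ 2" using t(2) by (intro power_decreasing) auto
      then show ?thesis by (auto simp: power_abs abs_mult intro!: mult_right_mono)
    qed
    have "norm (\<Sum>k. t ^ (k + 2) *\<^sub>R a (k + 2)) \<le> (\<Sum>k. t\<^sup>2 * norm (a (k + 2)))"
      by (rule norm_suminf_le[OF n summable_mult[OF sa2]])
    also have "\<dots> = t\<^sup>2 * C" unfolding C_def by (rule suminf_mult[OF sa2])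
    finally have "norm ((1 / t) *\<^sub>R (\<Sum>k. t ^ (k + 2) *\<^sub>R a (k + 2))) \<le> C * \<bar>t\<bar>"
      using t by (simp add: divide_simps power2_eq_square abs_if ac_simps split: if_splits)
    moreover have "(1 / t) *\<^sub>R (matrix_exp (t *\<^sub>R X) - mat 1) - X
        = (1 / t) *\<^sub>R (\<Sum>k. t ^ (k + 2) *\<^sub>R a (k + 2))"
      unfolding r using t(1) by (simp add: scaleR_add_right)
    ultimately show ?thesis by (simp only:)
  qed
  have "((\<lambda>t. C * \<bar>t\<bar>) \<longlongrightarrow> 0) (at 0)"
    by (intro tendsto_eq_intros | simp)+
  then have "((\<lambda>t. (1 / t) *\<^sub>R (matrix_exp (t *\<^sub>R X) - mat 1) - X) \<longlongrightarrow> 0) (at 0)"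
    by (rule Lim_null_comparison[rotated])
      (auto simp: eventually_at intro!: exI[of _ 1] bound)
  then show ?thesis by (simp add: LIM_zero_iff)
qed

text \<open>Since K - 1 = (1 - M) K, it suffices that K stays bounded. Once |1 - M| is below 1/(2B),
  with B the bilinearity constant of the product, the same identity gives |K - 1| \<le> |K|/2 and
  hence |K| \<le> 2 |1|.\<close>

lemma tendsto_matrix_inv_mat_1:
  fixes M :: "'x \<Rightarrow> complex^'c^'c"
  assumes M: "(M \<longlongrightarrow> mat 1) F" and inv: "\<And>t. M t ** K t = mat 1"
  shows "(K \<longlongrightarrow> mat 1) F"
proof -
  obtain B where B: "B > 0"
    "\<And>(A :: complex^'c^'c) (C :: complex^'c^'c). norm (A ** C) \<le> norm A * norm C * B"
    using bounded_bilinear.pos_bounded[OF bounded_bilinear_matrix_mult] by blast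
  let ?I = "mat 1 :: complex^'c^'c"
  have z: "((\<lambda>t. norm (?I - M t)) \<longlongrightarrow> 0) F"
    using tendsto_norm[OF tendsto_diff[OF tendsto_const[of ?I] M]] by simp
  then have "eventually (\<lambda>t. norm (?I - M t) < 1 / (2 * B)) F"
    using B(1) by (intro order_tendstoD(2)) auto
  then have "eventually (\<lambda>t. norm (K t - ?I) \<le> norm (?I - M t) * (2 * norm ?I * B)) F"
  proof eventually_elim
    case (elim t)
    have "K t - ?I = (?I - M t) ** K t" by (simp add: matrix_mult_algebra inv)
    then have n: "norm (K t - ?I) \<le> norm (?I - M t) * norm (K t) * B" using B(2) by metis
    also have "\<dots> \<le> (1 / (2 * B)) * norm (K t) * B"
      using elim B(1) by (intro mult_right_mono) auto
    also have "\<dots> = norm (K t) / 2" using B(1) by simp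
    finally have "norm (K t) \<le> 2 * norm ?I"
      using norm_triangle_sub[of "K t" ?I] by simp
    then have "norm (?I - M t) * norm (K t) * B \<le> norm (?I - M t) * (2 * norm ?I) * B"
      using B(1) by (intro mult_right_mono mult_left_mono) auto
    then show ?case using n by (simp add: mult.assoc)
  qed
  moreover have "((\<lambda>t. norm (?I - M t) * (2 * norm ?I * B)) \<longlongrightarrow> 0) F"
    using tendsto_mult_left_zero[OF z] by simp
  ultimately have "((\<lambda>t. K t - ?I) \<longlongrightarrow> 0) F" by (rule Lim_null_comparison)
  then show ?thesis by (simp add: LIM_zero_iff)
qed

text \<open>The bracket is the derivative at \<open>0\<close> of \<open>t \<mapsto> e\<^sup>t\<^sup>X Y e\<^sup>-\<^sup>t\<^sup>X\<close>, a curve in the Lie algebra.\<close>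

lemma Lie_algebra_commutator:
  fixes \<GG> :: "(complex^'c^'c) set"
  assumes group: "matrix_Lie_group \<GG>" and sub: "subspace (Lie_algebra \<GG>)"
    and X: "X \<in> Lie_algebra \<GG>" and Y: "Y \<in> Lie_algebra \<GG>"
  shows "commutator X Y \<in> Lie_algebra \<GG>"
proof -
  define M K where "M = (\<lambda>t::real. matrix_exp (t *\<^sub>R X))" and "K = (\<lambda>t. matrix_inv (M t))"
  have MG: "M t \<in> \<GG>" for t using X by (simp add: M_def Lie_algebra_def)
  then have KG: "K t \<in> \<GG>" for t using group by (simp add: K_def matrix_Lie_group_def)
  have "invertible (M t)" for t using MG group by (auto simp: matrix_Lie_group_def)
  then have "M t ** K t = mat 1 \<and> K t ** M t = mat 1" for t
    unfolding K_def matrix_inv_def invertible_def by (rule someI_ex)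
  then have MK: "M t ** K t = mat 1" and KM: "K t ** M t = mat 1" for t by auto
  have conj: "M t ** Y ** K t \<in> Lie_algebra \<GG>" for t
  proof -
    have "matrix_exp (s *\<^sub>R (M t ** Y ** K t)) = M t ** matrix_exp (s *\<^sub>R Y) ** K t" for s
      using matrix_exp_conjugate[OF MK KM, of t "s *\<^sub>R Y"] by (simp add: matrix_mult_algebra)
    moreover have "matrix_exp (s *\<^sub>R Y) \<in> \<GG>" for s using Y by (simp add: Lie_algebra_def)
    ultimately show ?thesis using MG KG group by (simp add: Lie_algebra_def matrix_Lie_group_def)
  qed
  note mult_tendsto = bounded_bilinear.tendsto[OF bounded_bilinear_matrix_mult]
  let ?D = "\<lambda>t. (1 / t) *\<^sub>R (M t - mat 1)"
  have D: "(?D \<longlongrightarrow> X) (at 0)" unfolding M_def by (rule matrix_exp_tendsto)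
  \<comment> \<open>Convergence of the difference quotients already gives continuity at 0, because M
    = 1 + t D away from 0.\<close>
  have "((\<lambda>t. t *\<^sub>R ?D t + mat 1) \<longlongrightarrow> 0 *\<^sub>R X + mat 1) (at 0)"
    by (intro tendsto_intros D)
  then have "((\<lambda>t. t *\<^sub>R ?D t + mat 1) \<longlongrightarrow> mat 1) (at 0)" by simp
  then have "(M \<longlongrightarrow> mat 1) (at 0)"
    by (rule Lim_transform_eventually) (auto simp: eventually_at_filter)
  then have K1: "(K \<longlongrightarrow> mat 1) (at 0)" using MK by (rule tendsto_matrix_inv_mat_1)
  have "((\<lambda>t. (?D t ** Y - Y ** ?D t) ** K t) \<longlongrightarrow> (X ** Y - Y ** X) ** mat 1) (at 0)"
    by (intro mult_tendsto tendsto_diff D K1 tendsto_const)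
  \<comment> \<open>The difference quotient of the conjugation curve becomes a commutator times
    \<open>K t\<close>, so only the limits of \<open>?D\<close> and \<open>K\<close> are needed. At
    t = 0 both sides are 0 because 1/0 = 0.\<close>
  moreover have "(?D t ** Y - Y ** ?D t) ** K t = (1 / t) *\<^sub>R (M t ** Y ** K t - Y)" for t
    by (simp add: matrix_mult_algebra matrix_mul_assoc[symmetric] MK scaleR_diff_right)
  ultimately have "((\<lambda>t. (1 / t) *\<^sub>R (M t ** Y ** K t - Y)) \<longlongrightarrow> commutator X Y) (at 0)"
    by (simp add: commutator_def)
  then show ?thesis
    by (rule Lim_in_closed_set[OF closed_subspace[OF sub], rotated 2])
      (auto intro!: always_eventually subspace_scale[OF sub] subspace_diff[OF sub] conj Y)
qed

text \<open>A vector orthogonal to \<open>V\<close> annihilates \<open>f\<close> and hence its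
  derivative; in finite dimension the double orthogonal complement of \<open>V\<close> is
  \<open>V\<close>.\<close>

lemma partial_d_in_subspace:
  fixes f :: "real^'n \<Rightarrow> 'b::euclidean_space"
  assumes V: "subspace V" and f: "smooth f" "\<And>x. f x \<in> V"
  shows "partial_d \<mu> f x \<in> V"
proof -
  have "w \<bullet> partial_d \<mu> f x = 0" if w: "w \<in> V\<^sup>\<bottom>" for w
  proof -
    have "w \<bullet> f y = 0" for y
      using w f(2)[of y] by (auto simp: orthogonal_comp_def orthogonal_def inner_commute)
    then have "partial_d \<mu> (\<lambda>y. w \<bullet> f y) x = 0"
      using partial_d_eqI[OF has_derivative_const] by simp
    then show ?thesis by (simp add: partial_d_bounded_linear[OF f(1) bounded_linear_inner_right])
  qed
  then have "partial_d \<mu> f x \<in> V\<^sup>\<bottom>\<^sup>\<bottom>"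
    by (simp add: orthogonal_comp_def orthogonal_def)
  then show ?thesis by (simp add: orthogonal_comp_self[OF V])
qed

section \<open>Derivatives of the proto-Lagrangians\<close>

lemma col_block_block_col [simp]: "col_block (block_col f) = f"
  and row_block_block_row [simp]: "row_block (block_row g) = g"
  by (auto simp: block_col_def col_block_def block_row_def row_block_def vec_eq_iff fun_eq_iff)

lemma dagger_block_col: "(block_col f)\<^sup>\<dagger> = block_row (\<lambda>\<mu>. (f \<mu>)\<^sup>\<dagger>)"
  by (simp add: block_col_def block_row_def vec_eq_iff)

lemma smooth_block_col:
  assumes "\<And>\<mu>. smooth (f \<mu>)"
  shows "smooth (\<lambda>x. block_col (\<lambda>\<mu>. f \<mu> x))"
  unfolding block_col_def by (intro smooth_vec smooth_vec_nth assms)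

lemma smooth_block_row:
  assumes "\<And>\<mu>. smooth (f \<mu>)"
  shows "smooth (\<lambda>x. block_row (\<lambda>\<mu>. f \<mu> x))"
  unfolding block_row_def by (intro smooth_vec smooth_vec_nth assms)

text \<open>Holomorphy is assumed in the whole block matrix, while the derivatives are taken
  blockwise. Updating an entry of a block updates one entry of the whole, so block derivatives are
  blocks of the full derivative.\<close>

lemma L_col_nth:
  "L_col L \<mu> (P, Q, R, S, x) $ i $ j = matrix_deriv (\<lambda>Z. L (P, Q, Z, S, x)) R $ i $ (\<mu>, j)"
proof -
  have "block_col ((col_block R)(\<mu> := upd_entry (col_block R \<mu>) j i z)) = upd_entry R (\<mu>, j) i z" for z
    by (auto simp: block_col_def col_block_def upd_entry_def vec_eq_iff)
  then show ?thesis by (simp add: matrix_deriv_def) (simp add: col_block_def)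
qed

lemma L_row_nth:
  "L_row L \<mu> (P, Q, R, S, x) $ i $ j = matrix_deriv (\<lambda>Z. L (P, Q, R, Z, x)) S $ (\<mu>, i) $ j"
proof -
  have "block_row ((row_block S)(\<mu> := upd_entry (row_block S \<mu>) j i z)) = upd_entry S j (\<mu>, i) z" for z
    by (auto simp: block_row_def row_block_def upd_entry_def vec_eq_iff)
  then show ?thesis by (simp add: matrix_deriv_def) (simp add: row_block_def)
qed

lemma sum_UNIV_prod: "(\<Sum>p\<in>UNIV. f p) = (\<Sum>a\<in>UNIV. \<Sum>b\<in>UNIV. f (a, b))"
  by (simp add: sum.cartesian_product)

lemma trace_mult_col_blocks:
  assumes "\<And>\<mu> i j. N \<mu> $ i $ j = M $ i $ (\<mu>, j)"
  shows "trace (M ** U) = (\<Sum>\<mu>\<in>UNIV. trace (N \<mu> ** col_block U \<mu>))"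
  unfolding trace_def matrix_matrix_mult_def sum_UNIV_prod
  by (simp add: assms col_block_def sum_UNIV_prod) (rule sum.swap)

lemma trace_mult_row_blocks:
  assumes "\<And>\<mu> i j. N \<mu> $ i $ j = M $ (\<mu>, i) $ j"
  shows "trace (M ** W) = (\<Sum>\<mu>\<in>UNIV. trace (N \<mu> ** row_block W \<mu>))"
  unfolding trace_def matrix_matrix_mult_def
  by (simp add: assms row_block_def sum_UNIV_prod)

text \<open>The companion of \<open>L_o\<close> for the argument \<open>Q\<close>. In a variation of
  the field it is paired with \<open>H\<^sup>\<dagger>\<close>, so it belongs to the antilinear part
  of the first variation.\<close>

definition L_o_star ::
    "(('n::finite, 'r::finite, 'c::finite) matter_arg \<Rightarrow> complex) \<Rightarrow>
      ('n, 'r, 'c) matter_arg \<Rightarrow> complex^'c^'r" where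
  "L_o_star L = (\<lambda>(P, Q, R, S, x). matrix_deriv (\<lambda>Z. L (P, Z, R, S, x)) Q)"

text \<open>The derivative splits over the four matrix arguments, in each of which \<open>L\<close>
  is holomorphic. The last component of the direction is 0 because fields are varied at a fixed
  point.\<close>

lemma matter_frechet_derivative:
  fixes a :: "('n::finite, 'r::finite, 'c::finite) matter_arg"
  assumes L: "matter_proto_lagrangian L"
  shows "frechet_derivative L (at a) (H, K, U, W, 0) =
      trace (L_o L a ** H) + trace (L_o_star L a ** K)
      + (\<Sum>\<mu>\<in>UNIV. trace (L_col L \<mu> a ** col_block U \<mu>))
      + (\<Sum>\<mu>\<in>UNIV. trace (L_row L \<mu> a ** row_block W \<mu>))"
proof -
  obtain P Q R S x where a: "a = (P, Q, R, S, x)" by (metis surj_pair)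
  have s: "smooth L" using L by (simp add: matter_proto_lagrangian_def)
  let ?D = "frechet_derivative L (at a)"
  have hol: "matrix_holomorphic (\<lambda>Z. L (Z, Q, R, S, x))" "matrix_holomorphic (\<lambda>Z. L (P, Z, R, S, x))"
    "matrix_holomorphic (\<lambda>Z. L (P, Q, Z, S, x))" "matrix_holomorphic (\<lambda>Z. L (P, Q, R, Z, x))"
    using L by (simp_all add: matter_proto_lagrangian_def)
  have D: "(L has_derivative ?D) (at a)" using s by (rule smooth_has_derivative)
  have l: "linear ?D" using D has_derivative_linear by blast
  have "((\<lambda>Z. L (Z, Q, R, S, x)) has_derivative (\<lambda>H. ?D (H, 0, 0, 0, 0))) (at P)"
    by (rule has_derivative_compose[where g = L and g' = ?D])
      (use D in \<open>auto simp: a zero_prod_def intro!: derivative_eq_intros\<close>)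
  then have 1: "?D (H, 0, 0, 0, 0) = trace (L_o L a ** H)"
    using trace_matrix_deriv[OF _ hol(1)] by (simp add: a)
  have "((\<lambda>Z. L (P, Z, R, S, x)) has_derivative (\<lambda>H. ?D (0, H, 0, 0, 0))) (at Q)"
    by (rule has_derivative_compose[where g = L and g' = ?D])
      (use D in \<open>auto simp: a zero_prod_def intro!: derivative_eq_intros\<close>)
  then have 2: "?D (0, K, 0, 0, 0) = trace (L_o_star L a ** K)"
    using trace_matrix_deriv[OF _ hol(2)] by (simp add: a L_o_star_def)
  have "((\<lambda>Z. L (P, Q, Z, S, x)) has_derivative (\<lambda>H. ?D (0, 0, H, 0, 0))) (at R)"
    by (rule has_derivative_compose[where g = L and g' = ?D])
      (use D in \<open>auto simp: a zero_prod_def intro!: derivative_eq_intros\<close>)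
  then have 3: "?D (0, 0, U, 0, 0) = (\<Sum>\<mu>\<in>UNIV. trace (L_col L \<mu> a ** col_block U \<mu>))"
    using trace_matrix_deriv[OF _ hol(3)] trace_mult_col_blocks[of "\<lambda>\<mu>. L_col L \<mu> a" _ U, unfolded a, OF L_col_nth]
    by (simp add: a del: L_col.simps)
  have "((\<lambda>Z. L (P, Q, R, Z, x)) has_derivative (\<lambda>H. ?D (0, 0, 0, H, 0))) (at S)"
    by (rule has_derivative_compose[where g = L and g' = ?D])
      (use D in \<open>auto simp: a zero_prod_def intro!: derivative_eq_intros\<close>)
  then have 4: "?D (0, 0, 0, W, 0) = (\<Sum>\<mu>\<in>UNIV. trace (L_row L \<mu> a ** row_block W \<mu>))"
    using trace_matrix_deriv[OF _ hol(4)] trace_mult_row_blocks[of "\<lambda>\<mu>. L_row L \<mu> a" _ W, unfolded a, OF L_row_nth]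
    by (simp add: a del: L_row.simps)
  have "(H, K, U, W, 0) = (H, 0, 0, 0, 0) + (0, K, 0, 0, 0) + (0, 0, U, 0, 0) + (0, 0, 0, W, 0::real^'n)"
    by simp
  then show ?thesis by (simp only: linear_add[OF l] 1 2 3 4)
qed

lemma col_block_axis: "col_block (axis (\<mu>, i) z) \<nu> = (if \<mu> = \<nu> then axis i z else 0)"
  by (auto simp: col_block_def axis_def vec_eq_iff)

lemma row_block_axis: "row_block (axis i (axis (\<mu>, j) z)) \<nu> = (if \<mu> = \<nu> then axis i (axis j z) else 0)"
  by (auto simp: row_block_def axis_def vec_eq_iff)

lemma block_zero [simp]: "col_block 0 \<mu> = 0" "row_block 0 \<mu> = 0"
  by (simp_all add: col_block_def row_block_def vec_eq_iff)

lemma trace_zero [simp]: "trace (0 :: complex^'q^'q) = 0"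
  by (simp add: trace_def)

text \<open>The entrywise \<open>deriv\<close> gives no joint smoothness by itself. Each entry is
  recovered as a derivative of \<open>L\<close> in the fixed direction of a matrix unit, which is
  smooth; the block derivatives below are treated alike.\<close>

lemma smooth_L_o:
  assumes L: "matter_proto_lagrangian L" and s: "smooth s"
  shows "smooth (\<lambda>x. L_o L (s x))"
proof -
  have "L_o L (s x) $ i $ j = frechet_derivative L (at (s x)) (axis j (axis i 1), 0, 0, 0, 0)" for x i j
    by (simp add: matter_frechet_derivative[OF L] trace_mult_axis)
  then have "(\<lambda>x. L_o L (s x)) = (\<lambda>x. \<chi> i j. frechet_derivative L (at (s x)) (axis j (axis i 1), 0, 0, 0, 0))"
    by (simp add: vec_eq_iff fun_eq_iff)
  moreover have "smooth L" using L by (simp add: matter_proto_lagrangian_def)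
  ultimately show ?thesis
    by (simp only:) (intro smooth_vec smooth_compose[OF smooth_frechet, of L s] s)
qed

lemma smooth_L_col:
  assumes L: "matter_proto_lagrangian L" and s: "smooth s"
  shows "smooth (\<lambda>x. L_col L \<mu> (s x))"
proof -
  have "L_col L \<mu> (s x) $ i $ j = frechet_derivative L (at (s x)) (0, 0, axis (\<mu>, j) (axis i 1), 0, 0)" for x i j
    by (simp add: matter_frechet_derivative[OF L] col_block_axis trace_mult_axis
        if_distrib[of "\<lambda>Z. trace (_ ** Z)"] cong: if_cong)
  then have "(\<lambda>x. L_col L \<mu> (s x)) = (\<lambda>x. \<chi> i j. frechet_derivative L (at (s x)) (0, 0, axis (\<mu>, j) (axis i 1), 0, 0))"
    by (simp add: vec_eq_iff fun_eq_iff)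
  moreover have "smooth L" using L by (simp add: matter_proto_lagrangian_def)
  ultimately show ?thesis
    by (simp only:) (intro smooth_vec smooth_compose[OF smooth_frechet, of L s] s)
qed

lemma smooth_L_row:
  assumes L: "matter_proto_lagrangian L" and s: "smooth s"
  shows "smooth (\<lambda>x. L_row L \<mu> (s x))"
proof -
  have "L_row L \<mu> (s x) $ i $ j = frechet_derivative L (at (s x)) (0, 0, 0, axis j (axis (\<mu>, i) 1), 0)" for x i j
    by (simp add: matter_frechet_derivative[OF L] row_block_axis trace_mult_axis
        if_distrib[of "\<lambda>Z. trace (_ ** Z)"] cong: if_cong)
  then have "(\<lambda>x. L_row L \<mu> (s x)) = (\<lambda>x. \<chi> i j. frechet_derivative L (at (s x)) (0, 0, 0, axis j (axis (\<mu>, i) 1), 0))"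
    by (simp add: vec_eq_iff fun_eq_iff)
  moreover have "smooth L" using L by (simp add: matter_proto_lagrangian_def)
  ultimately show ?thesis
    by (simp only:) (intro smooth_vec smooth_compose[OF smooth_frechet, of L s] s)
qed

section \<open>Derivatives of gauge proto-Lagrangians\<close>

lemma upd_block_eq: "upd_block P \<mu> \<nu> Z = P + axis \<mu> (axis \<nu> (Z - P $ \<mu> $ \<nu>))" for P :: "'a::ab_group_add^'n^'n"
  by (auto simp: upd_block_def vec_eq_iff axis_def)

lemma upd_block_has_derivative:
  "(upd_block P \<mu> \<nu> has_derivative (\<lambda>H. axis \<mu> (axis \<nu> H))) (at (P $ \<mu> $ \<nu>))"
  for P :: "'a::real_normed_vector^'n^'n"
proof -
  have "bounded_linear (\<lambda>h. axis \<mu> (axis \<nu> h) :: 'a^'n^'n)"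
    by (rule bounded_linear_compose[OF bounded_linear_axis bounded_linear_axis])
  then have "(upd_block P \<mu> \<nu> has_derivative (\<lambda>H. 0 + axis \<mu> (axis \<nu> (H - 0)))) (at (P $ \<mu> $ \<nu>))"
    unfolding upd_block_eq[abs_def]
    by (intro has_derivative_add has_derivative_const
        bounded_linear.has_derivative[of "\<lambda>h. axis \<mu> (axis \<nu> h)"] has_derivative_diff has_derivative_ident)
  then show ?thesis by simp
qed

lemma upd_block_same [simp]: "upd_block P \<mu> \<nu> (P $ \<mu> $ \<nu>) = P"
  by (auto simp: upd_block_def vec_eq_iff)

text \<open>The case distinction reflects the encoding: \<open>G\<close> ignores the entries on and
  below the diagonal, so it is constant in those directions.\<close>

lemma gauge_frechet_derivative_axis:
  fixes G :: "('n::{finite,linorder}, 'c::finite) gauge_arg \<Rightarrow> complex"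
  assumes G: "gauge_proto_lagrangian \<gg> G"
  shows "frechet_derivative G (at (P, Q, x)) (axis \<mu> (axis \<nu> H), 0, 0) =
      (if \<mu> < \<nu> then trace (G_P G \<mu> \<nu> (P, Q, x) ** H) else 0)"
    and "frechet_derivative G (at (P, Q, x)) (0, axis \<mu> (axis \<nu> H), 0) =
      (if \<mu> < \<nu> then trace (G_Q G \<mu> \<nu> (P, Q, x) ** H) else 0)"
proof -
  let ?D = "frechet_derivative G (at (P, Q, x))"
  have D: "(G has_derivative ?D) (at (P, Q, x))"
    using G by (intro smooth_has_derivative) (simp add: gauge_proto_lagrangian_def)
  have indep: "G (P, Q, x) = G (P', Q', x)"
    if "\<And>\<mu> \<nu>. \<mu> < \<nu> \<Longrightarrow> P $ \<mu> $ \<nu> = P' $ \<mu> $ \<nu> \<and> Q $ \<mu> $ \<nu> = Q' $ \<mu> $ \<nu>" for P P' Q Q' x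
    using G that unfolding gauge_proto_lagrangian_def by blast
  have hol: "matrix_holomorphic (\<lambda>Z. G (upd_block P \<mu> \<nu> Z, Q, x))"
      "matrix_holomorphic (\<lambda>Z. G (P, upd_block Q \<mu> \<nu> Z, x))" if "\<mu> < \<nu>"
    using G that by (simp_all add: gauge_proto_lagrangian_def)
  have 1: "((\<lambda>Z. G (upd_block P \<mu> \<nu> Z, Q, x)) has_derivative (\<lambda>H. ?D (axis \<mu> (axis \<nu> H), 0, 0))) (at (P $ \<mu> $ \<nu>))"
    by (rule has_derivative_compose[where g = G and g' = ?D])
      (use D in \<open>auto simp: zero_prod_def intro!: derivative_eq_intros upd_block_has_derivative\<close>)
  have 2: "((\<lambda>Z. G (P, upd_block Q \<mu> \<nu> Z, x)) has_derivative (\<lambda>H. ?D (0, axis \<mu> (axis \<nu> H), 0))) (at (Q $ \<mu> $ \<nu>))"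
    by (rule has_derivative_compose[where g = G and g' = ?D])
      (use D in \<open>auto simp: zero_prod_def intro!: derivative_eq_intros upd_block_has_derivative\<close>)
  show "?D (axis \<mu> (axis \<nu> H), 0, 0) = (if \<mu> < \<nu> then trace (G_P G \<mu> \<nu> (P, Q, x) ** H) else 0)"
  proof (cases "\<mu> < \<nu>")
    case True
    then show ?thesis using trace_matrix_deriv[OF 1 hol(1)] by simp
  next
    case False
    then have "(\<lambda>Z. G (upd_block P \<mu> \<nu> Z, Q, x)) = (\<lambda>Z. G (P, Q, x))"
      by (intro ext indep) (auto simp: upd_block_def)
    then show ?thesis
      using False fun_cong[OF has_derivative_unique[OF 1], of "\<lambda>_. 0" H] has_derivative_const by simp
  qed
  show "?D (0, axis \<mu> (axis \<nu> H), 0) = (if \<mu> < \<nu> then trace (G_Q G \<mu> \<nu> (P, Q, x) ** H) else 0)"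
  proof (cases "\<mu> < \<nu>")
    case True
    then show ?thesis using trace_matrix_deriv[OF 2 hol(2)] by simp
  next
    case False
    then have "(\<lambda>Z. G (P, upd_block Q \<mu> \<nu> Z, x)) = (\<lambda>Z. G (P, Q, x))"
      by (intro ext indep) (auto simp: upd_block_def)
    then show ?thesis
      using False fun_cong[OF has_derivative_unique[OF 2], of "\<lambda>_. 0" H] has_derivative_const by simp
  qed
qed

lemma sum_axis_axis: "(\<Sum>i\<in>UNIV. \<Sum>j\<in>UNIV. axis i (axis j (U $ i $ j))) = (U :: 'a::real_normed_vector^'m^'n)"
  by (simp add: sum_axis linear_sum[OF bounded_linear.linear[OF bounded_linear_axis], symmetric])

lemma gauge_frechet_derivative:
  fixes G :: "('n::{finite,linorder}, 'c::finite) gauge_arg \<Rightarrow> complex"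
  assumes G: "gauge_proto_lagrangian \<gg> G"
  shows "frechet_derivative G (at a) (U, W, 0) = (\<Sum>\<mu>\<in>UNIV. \<Sum>\<nu>\<in>UNIV.
      if \<mu> < \<nu> then trace (G_P G \<mu> \<nu> a ** U $ \<mu> $ \<nu>) + trace (G_Q G \<mu> \<nu> a ** W $ \<mu> $ \<nu>) else 0)"
proof -
  obtain P Q x where a: "a = (P, Q, x)" by (metis surj_pair)
  let ?D = "frechet_derivative G (at a)"
  have "smooth G" using G by (simp add: gauge_proto_lagrangian_def)
  then have l: "linear ?D"
    using linear_frechet_derivative smooth_differentiable by blast
  have l1: "linear (\<lambda>U. ?D (U, 0, 0))" and l2: "linear (\<lambda>W. ?D (0, W, 0))"
    using linear_compose[OF _ l, of "\<lambda>U. (U, 0, 0)"] linear_compose[OF _ l, of "\<lambda>W. (0, W, 0)"]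
    by (auto simp: o_def linear_iff)
  have "?D (U, W, 0) = ?D (U, 0, 0) + ?D (0, W, 0)"
    using linear_add[OF l, of "(U, 0, 0)" "(0, W, 0)"] by simp
  also have "?D (U, 0, 0) = ?D (\<Sum>\<mu>\<in>UNIV. \<Sum>\<nu>\<in>UNIV. axis \<mu> (axis \<nu> (U $ \<mu> $ \<nu>)), 0, 0)"
    by (simp add: sum_axis_axis)
  also have "\<dots> = (\<Sum>\<mu>\<in>UNIV. \<Sum>\<nu>\<in>UNIV. ?D (axis \<mu> (axis \<nu> (U $ \<mu> $ \<nu>)), 0, 0))"
    by (simp add: linear_sum[OF l1])
  also have "?D (0, W, 0) = ?D (0, \<Sum>\<mu>\<in>UNIV. \<Sum>\<nu>\<in>UNIV. axis \<mu> (axis \<nu> (W $ \<mu> $ \<nu>)), 0)"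
    by (simp add: sum_axis_axis)
  also have "\<dots> = (\<Sum>\<mu>\<in>UNIV. \<Sum>\<nu>\<in>UNIV. ?D (0, axis \<mu> (axis \<nu> (W $ \<mu> $ \<nu>)), 0))"
    by (simp add: linear_sum[OF l2])
  finally show ?thesis
    unfolding a gauge_frechet_derivative_axis[OF G] sum.distrib[symmetric]
    by (auto intro!: sum.cong)
qed

lemma smooth_G_P:
  fixes G :: "('n::{finite,linorder}, 'c::finite) gauge_arg \<Rightarrow> complex"
  assumes G: "gauge_proto_lagrangian \<gg> G" and s: "smooth s" and "\<mu> < \<nu>"
  shows "smooth (\<lambda>x. G_P G \<mu> \<nu> (s x))"
proof -
  have "G_P G \<mu> \<nu> a $ i $ j = frechet_derivative G (at a) (axis \<mu> (axis \<nu> (axis j (axis i 1))), 0, 0)" for a i j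
    using \<open>\<mu> < \<nu>\<close> by (cases a) (simp add: gauge_frechet_derivative_axis[OF G] trace_mult_axis)
  then have "(\<lambda>x. G_P G \<mu> \<nu> (s x)) = (\<lambda>x. \<chi> i j. frechet_derivative G (at (s x)) (axis \<mu> (axis \<nu> (axis j (axis i 1))), 0, 0))"
    by (simp add: vec_eq_iff fun_eq_iff)
  moreover have "smooth G" using G by (simp add: gauge_proto_lagrangian_def)
  ultimately show ?thesis
    by (simp only:) (intro smooth_vec smooth_compose[OF smooth_frechet, of G s] s)
qed

section \<open>Variations of the fields\<close>

lemma smooth_dagger: "smooth f \<Longrightarrow> smooth (\<lambda>x. (f x)\<^sup>\<dagger>)"
  by (rule smooth_bounded_linear[OF bounded_linear_dagger])

lemma smooth_matrix_mult:
  fixes f :: "'a::euclidean_space \<Rightarrow> complex^'q^'p"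
  shows "smooth f \<Longrightarrow> smooth g \<Longrightarrow> smooth (\<lambda>x. f x ** g x)"
  by (rule smooth_bilinear[OF bounded_bilinear_matrix_mult])

lemma partial_d_dagger: "smooth f \<Longrightarrow> partial_d \<mu> (\<lambda>x. (f x)\<^sup>\<dagger>) x = (partial_d \<mu> f x)\<^sup>\<dagger>"
  by (rule partial_d_bounded_linear[OF _ bounded_linear_dagger])

lemma smooth_scaleR: "smooth f \<Longrightarrow> smooth (\<lambda>x. e *\<^sub>R f x)"
  by (rule smooth_bounded_linear[OF bounded_linear_scaleR_right])

lemma partial_d_add_scaleR:
  "smooth f \<Longrightarrow> smooth g \<Longrightarrow>
    partial_d \<mu> (\<lambda>x. f x + e *\<^sub>R g x) x = partial_d \<mu> f x + e *\<^sub>R partial_d \<mu> g x"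
  by (simp add: partial_d_add smooth_scaleR partial_d_bounded_linear[OF _ bounded_linear_scaleR_right])

text \<open>The potential acts from the right, so this covariant derivative is complex linear in
  \<open>H\<close>.\<close>

definition cov_d :: "('n, 'r, 'c) matter_field \<Rightarrow> ('n, 'c) potential \<Rightarrow> 'n \<Rightarrow> real^'n::finite \<Rightarrow> complex^'c::finite^'r::finite" where
  "cov_d H A \<mu> x = partial_d \<mu> H x + H x ** A \<mu> x"

text \<open>The covariant derivative in the adjoint representation, with the sign convention of
  \<open>curvature\<close>. It is both the response of the curvature to a variation of the potential
  and the operator applied to the projected \<open>G_hat\<close> in the gauge equations.\<close>

definition adj_d :: "('n::finite, 'c) potential \<Rightarrow> (real^'n \<Rightarrow> complex^'c^'c) \<Rightarrow> 'n \<Rightarrow> real^'n \<Rightarrow> complex^'c::finite^'c" where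
  "adj_d A H \<mu> x = partial_d \<mu> H x - commutator (A \<mu> x) (H x)"

lemma smooth_cov_d: "smooth H \<Longrightarrow> smooth (A \<mu>) \<Longrightarrow> smooth (cov_d H A \<mu>)"
  unfolding cov_d_def[abs_def] by (intro smooth_add smooth_partial_d smooth_matrix_mult)

lemma smooth_commutator: "smooth f \<Longrightarrow> smooth g \<Longrightarrow> smooth (\<lambda>x. commutator (f x) (g x))"
  unfolding commutator_def by (intro smooth_diff smooth_matrix_mult)

lemma smooth_adj_d: "smooth H \<Longrightarrow> smooth (A \<mu>) \<Longrightarrow> smooth (adj_d A H \<mu>)"
  unfolding adj_d_def[abs_def] by (intro smooth_diff smooth_partial_d smooth_commutator)

definition matter_var :: "('n, 'r, 'c) matter_field \<Rightarrow> ('n, 'c) potential \<Rightarrow> real^'n \<Rightarrow>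
    ('n::finite, 'r::finite, 'c::finite) matter_arg" where
  "matter_var H A x = (H x, (H x)\<^sup>\<dagger>, block_col (\<lambda>\<mu>. cov_d H A \<mu> x), block_row (\<lambda>\<mu>. (cov_d H A \<mu> x)\<^sup>\<dagger>), 0)"

definition potential_var :: "'n \<Rightarrow> complex^'c^'r \<Rightarrow> ('n::finite, 'r::finite, 'c::finite) matter_arg" where
  "potential_var \<kappa> U = (0, 0, block_col (\<lambda>\<mu>. if \<mu> = \<kappa> then U else 0),
      block_row (\<lambda>\<mu>. if \<mu> = \<kappa> then U\<^sup>\<dagger> else 0), 0)"

definition curvature_var :: "'n \<Rightarrow> ('n::finite, 'c::finite) potential \<Rightarrow> (real^'n \<Rightarrow> complex^'c^'c) \<Rightarrow>
    'n \<Rightarrow> 'n \<Rightarrow> real^'n \<Rightarrow> complex^'c^'c" where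
  "curvature_var \<kappa> A H \<mu> \<nu> x =
    (if \<nu> = \<kappa> then adj_d A H \<mu> x else 0) - (if \<mu> = \<kappa> then adj_d A H \<nu> x else 0)"

text \<open>The row argument is the dagger of the column argument, so static arguments have the
  special form for which the condition on \<open>proj\<close> is stated.\<close>

lemma static_arg_eq:
  assumes "smooth \<Psi>"
  shows "static_arg \<Psi> A x = (\<Psi> x, (\<Psi> x)\<^sup>\<dagger>, block_col (\<lambda>\<mu>. cov_d \<Psi> A \<mu> x), (block_col (\<lambda>\<mu>. cov_d \<Psi> A \<mu> x))\<^sup>\<dagger>, x)"
  by (simp add: static_arg_def dagger_block_col cov_d_def partial_d_dagger[OF assms] dagger_add dagger_mult)

lemma smooth_static_arg:
  assumes "smooth \<Psi>" "\<And>\<mu>. smooth (A \<mu>)"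
  shows "smooth (static_arg \<Psi> A)"
proof -
  have "smooth (\<lambda>x. (\<Psi> x, (\<Psi> x)\<^sup>\<dagger>, block_col (\<lambda>\<mu>. cov_d \<Psi> A \<mu> x), (block_col (\<lambda>\<mu>. cov_d \<Psi> A \<mu> x))\<^sup>\<dagger>, x))"
    by (intro smooth_Pair smooth_dagger smooth_block_col smooth_cov_d assms smooth_linear
        bounded_linear_ident)
  then show ?thesis by (simp add: static_arg_eq[OF assms(1), symmetric])
qed

lemma smooth_matter_var:
  assumes "smooth H" "\<And>\<mu>. smooth (A \<mu>)"
  shows "smooth (matter_var H A)"
  unfolding matter_var_def[abs_def]
  by (intro smooth_Pair smooth_dagger smooth_block_col smooth_block_row smooth_cov_d assms smooth_const)

lemma block_col_add_scaleR: "block_col f + e *\<^sub>R block_col g = block_col (\<lambda>\<mu>. f \<mu> + e *\<^sub>R g \<mu>)"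
  and block_row_add_scaleR: "block_row f' + e *\<^sub>R block_row g' = block_row (\<lambda>\<mu>. f' \<mu> + e *\<^sub>R g' \<mu>)"
  by (simp_all add: block_col_def block_row_def vec_eq_iff)

lemma static_arg_matter_var:
  assumes "smooth \<Psi>" "smooth H"
  shows "static_arg (\<lambda>y. \<Psi> y + e *\<^sub>R H y) A x = static_arg \<Psi> A x + e *\<^sub>R matter_var H A x"
proof -
  have "cov_d (\<lambda>y. \<Psi> y + e *\<^sub>R H y) A \<mu> x = cov_d \<Psi> A \<mu> x + e *\<^sub>R cov_d H A \<mu> x" for \<mu>
    by (simp add: cov_d_def partial_d_add_scaleR[OF assms] matrix_mult_algebra algebra_simps)
  moreover have "smooth (\<lambda>y. \<Psi> y + e *\<^sub>R H y)" using assms by (intro smooth_add smooth_scaleR)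
  ultimately show ?thesis
    by (simp add: static_arg_eq assms matter_var_def dagger_block_col dagger_add dagger_scaleR
        block_col_add_scaleR block_row_add_scaleR)
qed

lemma static_arg_potential_var:
  assumes "smooth \<Psi>"
  shows "static_arg \<Psi> (A(\<kappa> := (\<lambda>y. A \<kappa> y + e *\<^sub>R H y))) x
    = static_arg \<Psi> A x + e *\<^sub>R potential_var \<kappa> (\<Psi> x ** H x)"
proof -
  have "cov_d \<Psi> (A(\<kappa> := (\<lambda>y. A \<kappa> y + e *\<^sub>R H y))) \<mu> x
      = cov_d \<Psi> A \<mu> x + e *\<^sub>R (if \<mu> = \<kappa> then \<Psi> x ** H x else 0)" for \<mu>
    by (simp add: cov_d_def matrix_mult_algebra)
  moreover have "(if \<mu> = \<kappa> then U else 0)\<^sup>\<dagger> = (if \<mu> = \<kappa> then U\<^sup>\<dagger> else 0)" for \<mu> and U :: "complex^'b^'c"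
    by simp
  ultimately show ?thesis
    by (simp add: static_arg_eq assms potential_var_def dagger_block_col dagger_add dagger_scaleR
        block_col_add_scaleR block_row_add_scaleR)
qed

text \<open>The curvature is quadratic in the potential, but only the component
  \<open>\<kappa>\<close> moves, so its second-order term in \<open>e\<close> could only be [H, H] =
  0. The change is therefore exactly affine.\<close>

lemma gauge_arg_of_var:
  assumes A: "\<And>\<mu>. smooth (A \<mu>)" and H: "smooth H"
  shows "gauge_arg_of (A(\<kappa> := (\<lambda>y. A \<kappa> y + e *\<^sub>R H y))) x
    = gauge_arg_of A x + e *\<^sub>R (\<chi> \<mu> \<nu>. curvature_var \<kappa> A H \<mu> \<nu> x, \<chi> \<mu> \<nu>. (curvature_var \<kappa> A H \<mu> \<nu> x)\<^sup>\<dagger>, 0)"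
proof -
  have "curvature (A(\<kappa> := (\<lambda>y. A \<kappa> y + e *\<^sub>R H y))) \<mu> \<nu> x = curvature A \<mu> \<nu> x + e *\<^sub>R curvature_var \<kappa> A H \<mu> \<nu> x" for \<mu> \<nu>
    by (auto simp: curvature_def curvature_var_def adj_d_def commutator_def
        partial_d_add_scaleR[OF A H] matrix_mult_algebra algebra_simps)
  then show ?thesis
    by (simp add: gauge_arg_of_def vec_eq_iff)
qed

lemma smooth_curvature: "(\<And>\<mu>. smooth (A \<mu>)) \<Longrightarrow> smooth (curvature A \<mu> \<nu>)"
  unfolding curvature_def[abs_def] by (intro smooth_diff smooth_partial_d smooth_commutator)

lemma smooth_gauge_arg_of: "(\<And>\<mu>. smooth (A \<mu>)) \<Longrightarrow> smooth (gauge_arg_of A)"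
  unfolding gauge_arg_of_def[abs_def]
  by (intro smooth_Pair smooth_vec smooth_dagger smooth_curvature smooth_linear[OF bounded_linear_ident])

lemma smooth_G_hat:
  assumes "gauge_proto_lagrangian \<gg> G" "\<And>\<mu>. smooth (A \<mu>)"
  shows "smooth (G_hat G A \<mu> \<nu>)"
proof -
  consider "\<mu> < \<nu>" | "\<mu> = \<nu>" | "\<nu> < \<mu>" by (meson linorder_less_linear)
  then show ?thesis
  proof cases
    case 1
    then show ?thesis
      by (simp add: G_hat_def[abs_def] smooth_G_P[OF assms(1)] smooth_gauge_arg_of assms(2))
  next
    case 2
    then show ?thesis by (simp add: G_hat_def[abs_def] smooth_const)
  next
    case 3
    then have "\<not> \<mu> < \<nu>" "\<mu> \<noteq> \<nu>" by auto
    then show ?thesis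
      using 3 by (simp add: G_hat_def[abs_def] smooth_minus smooth_G_P[OF assms(1)]
          smooth_gauge_arg_of assms(2))
  qed
qed

section \<open>The Euler-Lagrange equations\<close>

text \<open>\<open>f0\<close> carries the terms without derivatives of the variation; it is
  integrable by itself, so the pieces can be separated and recombined under one integral.\<close>

lemma integral_by_parts_sum:
  fixes B :: "'a::euclidean_space \<Rightarrow> 'b::euclidean_space \<Rightarrow> 'd::euclidean_space"
    and f :: "'n::finite \<Rightarrow> real^'n \<Rightarrow> 'a"
  assumes B: "bounded_bilinear B" and f: "\<And>\<mu>. smooth (f \<mu>)" and g: "smooth g"
    and zero: "\<And>x. norm x > R \<Longrightarrow> g x = 0"
    and f0: "continuous_on UNIV f0" "\<And>x. norm x > R \<Longrightarrow> f0 x = 0"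
  shows "(\<integral>x. f0 x + (\<Sum>\<mu>\<in>UNIV. B (f \<mu> x) (partial_d \<mu> g x)) \<partial>lborel)
    = (\<integral>x. f0 x - (\<Sum>\<mu>\<in>UNIV. B (partial_d \<mu> (f \<mu>) x) (g x)) \<partial>lborel)"
proof -
  have i: "integrable lborel f0"
    using f0 by (rule compact_support_integrable)
  note parts = integral_by_parts[OF B f g zero]
  show ?thesis
    using i parts by (simp add: sum_negf)
qed

lemma cscale_mult_left: "cscale z X ** Y = cscale z (X ** Y)"
  by (simp add: vec_eq_iff matrix_matrix_mult_def sum_distrib_left mult.assoc)

lemma cov_d_cscale:
  assumes "smooth H"
  shows "cov_d (\<lambda>y. cscale z (H y)) A \<mu> x = cscale z (cov_d H A \<mu> x)"
  by (simp add: cov_d_def partial_d_bounded_linear[OF assms bounded_linear_cscale] cscale_mult_left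
      linear_add[OF bounded_linear.linear[OF bounded_linear_cscale]])

lemma cov_d_zero_outside:
  assumes "\<And>x. norm x > R \<Longrightarrow> H x = 0" "norm x > R"
  shows "cov_d H A \<mu> x = 0"
proof -
  have "partial_d \<mu> H x = 0"
    by (rule partial_d_zero_outside[of "cball 0 R"]) (use assms in auto)
  then show ?thesis using assms by (simp add: cov_d_def bounded_bilinear.zero_left[OF bounded_bilinear_matrix_mult])
qed

lemma adj_d_zero_outside:
  assumes "\<And>x. norm x > R \<Longrightarrow> H x = 0" "norm x > R"
  shows "adj_d A H \<mu> x = 0"
proof -
  have "partial_d \<mu> H x = 0"
    by (rule partial_d_zero_outside[of "cball 0 R"]) (use assms in auto)
  then show ?thesis
    using assms by (simp add: adj_d_def commutator_def bounded_bilinear.zero_left[OF bounded_bilinear_matrix_mult]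
        bounded_bilinear.zero_right[OF bounded_bilinear_matrix_mult])
qed

lemma block_const_0 [simp]: "block_col (\<lambda>\<mu>. 0) = 0" "block_row (\<lambda>\<mu>. 0) = 0"
  by (simp_all add: block_col_def block_row_def vec_eq_iff)

lemma matter_var_zero_outside:
  assumes "\<And>x. norm x > R \<Longrightarrow> H x = 0" "norm x > R"
  shows "matter_var H A x = 0"
  using cov_d_zero_outside[OF assms] assms by (simp add: matter_var_def zero_prod_def)

lemma free_arg_eq: "free_arg \<Psi> x = static_arg \<Psi> (\<lambda>_ _. 0) x"
  by (simp add: free_arg_def static_arg_def bounded_bilinear.zero_left[OF bounded_bilinear_matrix_mult]
      bounded_bilinear.zero_right[OF bounded_bilinear_matrix_mult])

lemma test_function_cscale: "test_function H \<Longrightarrow> test_function (\<lambda>y. cscale z (H y))"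
proof -
  assume "test_function H"
  then obtain R where R: "smooth H" "R \<ge> 0" "\<And>x. norm x > R \<Longrightarrow> H x = 0"
    by (auto simp: test_function_iff)
  have "cscale z 0 = (0 :: complex^'b^'c)" by (simp add: vec_eq_iff)
  then show ?thesis
    unfolding test_function_iff
    using R smooth_bounded_linear[OF bounded_linear_cscale R(1)] by auto
qed

text \<open>Turns stationarity, which prescribes the derivative 0, into the vanishing of a
  derivative that has been computed.\<close>

lemma has_vector_derivative_eq_iff:
  "(f has_vector_derivative D) (at x) \<Longrightarrow> (f has_vector_derivative D') (at x) \<longleftrightarrow> D = D'"
  using vector_derivative_unique_at by blast

locale dynamic_extension =
  fixes \<GG> \<gg> :: "(complex^'c::finite^'c) set"
    and proj :: "complex^'c^'c \<Rightarrow> complex^'c^'c"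
    and L :: "('n::{finite,linorder}, 'r::finite, 'c) matter_arg \<Rightarrow> complex"
    and G :: "('n, 'c) gauge_arg \<Rightarrow> complex"
    and \<Psi> :: "('n, 'r, 'c) matter_field"
    and A :: "('n, 'c) potential"
  assumes Lie_group: "matrix_Lie_group \<GG>"
    and Lie_alg: "\<gg> = Lie_algebra \<GG>"
    and subspace: "subspace \<gg>"
    and dagger_closed: "dagger ` \<gg> = \<gg>"
    and projection: "real_orthogonal_projection \<gg> proj"
    and matter: "matter_proto_lagrangian L"
    and matter_real: "real_valued_functional L"
    and matter_proj: "\<And>P R x \<kappa>.
      proj (cscale (1 / \<i>)
           (P\<^sup>\<dagger> ** ((L_col L \<kappa> (P, P\<^sup>\<dagger>, R, R\<^sup>\<dagger>, x))\<^sup>\<dagger> - L_row L \<kappa> (P, P\<^sup>\<dagger>, R, R\<^sup>\<dagger>, x)))) = 0"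
    and gauge: "gauge_proto_lagrangian \<gg> G"
    and gauge_star: "\<And>B \<theta> \<rho> x. gauge_field \<gg> B \<Longrightarrow> \<theta> < \<rho> \<Longrightarrow>
      G_Q G \<theta> \<rho> (gauge_arg_of B x) = (G_P G \<theta> \<rho> (gauge_arg_of B x))\<^sup>\<dagger>"
    and \<Psi>: "smooth \<Psi>"
    and A: "gauge_field \<gg> A"
begin

section \<open>Consequences of the hypotheses, and reality of the matter action\<close>

lemma smooth_A: "smooth (A \<mu>)" and A_in: "A \<mu> x \<in> \<gg>"
  using A by (auto simp: gauge_field_def)

lemma smooth_L: "smooth L" and smooth_G: "smooth G"
  using matter gauge by (auto simp: matter_proto_lagrangian_def gauge_proto_lagrangian_def)

lemmas proj_in = projection_in[OF projection subspace]
lemmas proj_inner = projection_inner[OF projection subspace]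
lemmas proj_linear = projection_bounded_linear[OF projection subspace]
lemmas proj_dagger = projection_dagger[OF projection subspace dagger_closed]

lemma dagger_in: "X \<in> \<gg> \<Longrightarrow> X\<^sup>\<dagger> \<in> \<gg>"
  using dagger_closed by blast

lemma commutator_in: "X \<in> \<gg> \<Longrightarrow> Y \<in> \<gg> \<Longrightarrow> commutator X Y \<in> \<gg>"
  using Lie_algebra_commutator[OF Lie_group] subspace Lie_alg by blast

lemma adj_d_in: "smooth H \<Longrightarrow> (\<And>x. H x \<in> \<gg>) \<Longrightarrow> adj_d A H \<mu> x \<in> \<gg>"
  unfolding adj_d_def
  by (intro subspace_diff[OF subspace] partial_d_in_subspace[OF subspace] commutator_in A_in)

text \<open>Pairing the condition on \<open>proj\<close> with \<open>Y\<close> gives Re (z / i) = 0,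
  where z is the trace of \<open>Y\<^sup>\<dagger> ** (P\<^sup>\<dagger> ** (C\<^sup>\<dagger> -
  D))\<close>. Up to sign, Im z is the imaginary part of the left-hand side; its real part is the
  pairing with the sum instead of the difference.\<close>

lemma matter_trace_real:
  assumes Y: "Y \<in> \<gg>"
  defines "a \<equiv> \<lambda>P R x. (P, P\<^sup>\<dagger>, R, R\<^sup>\<dagger>, x)"
  shows "trace (L_col L \<kappa> (a P R x) ** (P ** Y)) + trace (L_row L \<kappa> (a P R x) ** (P ** Y)\<^sup>\<dagger>)
    = of_real (Y \<bullet> (P\<^sup>\<dagger> ** ((L_col L \<kappa> (a P R x))\<^sup>\<dagger> + L_row L \<kappa> (a P R x))))"
proof -
  define C D where "C = L_col L \<kappa> (a P R x)" and "D = L_row L \<kappa> (a P R x)"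
  have tC: "trace (Y\<^sup>\<dagger> ** (P\<^sup>\<dagger> ** C\<^sup>\<dagger>)) = cnj (trace (C ** (P ** Y)))"
    by (subst trace_dagger[symmetric]) (simp add: dagger_mult matrix_mul_assoc)
  have tD: "trace (Y\<^sup>\<dagger> ** (P\<^sup>\<dagger> ** D)) = trace (D ** (P ** Y)\<^sup>\<dagger>)"
    by (subst (2) trace_mul_sym) (simp add: dagger_mult matrix_mul_assoc)
  have "Y \<bullet> proj (cscale (1 / \<i>) (P\<^sup>\<dagger> ** (C\<^sup>\<dagger> - D))) = 0"
    using matter_proj[of P \<kappa> R x] by (simp add: C_def D_def a_def)
  then have "Y \<bullet> cscale (1 / \<i>) (P\<^sup>\<dagger> ** (C\<^sup>\<dagger> - D)) = 0"
    by (simp only: proj_inner[OF Y])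
  then have "Re ((1 / \<i>) * trace (Y\<^sup>\<dagger> ** (P\<^sup>\<dagger> ** (C\<^sup>\<dagger> - D)))) = 0"
    by (simp only: inner_matrix_eq trace_cscale_right)
  then have "Im (trace (C ** (P ** Y)) + trace (D ** (P ** Y)\<^sup>\<dagger>)) = 0"
    by (simp add: matrix_mult_algebra bounded_linear.linear[OF bounded_linear_trace, THEN linear_diff] tC tD)
  moreover have "Y \<bullet> (P\<^sup>\<dagger> ** (C\<^sup>\<dagger> + D)) = Re (trace (C ** (P ** Y)) + trace (D ** (P ** Y)\<^sup>\<dagger>))"
    by (simp add: inner_matrix_eq matrix_mult_algebra
        bounded_linear.linear[OF bounded_linear_trace, THEN linear_add] tC tD)
  ultimately show ?thesis
    by (simp add: C_def[symmetric] D_def[symmetric] complex_eq_iff)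
qed

text \<open>The imaginary part does not change when the potential is scaled down to \<open>0\<close>, since its derivative
  along the scaling is one of the real traces of the previous lemma.\<close>

lemma Im_static_arg:
  assumes \<Phi>: "smooth \<Phi>"
  shows "Im (L (static_arg \<Phi> A x)) = Im (L (free_arg \<Phi> x))"
proof -
  define a where "a = (\<lambda>t. static_arg \<Phi> (\<lambda>\<mu> y. t *\<^sub>R A \<mu> y) x)"
  define v :: "('n, 'r, 'c) matter_arg" where
    "v = (0, 0, block_col (\<lambda>\<mu>. \<Phi> x ** A \<mu> x), block_row (\<lambda>\<mu>. (\<Phi> x ** A \<mu> x)\<^sup>\<dagger>), 0)"
  have cov: "cov_d \<Phi> (\<lambda>\<mu> y. t *\<^sub>R A \<mu> y) \<mu> x = partial_d \<mu> \<Phi> x + t *\<^sub>R (\<Phi> x ** A \<mu> x)" for t \<mu>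
    by (simp add: cov_d_def matrix_mult_algebra)
  \<comment> \<open>Scaling the potential moves the argument along a straight line whose direction
    \<open>v\<close> is made of the blocks \<open>\<Phi> x ** A \<mu> x\<close>, with
    \<open>A \<mu> x\<close> in \<open>\<gg>\<close>.\<close>
  have a: "a t = a 0 + t *\<^sub>R v" for t
    by (simp add: a_def v_def static_arg_eq[OF \<Phi>] cov dagger_block_col dagger_add dagger_scaleR
        block_col_add_scaleR block_row_add_scaleR)
  have Im0: "Im (frechet_derivative L (at (a t)) v) = 0" for t
  proof -
    have "frechet_derivative L (at (a t)) v = (\<Sum>\<mu>\<in>UNIV. trace (L_col L \<mu> (a t) ** (\<Phi> x ** A \<mu> x))
        + trace (L_row L \<mu> (a t) ** (\<Phi> x ** A \<mu> x)\<^sup>\<dagger>))"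
      unfolding v_def matter_frechet_derivative[OF matter]
      by (simp add: sum.distrib)
    also have "\<dots> = of_real (\<Sum>\<mu>\<in>UNIV. A \<mu> x \<bullet> ((\<Phi> x)\<^sup>\<dagger> ** ((L_col L \<mu> (a t))\<^sup>\<dagger> + L_row L \<mu> (a t))))"
      unfolding a_def static_arg_eq[OF \<Phi>] matter_trace_real[OF A_in] by simp
    finally show ?thesis by (simp only: Im_complex_of_real)
  qed
  have "((\<lambda>t. Im (L (a t))) has_derivative (\<lambda>s. Im (frechet_derivative L (at (a t)) (s *\<^sub>R v)))) (at t)" for t
  proof -
    have "((\<lambda>t. a 0 + t *\<^sub>R v) has_derivative (\<lambda>s. s *\<^sub>R v)) (at t)"
      by (auto intro!: derivative_eq_intros)
    moreover have "(\<lambda>t. a 0 + t *\<^sub>R v) = a" by (rule ext) (rule a[symmetric])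
    ultimately have "(a has_derivative (\<lambda>s. s *\<^sub>R v)) (at t)" by simp
    from has_derivative_compose[OF this smooth_has_derivative[OF smooth_L]]
    show ?thesis by (rule bounded_linear.has_derivative[OF bounded_linear_Im])
  qed
  moreover have "frechet_derivative L (at (a t)) (s *\<^sub>R v) = s *\<^sub>R frechet_derivative L (at (a t)) v" for s t
    using linear_cmul linear_frechet_derivative smooth_differentiable[OF smooth_L] by blast
  ultimately have "((\<lambda>t. Im (L (a t))) has_real_derivative 0) (at t)" for t
    using Im0 by (simp add: has_field_derivative_def lambda_zero[symmetric])
  then have "Im (L (a 1)) = Im (L (a 0))" by (intro DERIV_isconst_all) auto
  then show ?thesis by (simp add: a_def free_arg_eq)
qed

lemma static_variation_integrable:
  assumes H: "test_function H"
  shows "integrable lborel (\<lambda>x. L (static_arg (\<lambda>y. \<Psi> y + \<epsilon> *\<^sub>R H y) A x) - L (static_arg \<Psi> A x))"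
    and "((\<lambda>\<epsilon>. \<integral>x. L (static_arg (\<lambda>y. \<Psi> y + \<epsilon> *\<^sub>R H y) A x) - L (static_arg \<Psi> A x) \<partial>lborel)
      has_vector_derivative
      (\<integral>x. frechet_derivative L (at (static_arg \<Psi> A x)) (matter_var H A x) \<partial>lborel)) (at 0)"
    and "integrable lborel (\<lambda>x. frechet_derivative L (at (static_arg \<Psi> A x)) (matter_var H A x))"
proof -
  obtain R where R: "smooth H" "\<And>x. norm x > R \<Longrightarrow> H x = 0"
    using H by (auto simp: test_function_iff)
  note fv = first_variation[OF smooth_L smooth_continuous[OF smooth_static_arg[OF \<Psi> smooth_A]]
      smooth_continuous[OF smooth_matter_var[OF R(1) smooth_A]] matter_var_zero_outside[OF R(2)]]
  show "integrable lborel (\<lambda>x. L (static_arg (\<lambda>y. \<Psi> y + \<epsilon> *\<^sub>R H y) A x) - L (static_arg \<Psi> A x))"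
    unfolding static_arg_matter_var[OF \<Psi> R(1)] by (rule fv(2))
  show "((\<lambda>\<epsilon>. \<integral>x. L (static_arg (\<lambda>y. \<Psi> y + \<epsilon> *\<^sub>R H y) A x) - L (static_arg \<Psi> A x) \<partial>lborel)
      has_vector_derivative
      (\<integral>x. frechet_derivative L (at (static_arg \<Psi> A x)) (matter_var H A x) \<partial>lborel)) (at 0)"
    unfolding static_arg_matter_var[OF \<Psi> R(1)] by (rule fv(1))
  show "integrable lborel (\<lambda>x. frechet_derivative L (at (static_arg \<Psi> A x)) (matter_var H A x))"
    by (rule fv(3))
qed

text \<open>Only test functions are known to have a real action, so \<open>\<Psi>\<close> is cut off outside the support
  of the variation.\<close>

lemma Im_static_variation:
  assumes H: "test_function H"
  shows "Im (\<integral>x. L (static_arg (\<lambda>y. \<Psi> y + \<epsilon> *\<^sub>R H y) A x) - L (static_arg \<Psi> A x) \<partial>lborel) = 0"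
proof -
  obtain R where R: "smooth H" "R \<ge> 0" "\<And>x. norm x > R \<Longrightarrow> H x = 0"
    using H by (auto simp: test_function_iff)
  have "R + 1 \<ge> 0" using R(2) by simp
  \<comment> \<open>The cutoff is 1 on a ball larger than the support of \<open>H\<close>, so that
    \<open>\<Phi>\<close> and \<open>\<Psi>\<close> agree on an open neighbourhood of the support
    and have the same derivatives there.\<close>
  then obtain \<eta> :: "(real, 'n) vec \<Rightarrow> real" where \<eta>: "smooth \<eta>" "\<And>x. norm x \<le> R + 1 \<Longrightarrow> \<eta> x = 1"
    "\<And>x. norm x > R + 1 + 1 \<Longrightarrow> \<eta> x = 0"
    using smooth_cutoff_exists by metis
  define \<Phi> where "\<Phi> = (\<lambda>x. \<eta> x *\<^sub>R \<Psi> x)"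
  have s\<Phi>: "smooth \<Phi>"
    unfolding \<Phi>_def by (intro smooth_bilinear[OF bounded_bilinear_scaleR] \<eta>(1) \<Psi>)
  have s\<Phi>H: "smooth (\<lambda>y. \<Phi> y + \<epsilon> *\<^sub>R H y)" and s\<Psi>H: "smooth (\<lambda>y. \<Psi> y + \<epsilon> *\<^sub>R H y)"
    by (intro smooth_add smooth_scaleR s\<Phi> \<Psi> R(1))+
  have t\<Phi>: "test_function \<Phi>"
    unfolding test_function_iff
    using s\<Phi> R(2) \<eta>(3) by (auto simp: \<Phi>_def intro!: exI[of _ "R + 2"])
  have t\<Phi>H: "test_function (\<lambda>y. \<Phi> y + \<epsilon> *\<^sub>R H y)"
    unfolding test_function_iff
    using s\<Phi>H R \<eta>(3) by (auto simp: \<Phi>_def intro!: exI[of _ "R + 2"])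
  obtain V where V: "\<And>\<psi>. test_function \<psi> \<Longrightarrow> \<psi> \<in> V"
    "\<And>\<psi>. \<psi> \<in> V \<Longrightarrow> integrable lborel (\<lambda>x. L (free_arg \<psi> x))"
    "\<And>\<psi>. \<psi> \<in> V \<Longrightarrow> (\<integral>x. L (free_arg \<psi> x) \<partial>lborel) \<in> \<real>"
    using matter_real unfolding real_valued_functional_def by metis
  \<comment> \<open>Beyond radius \<open>R\<close> both differences are 0; elsewhere the two fields
    coincide near the point.\<close>
  have eq: "L (free_arg (\<lambda>y. \<Psi> y + \<epsilon> *\<^sub>R H y) x) - L (free_arg \<Psi> x)
      = L (free_arg (\<lambda>y. \<Phi> y + \<epsilon> *\<^sub>R H y) x) - L (free_arg \<Phi> x)" for x
  proof (cases "norm x > R")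
    case True
    then have "matter_var H (\<lambda>_ _. 0) x = 0"
      by (intro matter_var_zero_outside[of R] R(3))
    then show ?thesis
      by (simp add: free_arg_eq static_arg_matter_var[OF \<Psi> R(1)] static_arg_matter_var[OF s\<Phi> R(1)])
  next
    case False
    have \<Phi>\<Psi>: "\<Phi> y = \<Psi> y" if "y \<in> ball 0 (R + 1)" for y
      using that \<eta>(2) by (simp add: \<Phi>_def)
    have x: "x \<in> ball 0 (R + 1)" using False by simp
    have "cov_d \<Phi> (\<lambda>_ _. 0) \<mu> x = cov_d \<Psi> (\<lambda>_ _. 0) \<mu> x" for \<mu>
      using partial_d_cong_open[OF open_ball x \<Phi>\<Psi> \<Psi>] \<Phi>\<Psi>[OF x] by (simp add: cov_d_def)
    then have "static_arg \<Phi> (\<lambda>_ _. 0) x = static_arg \<Psi> (\<lambda>_ _. 0) x"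
      using \<Phi>\<Psi>[OF x] by (simp add: static_arg_eq[OF s\<Phi>] static_arg_eq[OF \<Psi>])
    then show ?thesis
      by (simp add: free_arg_eq static_arg_matter_var[OF \<Psi> R(1)] static_arg_matter_var[OF s\<Phi> R(1)])
  qed
  let ?d = "\<lambda>x. L (static_arg (\<lambda>y. \<Psi> y + \<epsilon> *\<^sub>R H y) A x) - L (static_arg \<Psi> A x)"
  have i: "integrable lborel (\<lambda>x. L (free_arg (\<lambda>y. \<Phi> y + \<epsilon> *\<^sub>R H y) x))"
    "integrable lborel (\<lambda>x. L (free_arg \<Phi> x))"
    using V t\<Phi> t\<Phi>H by blast+
  have "Im (\<integral>x. ?d x \<partial>lborel) = (\<integral>x. Im (?d x) \<partial>lborel)"
    by (rule integral_Im[symmetric]) (rule static_variation_integrable(1)[OF H])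
  \<comment> \<open>Removing the potential preserves both imaginary parts; after that
    \<open>\<Psi>\<close> can be traded for the test function \<open>\<Phi>\<close>.\<close>
  also have "\<dots> = (\<integral>x. Im (L (free_arg (\<lambda>y. \<Phi> y + \<epsilon> *\<^sub>R H y) x) - L (free_arg \<Phi> x)) \<partial>lborel)"
    unfolding eq[symmetric] by (simp add: Im_static_arg \<Psi> s\<Psi>H)
  also have "\<dots> = Im (\<integral>x. L (free_arg (\<lambda>y. \<Phi> y + \<epsilon> *\<^sub>R H y) x) - L (free_arg \<Phi> x) \<partial>lborel)"
    using i by (intro integral_Im Bochner_Integration.integrable_diff)
  also have "\<dots> = Im (\<integral>x. L (free_arg (\<lambda>y. \<Phi> y + \<epsilon> *\<^sub>R H y) x) \<partial>lborel) - Im (\<integral>x. L (free_arg \<Phi> x) \<partial>lborel)"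
    using i by simp
  also have "\<dots> = 0"
    using V t\<Phi> t\<Phi>H by (simp add: complex_is_Real_iff)
  finally show ?thesis .
qed

section \<open>The Euler-Lagrange equation of the matter field\<close>

definition matter_variation :: "('n, 'r, 'c) matter_field \<Rightarrow> complex" where
  "matter_variation H = (\<integral>x. frechet_derivative L (at (static_arg \<Psi> A x)) (matter_var H A x) \<partial>lborel)"

text \<open>The gauge density does not depend on \<open>\<Psi>\<close> and cancels in the
  difference.\<close>

lemma stationary_matter_iff:
  "stationary_matter L G \<Psi> A \<longleftrightarrow> (\<forall>H. test_function H \<longrightarrow> matter_variation H = 0)"
proof -
  have "((\<lambda>\<epsilon>::real. \<integral>x. dyn_density L G (\<lambda>y. \<Psi> y + \<epsilon> *\<^sub>R H y) A x - dyn_density L G \<Psi> A x \<partial>lborel)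
      has_vector_derivative 0) (at 0) \<longleftrightarrow> matter_variation H = 0" if H: "test_function H" for H
    using has_vector_derivative_eq_iff[OF static_variation_integrable(2)[OF H]]
    by (simp add: dyn_density_def matter_variation_def)
  then show ?thesis unfolding stationary_matter_def by blast
qed

lemma Im_matter_variation:
  assumes H: "test_function H"
  shows "Im (matter_variation H) = 0"
proof -
  have "((\<lambda>\<epsilon>::real. 0) has_vector_derivative Im (matter_variation H)) (at 0)"
    using bounded_linear.has_vector_derivative[OF bounded_linear_Im static_variation_integrable(2)[OF H]]
    by (simp add: Im_static_variation[OF H] matter_variation_def)
  then show ?thesis
    using vector_derivative_unique_at has_vector_derivative_const by blast
qed

definition matter_EL :: "(real, 'n) vec \<Rightarrow> complex^'r^'c" where
  "matter_EL x = L_o L (static_arg \<Psi> A x)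
     - (\<Sum>\<mu>\<in>UNIV. partial_d \<mu> (\<lambda>y. L_col L \<mu> (static_arg \<Psi> A y)) x
          - A \<mu> x ** L_col L \<mu> (static_arg \<Psi> A x))"

lemmas smooth_static = smooth_static_arg[OF \<Psi> smooth_A]

text \<open>This combination of two variations isolates the part that is complex linear in the variation.\<close>

lemma matter_variation_linear_part:
  assumes H: "test_function H"
  shows "matter_variation H - \<i> * matter_variation (\<lambda>y. cscale \<i> (H y))
    = 2 * (\<integral>x. trace (matter_EL x ** H x) \<partial>lborel)"
proof -
  obtain R where R: "smooth H" "\<And>x. norm x > R \<Longrightarrow> H x = 0"
    using H by (auto simp: test_function_iff)
  let ?s = "static_arg \<Psi> A" and ?iH = "\<lambda>y. cscale \<i> (H y)"
  let ?D = "\<lambda>H x. frechet_derivative L (at (?s x)) (matter_var H A x)"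
  define f where "f = (\<lambda>\<mu> x. L_col L \<mu> (?s x))"
  define f0 where "f0 = (\<lambda>x. trace ((L_o L (?s x) + (\<Sum>\<mu>\<in>UNIV. A \<mu> x ** f \<mu> x)) ** H x))"
  have sf: "smooth (f \<mu>)" for \<mu>
    unfolding f_def by (intro smooth_L_col matter smooth_static)
  note trace_add = linear_add[OF bounded_linear.linear[OF bounded_linear_trace]]
  note mult_sum_left = linear_sum[OF bounded_linear.linear[OF bounded_bilinear.bounded_linear_left[OF
          bounded_bilinear_trace_mult]]]
  note tr = bounded_bilinear.add_left[OF bounded_bilinear_trace_mult]
    bounded_bilinear.diff_left[OF bounded_bilinear_trace_mult] mult_sum_left
    bounded_bilinear.add_right[OF bounded_bilinear_trace_mult]
  \<comment> \<open>Cyclicity moves the potential from the right of \<open>H\<close> to the left of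
    the matter derivative, where the Euler-Lagrange equation has it.\<close>
  have cyc: "trace (X ** (Y ** Z)) = trace ((Z ** X) ** Y)"
    for X :: "complex^'r^'c" and Y :: "complex^'c^'r" and Z :: "complex^'c^'c"
    by (subst trace_mul_sym[of "Z ** X"])
      (metis matrix_mul_assoc trace_mul_sym)
  \<comment> \<open>Passing from \<open>H\<close> to i \<open>H\<close> multiplies the linear part
    by i and the antilinear part by -i. After the further factor -i the linear parts add up and the
    antilinear parts cancel.\<close>
  have pt: "?D H x - \<i> * ?D ?iH x = 2 * (f0 x + (\<Sum>\<mu>\<in>UNIV. trace (f \<mu> x ** partial_d \<mu> H x)))" for x
  proof -
    have "?D H x - \<i> * ?D ?iH x
        = 2 * (trace (L_o L (?s x) ** H x) + (\<Sum>\<mu>\<in>UNIV. trace (f \<mu> x ** cov_d H A \<mu> x)))"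
      unfolding matter_var_def matter_frechet_derivative[OF matter]
      by (simp add: cov_d_cscale[OF R(1)] dagger_cscale trace_cscale_right f_def
          sum_distrib_left sum_negf sum.distrib algebra_simps)
    moreover have "trace (f \<mu> x ** cov_d H A \<mu> x) = trace (f \<mu> x ** partial_d \<mu> H x) + trace (A \<mu> x ** f \<mu> x ** H x)" for \<mu>
      by (simp add: cov_d_def tr cyc)
    ultimately show ?thesis
      by (simp add: f0_def tr sum.distrib)
  qed
  have f0: "continuous_on UNIV f0"
    unfolding f0_def f_def
    by (intro smooth_continuous smooth_bilinear[OF bounded_bilinear_trace_mult] smooth_add smooth_sum
        smooth_matrix_mult smooth_L_o smooth_L_col matter smooth_static smooth_A R(1))
  have z: "f0 x = 0" if "norm x > R" for x
    by (simp only: f0_def R(2)[OF that] bounded_bilinear.zero_right[OF bounded_bilinear_trace_mult])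
  have "matter_variation H - \<i> * matter_variation ?iH = (\<integral>x. ?D H x - \<i> * ?D ?iH x \<partial>lborel)"
    unfolding matter_variation_def
    using static_variation_integrable(3)[OF H] static_variation_integrable(3)[OF test_function_cscale[OF H]]
    by simp
  also have "\<dots> = 2 * (\<integral>x. f0 x + (\<Sum>\<mu>\<in>UNIV. trace (f \<mu> x ** partial_d \<mu> H x)) \<partial>lborel)"
    unfolding pt by (rule integral_mult_right_zero)
  also have "\<dots> = 2 * (\<integral>x. f0 x - (\<Sum>\<mu>\<in>UNIV. trace (partial_d \<mu> (f \<mu>) x ** H x)) \<partial>lborel)"
    by (simp only: integral_by_parts_sum[OF bounded_bilinear_trace_mult sf R f0 z])
  also have "(\<lambda>x. f0 x - (\<Sum>\<mu>\<in>UNIV. trace (partial_d \<mu> (f \<mu>) x ** H x))) = (\<lambda>x. trace (matter_EL x ** H x))"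
    by (simp add: fun_eq_iff f0_def matter_EL_def tr sum_subtractf f_def)
  finally show ?thesis .
qed

lemma stationary_matter_iff_EL: "stationary_matter L G \<Psi> A \<longleftrightarrow> (\<forall>x. matter_EL x = 0)"
proof
  assume "stationary_matter L G \<Psi> A"
  then have 0: "test_function H \<Longrightarrow> matter_variation H = 0" for H
    using stationary_matter_iff by blast
  \<comment> \<open>The dagger turns the real part of the trace pairing into the inner product of
    the fundamental lemma.\<close>
  have c: "continuous_on UNIV (\<lambda>x. (matter_EL x)\<^sup>\<dagger>)"
    unfolding matter_EL_def
    by (intro smooth_continuous smooth_dagger smooth_diff smooth_sum smooth_partial_d
        smooth_matrix_mult smooth_L_o smooth_L_col matter smooth_static smooth_A)
  have "(\<integral>x. (matter_EL x)\<^sup>\<dagger> \<bullet> H x \<partial>lborel) = 0" if H: "test_function H" for H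
  proof -
    obtain R where R: "smooth H" "\<And>x. norm x > R \<Longrightarrow> H x = 0"
      using H by (auto simp: test_function_iff)
    have "continuous_on UNIV (\<lambda>x. trace (((matter_EL x)\<^sup>\<dagger>)\<^sup>\<dagger> ** H x))"
      by (intro bounded_bilinear.continuous_on[OF bounded_bilinear_trace_mult]
          bounded_linear.continuous_on[OF bounded_linear_dagger] c smooth_continuous R(1))
    then have i: "integrable lborel (\<lambda>x. trace (matter_EL x ** H x))"
      by (intro compact_support_integrable[of _ R]) (simp_all add: R(2))
    have "(\<integral>x. trace (matter_EL x ** H x) \<partial>lborel) = 0"
      using matter_variation_linear_part[OF H] 0[OF H] 0[OF test_function_cscale[OF H]] by simp
    then show ?thesis
      using i by (simp add: inner_matrix_eq)
  qed
  then have "(matter_EL x)\<^sup>\<dagger> = 0" for x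
    by (intro fundamental_lemma[OF c subspace_UNIV]) auto
  then show "\<forall>x. matter_EL x = 0"
    by (metis dagger_0 dagger_dagger)
next
  assume EL: "\<forall>x. matter_EL x = 0"
  have "matter_variation H = 0" if H: "test_function H" for H
  proof -
    have "matter_variation H = \<i> * matter_variation (\<lambda>y. cscale \<i> (H y))"
      using matter_variation_linear_part[OF H] EL
      by (simp add: bounded_bilinear.zero_left[OF bounded_bilinear_matrix_mult])
    \<comment> \<open>Both variations are real, and a real number that is i times a real number is
      0.\<close>
    then show ?thesis
      using Im_matter_variation[OF H] Im_matter_variation[OF test_function_cscale[OF H, of \<i>]]
      by (simp add: complex_eq_iff)
  qed
  then show "stationary_matter L G \<Psi> A" using stationary_matter_iff by blast
qed

end

text \<open>Varying the component \<open>\<kappa>\<close> touches the curvature entries that have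
  \<open>\<kappa>\<close> in either place, with sign + if it is second and - if it is first. This is
  the origin of the antisymmetric extension \<open>G_hat\<close>.\<close>

lemma sum_less_if_split:
  fixes a :: "'n::{finite,linorder} \<Rightarrow> 'n \<Rightarrow> 'n \<Rightarrow> real"
  shows "(\<Sum>\<mu>\<in>UNIV. \<Sum>\<nu>\<in>UNIV. if \<mu> < \<nu>
        then (if \<nu> = \<kappa> then a \<mu> \<nu> \<mu> else 0) - (if \<mu> = \<kappa> then a \<mu> \<nu> \<nu> else 0) else 0)
    = (\<Sum>\<mu>\<in>UNIV. if \<mu> < \<kappa> then a \<mu> \<kappa> \<mu> else if \<mu> = \<kappa> then 0 else - a \<kappa> \<mu> \<mu>)"
proof -
  have "(\<Sum>\<mu>\<in>UNIV. \<Sum>\<nu>\<in>UNIV. if \<mu> < \<nu>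
        then (if \<nu> = \<kappa> then a \<mu> \<nu> \<mu> else 0) - (if \<mu> = \<kappa> then a \<mu> \<nu> \<nu> else 0) else 0)
      = (\<Sum>\<mu>\<in>UNIV. \<Sum>\<nu>\<in>UNIV. if \<nu> = \<kappa> then (if \<mu> < \<kappa> then a \<mu> \<kappa> \<mu> else 0) else 0)
        - (\<Sum>\<mu>\<in>UNIV. \<Sum>\<nu>\<in>UNIV. if \<mu> = \<kappa> then (if \<kappa> < \<nu> then a \<kappa> \<nu> \<nu> else 0) else 0)"
    unfolding sum_subtractf[symmetric] by (intro sum.cong) auto
  also have "(\<Sum>\<mu>\<in>UNIV. \<Sum>\<nu>\<in>UNIV. if \<mu> = \<kappa> then (if \<kappa> < \<nu> then a \<kappa> \<nu> \<nu> else 0) else 0)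
      = (\<Sum>\<nu>\<in>UNIV. if \<kappa> < \<nu> then a \<kappa> \<nu> \<nu> else 0)"
    by (subst sum.swap) simp
  also have "(\<Sum>\<mu>\<in>UNIV. \<Sum>\<nu>\<in>UNIV. if \<nu> = \<kappa> then (if \<mu> < \<kappa> then a \<mu> \<kappa> \<mu> else 0) else 0)
      = (\<Sum>\<mu>\<in>UNIV. if \<mu> < \<kappa> then a \<mu> \<kappa> \<mu> else 0)"
    by simp
  finally show ?thesis
    unfolding sum_subtractf[symmetric] by (auto intro!: sum.cong)
qed

section \<open>The Euler-Lagrange equations of the potential\<close>

context dynamic_extension begin

definition gauge_EL :: "'n \<Rightarrow> (real, 'n) vec \<Rightarrow> complex^'c^'c" where
  "gauge_EL \<kappa> x = proj ((\<Psi> x)\<^sup>\<dagger> ** ((L_col L \<kappa> (static_arg \<Psi> A x))\<^sup>\<dagger> + L_row L \<kappa> (static_arg \<Psi> A x)))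
     - 2 *\<^sub>R (\<Sum>\<mu>\<in>UNIV. (partial_d \<mu> (\<lambda>y. proj (G_hat G A \<mu> \<kappa> y)) x
          - commutator (A \<mu> x) (proj (G_hat G A \<mu> \<kappa> x)))\<^sup>\<dagger>)"

lemma smooth_proj: "smooth f \<Longrightarrow> smooth (\<lambda>x. proj (f x))"
  by (rule smooth_bounded_linear[OF proj_linear])

lemmas smooth_proj_G_hat = smooth_proj[OF smooth_G_hat[OF gauge smooth_A]]

lemma smooth_matter_current:
  "smooth (\<lambda>x. (\<Psi> x)\<^sup>\<dagger> ** ((L_col L \<kappa> (static_arg \<Psi> A x))\<^sup>\<dagger> + L_row L \<kappa> (static_arg \<Psi> A x)))"
  by (intro smooth_matrix_mult smooth_dagger \<Psi> smooth_add smooth_L_col smooth_L_row matter smooth_static)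

lemma smooth_gauge_EL: "smooth (gauge_EL \<kappa>)"
  unfolding gauge_EL_def[abs_def]
  by (intro smooth_diff smooth_proj smooth_matter_current smooth_scaleR smooth_sum smooth_dagger
      smooth_partial_d smooth_commutator smooth_A smooth_proj_G_hat)

text \<open>Derivatives, brackets, the dagger and real linear combinations all preserve
  \<open>\<gg>\<close>, and the projected terms start there. The fundamental lemma for
  \<open>\<gg>\<close>-valued test functions depends on this.\<close>

lemma gauge_EL_in: "gauge_EL \<kappa> x \<in> \<gg>"
  unfolding gauge_EL_def
  by (intro subspace_diff[OF subspace] subspace_scale[OF subspace] subspace_sum[OF subspace] dagger_in
      partial_d_in_subspace[OF subspace] commutator_in A_in proj_in smooth_proj_G_hat)

lemma matter_derivative_potential_var:
  assumes "X \<in> \<gg>"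
  shows "frechet_derivative L (at (static_arg \<Psi> A x)) (potential_var \<kappa> (\<Psi> x ** X))
    = of_real (X \<bullet> ((\<Psi> x)\<^sup>\<dagger> ** ((L_col L \<kappa> (static_arg \<Psi> A x))\<^sup>\<dagger> + L_row L \<kappa> (static_arg \<Psi> A x))))"
proof -
  have "frechet_derivative L (at (static_arg \<Psi> A x)) (potential_var \<kappa> (\<Psi> x ** X))
      = trace (L_col L \<kappa> (static_arg \<Psi> A x) ** (\<Psi> x ** X))
        + trace (L_row L \<kappa> (static_arg \<Psi> A x) ** (\<Psi> x ** X)\<^sup>\<dagger>)"
    unfolding potential_var_def matter_frechet_derivative[OF matter]
    by (simp add: if_distrib[of "\<lambda>Z. trace (_ ** Z)"] cong: if_cong)
  also have "\<dots> = of_real (X \<bullet> ((\<Psi> x)\<^sup>\<dagger> ** ((L_col L \<kappa> (static_arg \<Psi> A x))\<^sup>\<dagger> + L_row L \<kappa> (static_arg \<Psi> A x))))"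
    unfolding static_arg_eq[OF \<Psi>] by (rule matter_trace_real[OF assms])
  finally show ?thesis .
qed

text \<open>By \<open>gauge_star\<close> the trace against \<open>G_Q\<close> is the conjugate of
  the trace against \<open>G_P\<close>, so each pair of indices contributes twice a real part. This
  is the factor 2 of the equations.\<close>

lemma gauge_derivative_curvature_var:
  assumes H: "smooth H" "\<And>x. H x \<in> \<gg>"
  shows "frechet_derivative G (at (gauge_arg_of A x))
      (\<chi> \<mu> \<nu>. curvature_var \<kappa> A H \<mu> \<nu> x, \<chi> \<mu> \<nu>. (curvature_var \<kappa> A H \<mu> \<nu> x)\<^sup>\<dagger>, 0)
    = of_real (2 * (\<Sum>\<mu>\<in>UNIV. (proj (G_hat G A \<mu> \<kappa> x))\<^sup>\<dagger> \<bullet> adj_d A H \<mu> x))"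
proof -
  define t where "t = gauge_arg_of A x"
  define V where "V = (\<lambda>\<mu> \<nu>. curvature_var \<kappa> A H \<mu> \<nu> x)"
  define D where "D = (\<lambda>\<mu>. adj_d A H \<mu> x)"
  have Re_trace: "Re (trace (X ** Y)) = X\<^sup>\<dagger> \<bullet> Y" for X Y :: "complex^'c^'c"
    by (simp add: inner_matrix_eq)
  have real: "trace (G_P G \<mu> \<nu> t ** V \<mu> \<nu>) + trace (G_Q G \<mu> \<nu> t ** (V \<mu> \<nu>)\<^sup>\<dagger>)
      = of_real (2 * ((G_P G \<mu> \<nu> t)\<^sup>\<dagger> \<bullet> V \<mu> \<nu>))" if "\<mu> < \<nu>" for \<mu> \<nu>
  proof -
    have "trace (G_Q G \<mu> \<nu> t ** (V \<mu> \<nu>)\<^sup>\<dagger>) = trace ((V \<mu> \<nu> ** G_P G \<mu> \<nu> t)\<^sup>\<dagger>)"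
      using gauge_star[OF A that, of x] by (simp add: t_def dagger_mult)
    also have "\<dots> = cnj (trace (G_P G \<mu> \<nu> t ** V \<mu> \<nu>))"
      by (simp only: trace_dagger trace_mul_sym[of "V \<mu> \<nu>"])
    finally show ?thesis
      by (simp add: Re_trace[symmetric] complex_add_cnj)
  qed
  have "frechet_derivative G (at t) (\<chi> \<mu> \<nu>. V \<mu> \<nu>, \<chi> \<mu> \<nu>. (V \<mu> \<nu>)\<^sup>\<dagger>, 0)
      = (\<Sum>\<mu>\<in>UNIV. \<Sum>\<nu>\<in>UNIV. if \<mu> < \<nu> then of_real (2 * ((G_P G \<mu> \<nu> t)\<^sup>\<dagger> \<bullet> V \<mu> \<nu>)) else 0)"
    unfolding gauge_frechet_derivative[OF gauge]
    by (simp add: real cong: if_cong)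
  also have "\<dots> = of_real (2 * (\<Sum>\<mu>\<in>UNIV. \<Sum>\<nu>\<in>UNIV. if \<mu> < \<nu> then (G_P G \<mu> \<nu> t)\<^sup>\<dagger> \<bullet> V \<mu> \<nu> else 0))"
    by (simp add: sum_distrib_left if_distrib[of of_real] if_distrib[of "\<lambda>z. _ * z"] cong: if_cong)
  also have "(\<Sum>\<mu>\<in>UNIV. \<Sum>\<nu>\<in>UNIV. if \<mu> < \<nu> then (G_P G \<mu> \<nu> t)\<^sup>\<dagger> \<bullet> V \<mu> \<nu> else 0)
      = (\<Sum>\<mu>\<in>UNIV. \<Sum>\<nu>\<in>UNIV. if \<mu> < \<nu>
        then (if \<nu> = \<kappa> then (G_P G \<mu> \<nu> t)\<^sup>\<dagger> \<bullet> D \<mu> else 0)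
           - (if \<mu> = \<kappa> then (G_P G \<mu> \<nu> t)\<^sup>\<dagger> \<bullet> D \<nu> else 0) else 0)"
    by (intro sum.cong refl) (simp add: V_def D_def curvature_var_def inner_diff_right)
  also have "\<dots> = (\<Sum>\<mu>\<in>UNIV. if \<mu> < \<kappa> then (G_P G \<mu> \<kappa> t)\<^sup>\<dagger> \<bullet> D \<mu>
      else if \<mu> = \<kappa> then 0 else - ((G_P G \<kappa> \<mu> t)\<^sup>\<dagger> \<bullet> D \<mu>))"
    by (rule sum_less_if_split[where a = "\<lambda>\<mu> \<nu> \<rho>. (G_P G \<mu> \<nu> t)\<^sup>\<dagger> \<bullet> D \<rho>"])
  also have "\<dots> = (\<Sum>\<mu>\<in>UNIV. (G_hat G A \<mu> \<kappa> x)\<^sup>\<dagger> \<bullet> D \<mu>)"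
  proof (intro sum.cong refl)
    have "(- X)\<^sup>\<dagger> = - X\<^sup>\<dagger>" for X :: "complex^'c^'c" by (simp add: vec_eq_iff)
    then show "(if \<mu> < \<kappa> then (G_P G \<mu> \<kappa> t)\<^sup>\<dagger> \<bullet> D \<mu> else if \<mu> = \<kappa> then 0
        else - ((G_P G \<kappa> \<mu> t)\<^sup>\<dagger> \<bullet> D \<mu>)) = (G_hat G A \<mu> \<kappa> x)\<^sup>\<dagger> \<bullet> D \<mu>" for \<mu>
      by (simp add: G_hat_def t_def)
  qed
  \<comment> \<open>The covariant derivative of \<open>H\<close> lies in \<open>\<gg>\<close>, so it
    sees only the projection, which commutes with the dagger.\<close>
  also have "\<dots> = (\<Sum>\<mu>\<in>UNIV. (proj (G_hat G A \<mu> \<kappa> x))\<^sup>\<dagger> \<bullet> D \<mu>)"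
    using proj_inner[OF adj_d_in[OF H]] by (simp add: D_def proj_dagger[symmetric] inner_commute[of _ "adj_d A H _ x"])
  finally show ?thesis by (simp only: t_def V_def D_def)
qed

text \<open>The matter density contributes the pairing of \<open>H\<close> with the current, the
  gauge density that of the covariant derivative of \<open>H\<close> with the projected
  \<open>G_hat\<close>; integration by parts frees \<open>H\<close> in the latter.\<close>

lemma gauge_variation:
  assumes H: "test_function H" and Hg: "\<And>x. H x \<in> \<gg>"
  shows "((\<lambda>\<epsilon>::real. \<integral>x. dyn_density L G \<Psi> (A(\<kappa> := (\<lambda>y. A \<kappa> y + \<epsilon> *\<^sub>R H y))) x
        - dyn_density L G \<Psi> A x \<partial>lborel)
      has_vector_derivative of_real (\<integral>x. gauge_EL \<kappa> x \<bullet> H x \<partial>lborel)) (at 0)"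
proof -
  obtain R where R: "smooth H" "\<And>x. norm x > R \<Longrightarrow> H x = 0"
    using H by (auto simp: test_function_iff)
  let ?s = "static_arg \<Psi> A" and ?t = "gauge_arg_of A"
  define v where "v = (\<lambda>x. potential_var \<kappa> (\<Psi> x ** H x) :: ('n, 'r, 'c) matter_arg)"
  define w :: "_ \<Rightarrow> ('n, 'c) gauge_arg" where
    "w = (\<lambda>x. (\<chi> \<mu> \<nu>. curvature_var \<kappa> A H \<mu> \<nu> x, \<chi> \<mu> \<nu>. (curvature_var \<kappa> A H \<mu> \<nu> x)\<^sup>\<dagger>, 0))"
  have "smooth (\<lambda>x. if \<mu> = \<kappa> then \<Psi> x ** H x else 0)"
    and "smooth (\<lambda>x. if \<mu> = \<kappa> then (\<Psi> x ** H x)\<^sup>\<dagger> else 0)" for \<mu>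
    by (cases "\<mu> = \<kappa>"; simp add: smooth_const smooth_dagger smooth_matrix_mult \<Psi> R(1))+
  then have sv: "smooth v"
    unfolding v_def potential_var_def
    by (intro smooth_Pair smooth_block_col smooth_block_row smooth_const)
  have "smooth (curvature_var \<kappa> A H \<mu> \<nu>)" for \<mu> \<nu>
  proof -
    have "smooth (\<lambda>x. if b then adj_d A H \<mu> x else 0)" for b \<mu>
      by (cases b) (simp_all add: smooth_const smooth_adj_d[where A = A, OF R(1) smooth_A])
    then show ?thesis unfolding curvature_var_def[abs_def] by (intro smooth_diff)
  qed
  then have sw: "smooth w"
    unfolding w_def by (intro smooth_Pair smooth_vec smooth_dagger smooth_const)
  have zv: "v x = 0" if "norm x > R" for x
    using R(2)[OF that]
    by (simp add: v_def potential_var_def zero_prod_def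
        bounded_bilinear.zero_right[OF bounded_bilinear_matrix_mult] cong: if_cong)
  have zw: "w x = 0" if x: "norm x > R" for x
  proof -
    have "adj_d A H \<mu> x = 0" for \<mu>
      by (rule adj_d_zero_outside[of R]) (use R x in auto)
    then show ?thesis by (simp add: w_def curvature_var_def zero_prod_def vec_eq_iff)
  qed
  note fL = first_variation[OF smooth_L smooth_continuous[OF smooth_static] smooth_continuous[OF sv] zv]
  note fG = first_variation[OF smooth_G smooth_continuous[OF smooth_gauge_arg_of[OF smooth_A]]
      smooth_continuous[OF sw] zw]
  let ?dL = "\<lambda>x. frechet_derivative L (at (?s x)) (v x)"
  let ?dG = "\<lambda>x. frechet_derivative G (at (?t x)) (w x)"
  have iL: "integrable lborel (\<lambda>x. L (?s x + \<epsilon> *\<^sub>R v x) - L (?s x))"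
    and iG: "integrable lborel (\<lambda>x. G (?t x + \<epsilon> *\<^sub>R w x) - G (?t x))" for \<epsilon>
    by (rule fL(2), assumption) (rule fG(2), assumption)
  have dL: "((\<lambda>\<epsilon>. \<integral>x. L (?s x + \<epsilon> *\<^sub>R v x) - L (?s x) \<partial>lborel) has_vector_derivative
      (\<integral>x. ?dL x \<partial>lborel)) (at 0)"
    and dG: "((\<lambda>\<epsilon>. \<integral>x. G (?t x + \<epsilon> *\<^sub>R w x) - G (?t x) \<partial>lborel) has_vector_derivative
      (\<integral>x. ?dG x \<partial>lborel)) (at 0)"
    and idL: "integrable lborel ?dL" and idG: "integrable lborel ?dG"
    by (rule fL(1) fG(1) fL(3) fG(3), assumption)+
  have "(\<integral>x. dyn_density L G \<Psi> (A(\<kappa> := (\<lambda>y. A \<kappa> y + \<epsilon> *\<^sub>R H y))) x - dyn_density L G \<Psi> A x \<partial>lborel)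
      = (\<integral>x. L (?s x + \<epsilon> *\<^sub>R v x) - L (?s x) \<partial>lborel) + (\<integral>x. G (?t x + \<epsilon> *\<^sub>R w x) - G (?t x) \<partial>lborel)" for \<epsilon>
    unfolding Bochner_Integration.integral_add[OF iL iG, symmetric]
    by (simp add: dyn_density_def static_arg_potential_var[OF \<Psi>] gauge_arg_of_var[where A = A and H = H, OF smooth_A R(1)]
        v_def w_def algebra_simps)
  moreover have "(\<integral>x. ?dL x \<partial>lborel) + (\<integral>x. ?dG x \<partial>lborel) = of_real (\<integral>x. gauge_EL \<kappa> x \<bullet> H x \<partial>lborel)"
  proof -
    define W where "W = (\<lambda>x. proj ((\<Psi> x)\<^sup>\<dagger> ** ((L_col L \<kappa> (?s x))\<^sup>\<dagger> + L_row L \<kappa> (?s x))))"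
    define K where "K = (\<lambda>\<mu> x. proj (G_hat G A \<mu> \<kappa> x))"
    define f where "f = (\<lambda>\<mu> x. 2 *\<^sub>R (K \<mu> x)\<^sup>\<dagger>)"
    \<comment> \<open>The terms algebraic in \<open>H\<close>. The bracket has sign + because the
      minus sign of \<open>adj_d\<close> cancels that of \<open>comm\<close> below.\<close>
    define f0 where "f0 = (\<lambda>x. (W x + 2 *\<^sub>R (\<Sum>\<mu>\<in>UNIV. (commutator (A \<mu> x) (K \<mu> x))\<^sup>\<dagger>)) \<bullet> H x)"
    have sK: "smooth (K \<mu>)" for \<mu>
      unfolding K_def by (rule smooth_proj_G_hat)
    have sf: "smooth (f \<mu>)" for \<mu>
      unfolding f_def by (intro smooth_scaleR smooth_dagger sK)
    have f0: "continuous_on UNIV f0"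
      unfolding f0_def W_def
      by (intro smooth_continuous smooth_bilinear[OF bounded_bilinear_inner] smooth_add smooth_proj
          smooth_matter_current smooth_scaleR smooth_sum smooth_dagger smooth_commutator smooth_A sK R(1))
    have z: "f0 x = 0" if "norm x > R" for x
      by (simp only: f0_def R(2)[OF that] inner_zero_right)
    \<comment> \<open>Cyclicity of the trace passes the bracket with the potential from
      \<open>H\<close> to the projected \<open>G_hat\<close>.\<close>
    have comm: "X\<^sup>\<dagger> \<bullet> commutator Y Z = - ((commutator Y X)\<^sup>\<dagger> \<bullet> Z)" for X Y Z :: "complex^'c^'c"
    proof -
      have "trace (X ** (Z ** Y)) = trace (Y ** X ** Z)"
        by (metis matrix_mul_assoc trace_mul_sym)
      then show ?thesis
        by (simp add: inner_matrix_eq commutator_def matrix_mult_algebra matrix_mul_assoc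
            bounded_linear.linear[OF bounded_linear_trace, THEN linear_diff])
    qed
    have pt: "?dL x + ?dG x = of_real (f0 x + (\<Sum>\<mu>\<in>UNIV. f \<mu> x \<bullet> partial_d \<mu> H x))" for x
    proof -
      have "?dL x + ?dG x = of_real (W x \<bullet> H x + 2 * (\<Sum>\<mu>\<in>UNIV. (K \<mu> x)\<^sup>\<dagger> \<bullet> adj_d A H \<mu> x))"
        unfolding v_def w_def matter_derivative_potential_var[OF Hg]
          gauge_derivative_curvature_var[OF R(1) Hg]
        by (simp add: W_def K_def inner_commute[of _ "H x"] proj_inner[OF Hg])
      also have "W x \<bullet> H x + 2 * (\<Sum>\<mu>\<in>UNIV. (K \<mu> x)\<^sup>\<dagger> \<bullet> adj_d A H \<mu> x)
          = f0 x + (\<Sum>\<mu>\<in>UNIV. f \<mu> x \<bullet> partial_d \<mu> H x)"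
        by (simp add: f0_def f_def adj_d_def inner_diff_right inner_add_left comm sum.distrib
            inner_sum_left sum_distrib_left)
      finally show ?thesis .
    qed
    have "(\<integral>x. ?dL x \<partial>lborel) + (\<integral>x. ?dG x \<partial>lborel) = (\<integral>x. of_real (f0 x + (\<Sum>\<mu>\<in>UNIV. f \<mu> x \<bullet> partial_d \<mu> H x)) \<partial>lborel)"
      unfolding pt[symmetric] by (rule Bochner_Integration.integral_add[OF idL idG, symmetric])
    also have "\<dots> = of_real (\<integral>x. f0 x + (\<Sum>\<mu>\<in>UNIV. f \<mu> x \<bullet> partial_d \<mu> H x) \<partial>lborel)"
      by (rule integral_complex_of_real)
    also have "(\<integral>x. f0 x + (\<Sum>\<mu>\<in>UNIV. f \<mu> x \<bullet> partial_d \<mu> H x) \<partial>lborel)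
        = (\<integral>x. f0 x - (\<Sum>\<mu>\<in>UNIV. partial_d \<mu> (f \<mu>) x \<bullet> H x) \<partial>lborel)"
      by (simp only: integral_by_parts_sum[OF bounded_bilinear_inner sf R f0 z])
    also have "(\<lambda>x. f0 x - (\<Sum>\<mu>\<in>UNIV. partial_d \<mu> (f \<mu>) x \<bullet> H x)) = (\<lambda>x. gauge_EL \<kappa> x \<bullet> H x)"
    proof
      fix x
      have "partial_d \<mu> (f \<mu>) x = 2 *\<^sub>R (partial_d \<mu> (K \<mu>) x)\<^sup>\<dagger>" for \<mu>
        unfolding f_def
        by (simp add: partial_d_bounded_linear[OF smooth_dagger[OF sK] bounded_linear_scaleR_right]
            partial_d_dagger[OF sK])
      then show "f0 x - (\<Sum>\<mu>\<in>UNIV. partial_d \<mu> (f \<mu>) x \<bullet> H x) = gauge_EL \<kappa> x \<bullet> H x"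
        by (simp add: f0_def gauge_EL_def W_def K_def inner_diff_left inner_add_left inner_sum_left
            dagger_diff sum_subtractf sum_distrib_left algebra_simps)
    qed
    finally show ?thesis .
  qed
  ultimately show ?thesis
    using has_vector_derivative_add[OF dL dG] by simp
qed

lemma stationary_gauge_iff_EL: "stationary_gauge \<gg> L G \<Psi> A \<kappa> \<longleftrightarrow> (\<forall>x. gauge_EL \<kappa> x = 0)"
proof
  assume "stationary_gauge \<gg> L G \<Psi> A \<kappa>"
  have "(\<integral>x. gauge_EL \<kappa> x \<bullet> H x \<partial>lborel) = 0" if "test_function H" "\<And>x. H x \<in> \<gg>" for H
  proof -
    have "of_real (\<integral>x. gauge_EL \<kappa> x \<bullet> H x \<partial>lborel) = (0 :: complex)"
      using \<open>stationary_gauge \<gg> L G \<Psi> A \<kappa>\<close> that unfolding stationary_gauge_def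
      by (intro has_vector_derivative_eq_iff[THEN iffD1, OF gauge_variation[OF that]]) blast
    then show ?thesis by simp
  qed
  then show "\<forall>x. gauge_EL \<kappa> x = 0"
    using fundamental_lemma[OF smooth_continuous[OF smooth_gauge_EL] subspace gauge_EL_in] by blast
next
  assume "\<forall>x. gauge_EL \<kappa> x = 0"
  then show "stationary_gauge \<gg> L G \<Psi> A \<kappa>"
    using gauge_variation[of _ \<kappa>] by (simp add: stationary_gauge_def)
qed

section \<open>The algebra attached to a Hermitian involution\<close>

lemma projection_J:
  assumes J: "J\<^sup>\<dagger> = J" "J ** J = mat 1" and \<gg>: "\<gg> = {X. X\<^sup>\<dagger> ** J + J ** X = 0}"
  shows "proj X = (1 / 2) *\<^sub>R (X - J ** X\<^sup>\<dagger> ** J)"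
proof -
  have JJ: "J ** (J ** Z) = Z" "Z ** J ** J = Z" for Z :: "complex^'c^'c"
    by (simp_all add: matrix_mul_assoc J) (simp add: matrix_mul_assoc[symmetric] J)
  \<comment> \<open>The map sending \<open>X\<close> to
    \<open>- (J ** X\<^sup>\<dagger> ** J)\<close> is a real-linear isometric involution with fixed
    set \<open>\<gg>\<close>; its average with the identity is the orthogonal projection.\<close>
  define Z where "Z = (1 / 2) *\<^sub>R (X - J ** X\<^sup>\<dagger> ** J)"
  have "Z\<^sup>\<dagger> ** J + J ** Z = 0"
    by (simp add: Z_def dagger_scaleR dagger_diff dagger_mult J(1) matrix_mult_algebra
        matrix_mul_assoc JJ J(2) algebra_simps)
  then have "Z \<in> \<gg>" using \<gg> by blast
  moreover have "Y \<bullet> (X - Z) = 0" if Y: "Y \<in> \<gg>" for Y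
  proof -
    \<comment> \<open>Membership of \<open>Y\<close> makes \<open>X\<close> and
      \<open>J ** X\<^sup>\<dagger> ** J\<close> have opposite inner products with \<open>Y\<close>,
      so their sum is orthogonal to \<open>Y\<close>.\<close>
    have "Y\<^sup>\<dagger> ** J = - (J ** Y)" using Y \<gg> by (auto simp: eq_neg_iff_add_eq_0)
    then have "Y\<^sup>\<dagger> ** (J ** X\<^sup>\<dagger> ** J) = - (J ** Y ** X\<^sup>\<dagger> ** J)"
      by (simp add: matrix_mul_assoc matrix_mult_algebra)
    then have "Y \<bullet> (J ** X\<^sup>\<dagger> ** J) = - Re (trace (J ** (Y ** X\<^sup>\<dagger> ** J)))"
      by (simp add: inner_matrix_eq matrix_mul_assoc bounded_linear.linear[OF bounded_linear_trace, THEN linear_neg])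
    also have "trace (J ** (Y ** X\<^sup>\<dagger> ** J)) = trace (Y ** X\<^sup>\<dagger>)"
      by (subst trace_mul_sym) (simp add: JJ)
    also have "\<dots> = cnj (trace (X ** Y\<^sup>\<dagger>))"
      by (subst trace_dagger[symmetric]) (simp add: dagger_mult)
    also have "trace (X ** Y\<^sup>\<dagger>) = trace (Y\<^sup>\<dagger> ** X)" by (rule trace_mul_sym)
    finally have "Y \<bullet> (J ** X\<^sup>\<dagger> ** J) = - (Y \<bullet> X)" by (simp add: inner_matrix_eq)
    moreover have "X - Z = (1 / 2) *\<^sub>R (X + J ** X\<^sup>\<dagger> ** J)"
      by (simp add: Z_def scaleR_add_right scaleR_diff_right)
    ultimately show ?thesis by (simp add: inner_add_right)
  qed
  ultimately show ?thesis
    using projection_characterization[OF projection subspace, of X Z] by (simp add: Z_def)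
qed

text \<open>Multiplication by 1/i exchanges this \<open>\<gg>\<close> with its orthogonal
  complement, so the condition on \<open>proj\<close> says that U - T lies in \<open>\<gg>\<close>.
  This makes the two halves in the projection of U + T equal, which removes the projection and the
  factor 1/2.\<close>

lemma matter_current_J:
  assumes J: "J\<^sup>\<dagger> = J" "J ** J = mat 1" and \<gg>: "\<gg> = {X. X\<^sup>\<dagger> ** J + J ** X = 0}"
  defines "a \<equiv> static_arg \<Psi> A"
  shows "(proj ((\<Psi> x)\<^sup>\<dagger> ** ((L_col L \<kappa> (a x))\<^sup>\<dagger> + L_row L \<kappa> (a x))))\<^sup>\<dagger>
    = L_col L \<kappa> (a x) ** \<Psi> x - J ** (\<Psi> x)\<^sup>\<dagger> ** L_row L \<kappa> (a x) ** J"
proof -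
  define U where "U = (\<Psi> x)\<^sup>\<dagger> ** (L_col L \<kappa> (a x))\<^sup>\<dagger>"
  define T where "T = (\<Psi> x)\<^sup>\<dagger> ** L_row L \<kappa> (a x)"
  have J': "J ** (J ** Z ** J) ** J = Z" for Z
    by (metis J(2) matrix_mul_assoc matrix_mul_lid matrix_mul_rid)
  have "proj (cscale (1 / \<i>) (U - T)) = 0"
    using matter_proj[of "\<Psi> x" \<kappa> "block_col (\<lambda>\<mu>. cov_d \<Psi> A \<mu> x)" x]
    by (simp add: U_def T_def a_def static_arg_eq[OF \<Psi>] matrix_mult_algebra)
  then have "cscale (1 / \<i>) (U - T) - J ** (cscale (1 / \<i>) (U - T))\<^sup>\<dagger> ** J = 0"
    unfolding projection_J[OF J \<gg>] by simp
  moreover have "Y ** cscale z X = cscale z (Y ** X)" for Y X :: "complex^'c^'c" and z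
    by (simp add: vec_eq_iff matrix_matrix_mult_def sum_distrib_left mult.left_commute)
  ultimately have "cscale (1 / \<i>) ((U - T) + J ** (U - T)\<^sup>\<dagger> ** J) = 0"
    by (simp add: dagger_cscale cscale_mult_left vec_eq_iff algebra_simps)
  then have "(U - T) + J ** (U - T)\<^sup>\<dagger> ** J = 0"
    by (simp add: vec_eq_iff)
  then have 1: "U + J ** U\<^sup>\<dagger> ** J = T + J ** T\<^sup>\<dagger> ** J"
    by (simp add: dagger_diff matrix_mult_algebra algebra_simps)
  have "J ** (U + J ** U\<^sup>\<dagger> ** J) ** J = J ** (T + J ** T\<^sup>\<dagger> ** J) ** J"
    by (simp only: 1)
  then have 2: "J ** U ** J + U\<^sup>\<dagger> = J ** T ** J + T\<^sup>\<dagger>"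
    by (simp add: matrix_mult_algebra J')
  have "(proj (U + T))\<^sup>\<dagger> = (1 / 2) *\<^sub>R ((U\<^sup>\<dagger> - J ** T ** J) + (T\<^sup>\<dagger> - J ** U ** J))"
    unfolding projection_J[OF J \<gg>]
    by (simp add: dagger_scaleR dagger_diff dagger_add dagger_mult J(1) matrix_mult_algebra
        matrix_mul_assoc algebra_simps)
  also have "T\<^sup>\<dagger> - J ** U ** J = U\<^sup>\<dagger> - J ** T ** J"
    using 2 by (simp add: algebra_simps)
  also have "(1 / 2) *\<^sub>R ((U\<^sup>\<dagger> - J ** T ** J) + (U\<^sup>\<dagger> - J ** T ** J)) = U\<^sup>\<dagger> - J ** T ** J"
    by (rule scaleR_half_double)
  finally show ?thesis
    by (simp add: U_def T_def matrix_mult_algebra dagger_mult matrix_mul_assoc)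
qed

text \<open>Vanishing is invariant under the dagger, which lifts the dagger off the sum and leaves
  the matter term in the form of \<open>matter_current_J\<close>.\<close>

lemma gauge_EL_J:
  assumes J: "J\<^sup>\<dagger> = J" "J ** J = mat 1" and \<gg>: "\<gg> = {X. X\<^sup>\<dagger> ** J + J ** X = 0}"
  shows "gauge_EL \<kappa> x = 0 \<longleftrightarrow> L_col L \<kappa> (static_arg \<Psi> A x) ** \<Psi> x
     - J ** (\<Psi> x)\<^sup>\<dagger> ** L_row L \<kappa> (static_arg \<Psi> A x) ** J
     - 2 *\<^sub>R (\<Sum>\<mu>\<in>UNIV. partial_d \<mu> (\<lambda>y. proj (G_hat G A \<mu> \<kappa> y)) x
          - commutator (A \<mu> x) (proj (G_hat G A \<mu> \<kappa> x))) = 0"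
proof -
  have "gauge_EL \<kappa> x = 0 \<longleftrightarrow> (gauge_EL \<kappa> x)\<^sup>\<dagger> = 0"
    by (metis dagger_0 dagger_dagger)
  then show ?thesis
    by (simp only: gauge_EL_def dagger_diff[of "proj _"] dagger_scaleR dagger_sum dagger_dagger matter_current_J[OF assms])
qed

end

theorem theorem5p5:
  fixes \<GG> \<gg> :: "(complex^'c::finite^'c) set"
    and proj :: "complex^'c^'c \<Rightarrow> complex^'c^'c"
    and L :: "('n::{finite,linorder}, 'r::finite, 'c) matter_arg \<Rightarrow> complex"
    and G :: "('n, 'c) gauge_arg \<Rightarrow> complex"
    and \<Psi> :: "('n, 'r, 'c) matter_field"
    and A :: "('n, 'c) potential"
  assumes Lie_group: "matrix_Lie_group \<GG>"
    and Lie_alg: "\<gg> = Lie_algebra \<GG>"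
    and subspace: "subspace \<gg>"
    and dagger_closed: "dagger ` \<gg> = \<gg>"
    and projection: "real_orthogonal_projection \<gg> proj"
    and matter: "matter_proto_lagrangian L"
    and matter_real: "real_valued_functional L"
    and matter_proj: "\<And>P R x \<kappa>.
      proj (cscale (1 / \<i>)
           (P\<^sup>\<dagger> ** ((L_col L \<kappa> (P, P\<^sup>\<dagger>, R, R\<^sup>\<dagger>, x))\<^sup>\<dagger> - L_row L \<kappa> (P, P\<^sup>\<dagger>, R, R\<^sup>\<dagger>, x)))) = 0"
    and gauge: "gauge_proto_lagrangian \<gg> G"
    and gauge_star: "\<And>B \<theta> \<rho> x. gauge_field \<gg> B \<Longrightarrow> \<theta> < \<rho> \<Longrightarrow>
      G_Q G \<theta> \<rho> (gauge_arg_of B x) = (G_P G \<theta> \<rho> (gauge_arg_of B x))\<^sup>\<dagger>"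
    and \<Psi>: "smooth \<Psi>"
    and A: "gauge_field \<gg> A"
  shows
    "(stationary_matter L G \<Psi> A \<longleftrightarrow>
        (\<forall>x. L_o L (static_arg \<Psi> A x)
           - (\<Sum>\<mu>\<in>UNIV. partial_d \<mu> (\<lambda>y. L_col L \<mu> (static_arg \<Psi> A y)) x
                - A \<mu> x ** L_col L \<mu> (static_arg \<Psi> A x)) = 0)) \<and>
     (\<forall>\<kappa>. stationary_gauge \<gg> L G \<Psi> A \<kappa> \<longleftrightarrow>
        (\<forall>x. proj ((\<Psi> x)\<^sup>\<dagger> ** ((L_col L \<kappa> (static_arg \<Psi> A x))\<^sup>\<dagger> + L_row L \<kappa> (static_arg \<Psi> A x)))
           - 2 *\<^sub>R (\<Sum>\<mu>\<in>UNIV. (partial_d \<mu> (\<lambda>y. proj (G_hat G A \<mu> \<kappa> y)) x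
                - commutator (A \<mu> x) (proj (G_hat G A \<mu> \<kappa> x)))\<^sup>\<dagger>) = 0)) \<and>
     (\<forall>J. J\<^sup>\<dagger> = J \<and> J ** J = mat 1 \<and> \<gg> = {X. X\<^sup>\<dagger> ** J + J ** X = 0} \<longrightarrow>
       (\<forall>\<kappa>.
        (\<forall>x. proj ((\<Psi> x)\<^sup>\<dagger> ** ((L_col L \<kappa> (static_arg \<Psi> A x))\<^sup>\<dagger> + L_row L \<kappa> (static_arg \<Psi> A x)))
           - 2 *\<^sub>R (\<Sum>\<mu>\<in>UNIV. (partial_d \<mu> (\<lambda>y. proj (G_hat G A \<mu> \<kappa> y)) x
                - commutator (A \<mu> x) (proj (G_hat G A \<mu> \<kappa> x)))\<^sup>\<dagger>) = 0)
        \<longleftrightarrow>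
        (\<forall>x. L_col L \<kappa> (static_arg \<Psi> A x) ** \<Psi> x
           - J ** (\<Psi> x)\<^sup>\<dagger> ** L_row L \<kappa> (static_arg \<Psi> A x) ** J
           - 2 *\<^sub>R (\<Sum>\<mu>\<in>UNIV. partial_d \<mu> (\<lambda>y. proj (G_hat G A \<mu> \<kappa> y)) x
                - commutator (A \<mu> x) (proj (G_hat G A \<mu> \<kappa> x))) = 0)))"
proof -
  interpret dynamic_extension \<GG> \<gg> proj L G \<Psi> A
    by unfold_locales (fact assms)+
  show ?thesis
    using stationary_matter_iff_EL stationary_gauge_iff_EL gauge_EL_J
    unfolding matter_EL_def gauge_EL_def by blast
qed

end
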